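(* Let $\Sigma$ be a collection of elements of $X^*(\mathbb{T})$ with finite multiplicities such that for all $w\in\mathbb{W}$ the collections $w(\Sigma)\setminus\Sigma$ and $\Sigma\setminus w(\Sigma)$ are finite. Then $\mathbf{H}_\Sigma=\mathbf{H}\cap\Pi_\Sigma^{-1}\mathbf{H}\Pi_\Sigma$ is equal to the set of all $f=\sum_{w\in\mathbb{W}}f_w[w]\in Q[\mathbb{W}]$ satisfying the following four conditions: (1) For any $w\in\mathbb{W}$, the rational function $f_w$ has no singularities other than finitely many first order poles at $\mathfrak{h}_\alpha$, where $\alpha\in\Phi^{\mathrm{re}}_+$. (2a) For any $w\in\mathbb{W}$ and $\alpha\in\Phi^{\mathrm{re}}_+$, $\operatorname{Res}_{\mathfrak{h}_\alpha}(f_w)+\operatorname{Res}_{\mathfrak{h}_\alpha}(f_{s_\alpha w})=0$. (2b) For any $w\in\mathbb{W}$ and $\alpha\in\Phi^{\mathrm{re}}_+$, $\operatorname{Res}_{\mathfrak{h}_\alpha}\!\left(\frac{\Pi_\Sigma}{\Pi_{w(\Sigma)}}f_w\right)+\operatorname{Res}_{\mathfrak{h}_\alpha}\!\left(\frac{\Pi_\Sigma}{\Pi_{s_\alpha w(\Sigma)}}f_{s_\alpha w}\right)=0$. (3) For any $w\in\mathbb{W}$, the rational function $\frac{f_w}{\widetilde\Pi_{w(\Sigma),\Sigma}}$ has no singularities other than finitely many first order poles at $\mathfrak{h}_\alpha$, where $\alpha\in\Phi^{\mathrm{re}}_+$.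
   Context: Setting (either of two cases). (i) Kac–Moody case: $A=(a_{ij})$ is a symmetrizable generalized Cartan matrix with a root datum: a free abelian group $\mathbb{X}$, its dual $\mathbb{X}^\vee$, linearly independent simple roots $\alpha_1,\dots,\alpha_n\in\mathbb{X}$ and linearly independent simple coroots $\alpha_i^\vee\in\mathbb{X}^\vee$ with $\langle\alpha_i^\vee,\alpha_j\rangle=a_{ij}$. $\mathbb{T}$ is the torus with character lattice $X^*(\mathbb{T})=\mathbb{X}$, $\mathfrak{h}=\mathbb{C}\otimes\mathbb{X}^\vee$, $\mathbb{W}$ is the Weyl group with its Bruhat order, $\Phi^{\mathrm{re}}_+$ the positive real roots, $S=\mathbb{C}[\mathfrak{h}]$, $Q=\mathbb{C}(\mathfrak{h})$. (ii) Extended affine case: $G$ is a finite dimensional complex reductive group with simply connected derived subgroup, maximal torus $T$ and Weyl group $W$; $\mathbb{G}=G(\mathbb{C}((\varpi)))\rtimes\mathbb{C}^*_{\mathrm{rot}}$ (or its product with an extra torus $\mathbb{C}^*_{\mathrm{dil}}$), $\mathbb{T}=T\times\mathbb{C}^*_{\mathrm{rot}}$ (resp. $T\times\mathbb{C}^*_{\mathrm{rot}}\times\mathbb{C}^*_{\mathrm{dil}}$), $\mathfrak{h}=\operatorname{Lie}\mathbb{T}$, roots are the affine roots, $\mathbb{W}=X_*(T)\rtimes W$ is the extended affine Weyl group acting on $\mathbb{T}$ and $\mathfrak{h}$, $S=\mathbb{C}[\mathfrak{h}]$, and $Q$ is the ring of rational functions on $\mathfrak{h}$ with no poles along imaginary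 root hyperplanes. Here $\mathbb{W}=W_{\mathrm{aff}}\rtimes\Omega$, with $W_{\mathrm{aff}}$ the Coxeter group generated by simple affine reflections and $\Omega$ the elements of length $0$. $Q[\mathbb{W}]=Q\otimes\mathbb{C}[\mathbb{W}]$ with elements $\sum f_w[w]$ and product $f_1[w_1]\cdot f_2[w_2]=f_1w_1(f_2)[w_1w_2]$. For a simple root, $D_{s_i}=-\frac1{\alpha_i}[s_{\alpha_i}]+\frac1{\alpha_i}[1]$; $D_w=D_{s_{i_1}}\cdots D_{s_{i_\ell}}$ for a reduced expression $w=s_{i_1}\cdots s_{i_\ell}$ (independent of choice); in case (ii), $D_{a\omega}=D_a[\omega]$ for $a\in W_{\mathrm{aff}},\omega\in\Omega$. The nil-Hecke algebra $\mathbf{H}$ is the subring of $Q[\mathbb{W}]$ generated by $S$ and all $D_w$. Characters $\lambda\in X^*(\mathbb{T})$ are viewed as linear functions on $\mathfrak{h}$. If $\lambda$ occurs $m_\lambda\in\mathbb{Z}_{\ge0}$ times in $\Sigma$, then $\Pi_\Sigma=\prod_\lambda\lambda^{m_\lambda}$ is a formal symbol (possibly an infinite product), but $\frac{\Pi_\Sigma}{\Pi_{w(\Sigma)}}=\prod_\lambda\lambda^{m_\lambda-m_{w^{-1}\lambda}}$ is a well-defined rational function; write it in lowest terms as $\frac{\Pi_\Sigma}{\Pi_{w(\Sigma)}}=\frac{\widetilde\Pi_{\Sigma,w(\Sigma)}}{\widetilde\Pi_{w(\Sigma),\Sigma}}$ with $\widetilde\Pi_{\Sigma,w(\Sigma)},\widetilde\Pi_{w(\Sigma),\Sigma}\in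 S$ coprime. Set $\Pi_\Sigma^{-1}\big(\sum f_w[w]\big)\Pi_\Sigma:=\sum f_w\frac{\Pi_{w(\Sigma)}}{\Pi_\Sigma}[w]$ and $\mathbf{H}_\Sigma:=\mathbf{H}\cap\Pi_\Sigma^{-1}\mathbf{H}\Pi_\Sigma\subset Q[\mathbb{W}]$. $\mathfrak{h}_\alpha=\ker\alpha\subset\mathfrak{h}$, $s_\alpha$ is the reflection in $\alpha$, and for a function $g$ with at most a first order pole along $\mathfrak{h}_\alpha$, $\operatorname{Res}_{\mathfrak{h}_\alpha}(g)$ denotes its residue, i.e. $(\alpha g)|_{\mathfrak{h}_\alpha}$. *)

theory Defs
  imports
    Complex_Main
    "HOL-Library.Poly_Mapping"
    "HOL-Library.Set_Algebras"
    "HOL-Computational_Algebra.Fraction_Field"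
begin

section \<open>Lattices and reflections\<close>

text \<open>
  A free abelian group of rank \<open>N\<close> is the set of integer sequences supported on \<open>{..<N}\<close>,
  and its dual is the same set, paired by the standard pairing. The groups
  \<open>\<W>\<close> below consist of additive bijections of \<^typ>\<open>nat \<Rightarrow> int\<close> which preserve
  the lattice and are determined by their restriction to it; the group law is composition.
\<close>

type_synonym weight = "nat \<Rightarrow> int"
type_synonym weyl = "weight \<Rightarrow> weight"

definition lattice :: "nat \<Rightarrow> weight set" where
  "lattice N = {v. \<forall>j\<ge>N. v j = 0}"

definition unit_vec :: "nat \<Rightarrow> weight" where
  "unit_vec i = (\<lambda>j. if j = i then 1 else 0)"

definition pairing :: "nat \<Rightarrow> weight \<Rightarrow> weight \<Rightarrow> int" where
  "pairing N \<mu> v = (\<Sum>i<N. \<mu> i * v i)"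

definition reflection :: "nat \<Rightarrow> weight \<Rightarrow> weight \<Rightarrow> weyl" where
  "reflection N c a = (\<lambda>v j. v j - pairing N c v * a j)"

definition int_independent :: "'i set \<Rightarrow> ('i \<Rightarrow> weight) \<Rightarrow> bool" where
  "int_independent I v \<longleftrightarrow>
     (\<forall>c :: 'i \<Rightarrow> int. (\<forall>j. (\<Sum>i\<in>I. c i * v i j) = 0) \<longrightarrow> (\<forall>i\<in>I. c i = 0))"

definition int_span :: "weight set \<Rightarrow> weight set" where
  "int_span B = {v. \<exists>c :: weight \<Rightarrow> int. v = (\<lambda>j. \<Sum>b\<in>B. c b * b j)}"

definition nonneg_span :: "weight set \<Rightarrow> weight set" where
  "nonneg_span B = {v. \<exists>c :: weight \<Rightarrow> nat. v = (\<lambda>j. \<Sum>b\<in>B. int (c b) * b j)}"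

definition word_prod :: "('a \<Rightarrow> weyl) \<Rightarrow> 'a list \<Rightarrow> weyl" where
  "word_prod s is = foldr (\<lambda>i u. s i \<circ> u) is id"

text \<open>
  Reflections being involutions, the group they generate consists of the products of words in them.
\<close>

definition refl_group :: "('a \<Rightarrow> weyl) \<Rightarrow> 'a set \<Rightarrow> weyl set" where
  "refl_group s I = {word_prod s is | is. set is \<subseteq> I}"


section \<open>The data common to the two cases\<close>

text \<open>
  \<open>rank\<close> is the rank of \<open>X\<^sup>*(\<T>)\<close>; \<open>imag_roots\<close> are the imaginary roots along which elements of
  \<open>Q\<close> are required to be regular (none in the Kac--Moody case, where \<open>Q\<close> is the full field of
  fractions); \<open>Omega\<close> is the group of elements of length 0 (trivial in the Kac--Moody
  case); \<open>refl \<alpha>\<close> is the reflection in the real root \<open>\<alpha>\<close>, and is used on real roots only.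
\<close>

record setting =
  rank :: nat
  imag_roots :: "weight set"
  weyl_group :: "weyl set"
  Omega :: "weyl set"
  simple :: "weight set"
  pos_re :: "weight set"
  refl :: "weight \<Rightarrow> weyl"


subsection \<open>Case (i): Kac--Moody root data\<close>

record km_datum =
  km_size :: nat
  km_cartan :: "nat \<Rightarrow> nat \<Rightarrow> int"
  km_rank :: nat
  km_root :: "nat \<Rightarrow> weight"
  km_coroot :: "nat \<Rightarrow> weight"

definition symmetrizable_gcm :: "nat \<Rightarrow> (nat \<Rightarrow> nat \<Rightarrow> int) \<Rightarrow> bool" where
  "symmetrizable_gcm n A \<longleftrightarrow>
     (\<forall>i<n. A i i = 2) \<and>
     (\<forall>i<n. \<forall>j<n. i \<noteq> j \<longrightarrow> A i j \<le> 0) \<and>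
     (\<forall>i<n. \<forall>j<n. A i j = 0 \<longrightarrow> A j i = 0) \<and>
     (\<exists>d :: nat \<Rightarrow> rat. (\<forall>i<n. d i > 0) \<and>
        (\<forall>i<n. \<forall>j<n. d i * of_int (A i j) = d j * of_int (A j i)))"

definition km_root_datum :: "km_datum \<Rightarrow> bool" where
  "km_root_datum K \<longleftrightarrow>
     symmetrizable_gcm (km_size K) (km_cartan K) \<and>
     (\<forall>i<km_size K. km_root K i \<in> lattice (km_rank K) \<and> km_coroot K i \<in> lattice (km_rank K)) \<and>
     int_independent {..<km_size K} (km_root K) \<and>
     int_independent {..<km_size K} (km_coroot K) \<and>
     (\<forall>i<km_size K. \<forall>j<km_size K.
        pairing (km_rank K) (km_coroot K i) (km_root K j) = km_cartan K i j)"

definition km_simple_refl :: "km_datum \<Rightarrow> nat \<Rightarrow> weyl" where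
  "km_simple_refl K i = reflection (km_rank K) (km_coroot K i) (km_root K i)"

definition km_weyl :: "km_datum \<Rightarrow> weyl set" where
  "km_weyl K = refl_group (km_simple_refl K) {..<km_size K}"

definition km_real_roots :: "km_datum \<Rightarrow> weight set" where
  "km_real_roots K = {w (km_root K i) | w i. w \<in> km_weyl K \<and> i < km_size K}"

text \<open>For a real root \<open>\<alpha> = w \<alpha>\<^sub>i\<close> the reflection \<open>w s\<^sub>i w\<inverse>\<close> depends only on \<open>\<alpha>\<close>.\<close>

definition km_refl :: "km_datum \<Rightarrow> weight \<Rightarrow> weyl" where
  "km_refl K \<alpha> = (SOME s. \<exists>w\<in>km_weyl K. \<exists>i<km_size K.
     \<alpha> = w (km_root K i) \<and> s = w \<circ> km_simple_refl K i \<circ> inv w)"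

definition km_setting :: "km_datum \<Rightarrow> setting" where
  "km_setting K = \<lparr>
     rank = km_rank K,
     imag_roots = {},
     weyl_group = km_weyl K,
     Omega = {id},
     simple = km_root K ` {..<km_size K},
     pos_re = km_real_roots K \<inter> nonneg_span (km_root K ` {..<km_size K}),
     refl = km_refl K \<rparr>"


subsection \<open>Case (ii): extended affine Weyl groups\<close>

text \<open>
  A complex reductive group \<open>G\<close> with maximal torus \<open>T\<close> and a Borel subgroup containing it is
  given by its reduced root datum \<open>(X\<^sup>*(T), \<Phi>, X\<^sub>*(T), \<Phi>\<^sup>\<or>)\<close> of rank \<open>rd_rank\<close> together with a
  base of \<open>\<Phi>\<close>. The last flag tells whether the torus \<open>\<complex>\<^sup>*\<close> of dilations is present.
\<close>

record reductive_datum =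
  rd_rank :: nat
  rd_roots :: "weight set"
  rd_coroot :: "weight \<Rightarrow> weight"
  rd_base :: "weight set"
  rd_dil :: bool

definition reductive_root_datum :: "reductive_datum \<Rightarrow> bool" where
  "reductive_root_datum R \<longleftrightarrow>
     finite (rd_roots R) \<and>
     rd_roots R \<subseteq> lattice (rd_rank R) \<and>
     rd_coroot R ` rd_roots R \<subseteq> lattice (rd_rank R) \<and>
     inj_on (rd_coroot R) (rd_roots R) \<and>
     (\<forall>\<alpha>\<in>rd_roots R. pairing (rd_rank R) (rd_coroot R \<alpha>) \<alpha> = 2) \<and>
     (\<forall>\<alpha>\<in>rd_roots R. reflection (rd_rank R) (rd_coroot R \<alpha>) \<alpha> ` rd_roots R \<subseteq> rd_roots R) \<and>
     (\<forall>\<alpha>\<in>rd_roots R. reflection (rd_rank R) \<alpha> (rd_coroot R \<alpha>) ` rd_coroot R ` rd_roots R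
        \<subseteq> rd_coroot R ` rd_roots R) \<and>
     (\<forall>\<alpha>\<in>rd_roots R. \<forall>\<beta>\<in>rd_roots R. \<forall>a b :: int. a \<noteq> 0 \<longrightarrow> b \<noteq> 0 \<longrightarrow>
        (\<forall>j. a * \<alpha> j = b * \<beta> j) \<longrightarrow> \<beta> = \<alpha> \<or> \<beta> = (\<lambda>j. - \<alpha> j)) \<and>
     rd_base R \<subseteq> rd_roots R \<and>
     int_independent (rd_base R) (\<lambda>\<alpha>. \<alpha>) \<and>
     (\<forall>\<alpha>\<in>rd_roots R. \<alpha> \<in> nonneg_span (rd_base R) \<or> (\<lambda>j. - \<alpha> j) \<in> nonneg_span (rd_base R))"

text \<open>
  The maximal torus of the derived subgroup has as cocharacter lattice the saturation of the coroot
  lattice in \<open>X\<^sub>*(T)\<close>; the derived subgroup is simply connected iff this is the coroot lattice.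
\<close>

definition derived_simply_connected :: "reductive_datum \<Rightarrow> bool" where
  "derived_simply_connected R \<longleftrightarrow>
     {\<mu> \<in> lattice (rd_rank R). \<exists>k :: int. k \<noteq> 0 \<and>
        (\<lambda>j. k * \<mu> j) \<in> int_span (rd_coroot R ` rd_roots R)}
     = int_span (rd_coroot R ` rd_roots R)"

definition finite_refl :: "reductive_datum \<Rightarrow> weight \<Rightarrow> weyl" where
  "finite_refl R \<alpha> = reflection (rd_rank R) (rd_coroot R \<alpha>) \<alpha>"

definition finite_weyl :: "reductive_datum \<Rightarrow> weyl set" where
  "finite_weyl R = refl_group (finite_refl R) (rd_roots R)"

text \<open>
  \<open>X\<^sup>*(\<T>) = X\<^sup>*(T) \<oplus> \<int>\<delta> (\<oplus> \<int>\<epsilon>)\<close>, where the characters \<open>\<delta>\<close>, \<open>\<epsilon>\<close> of the rotation and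
  dilation tori are the unit vectors at positions \<open>rd_rank R\<close> and \<open>rd_rank R + 1\<close>. Thus
  \<^term>\<open>\<alpha>(rd_rank R := k)\<close> is \<open>\<alpha> + k\<delta>\<close> for \<open>\<alpha> \<in> X\<^sup>*(T)\<close>. Conjugation by the point \<open>\<mu>(\<varpi>)\<close> of the
  loop group takes \<open>(t, z) \<in> \<T>\<close> to \<open>(t \<mu>(z)\<inverse>, z)\<close>, so that the translation by \<open>\<mu>\<close> maps
  a character \<open>\<lambda> + k\<delta>\<close> to \<open>\<lambda> + (k + \<langle>\<mu>,\<lambda>\<rangle>)\<delta>\<close>.
\<close>

definition translation :: "reductive_datum \<Rightarrow> weight \<Rightarrow> weyl" where
  "translation R \<mu> = (\<lambda>v. v(rd_rank R := v (rd_rank R) + pairing (rd_rank R) \<mu> v))"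

definition ext_affine_weyl :: "reductive_datum \<Rightarrow> weyl set" where
  "ext_affine_weyl R = {translation R \<mu> \<circ> w | \<mu> w. \<mu> \<in> lattice (rd_rank R) \<and> w \<in> finite_weyl R}"

definition affine_pos_re :: "reductive_datum \<Rightarrow> weight set" where
  "affine_pos_re R = {\<alpha>(rd_rank R := k) | \<alpha> k.
     \<alpha> \<in> rd_roots R \<and> (k > 0 \<or> k = 0 \<and> \<alpha> \<in> nonneg_span (rd_base R))}"

definition affine_imag :: "reductive_datum \<Rightarrow> weight set" where
  "affine_imag R = {(\<lambda>j. k * unit_vec (rd_rank R) j) | k. k \<noteq> 0}"

text \<open>There is one highest root for each irreducible component of \<open>\<Phi>\<close>.\<close>

definition highest_roots :: "reductive_datum \<Rightarrow> weight set" where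
  "highest_roots R = {\<theta> \<in> rd_roots R.
     \<forall>\<gamma>\<in>rd_roots R. (\<lambda>j. \<gamma> j - \<theta> j) \<in> nonneg_span (rd_base R) \<longrightarrow> \<gamma> = \<theta>}"

definition affine_simple :: "reductive_datum \<Rightarrow> weight set" where
  "affine_simple R =
     rd_base R \<union> {(\<lambda>j. - \<theta> j)(rd_rank R := 1) | \<theta>. \<theta> \<in> highest_roots R}"

text \<open>The coroot of \<open>\<alpha> + k\<delta>\<close> is that of \<open>\<alpha>\<close>, as the loop group is not centrally extended.\<close>

definition affine_refl :: "reductive_datum \<Rightarrow> weight \<Rightarrow> weyl" where
  "affine_refl R v = reflection (rd_rank R) (rd_coroot R (v(rd_rank R := 0))) v"

definition ext_affine_Omega :: "reductive_datum \<Rightarrow> weyl set" where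
  "ext_affine_Omega R =
     {w \<in> ext_affine_weyl R. {\<alpha> \<in> affine_pos_re R. w \<alpha> \<notin> affine_pos_re R} = {}}"

definition ext_affine_setting :: "reductive_datum \<Rightarrow> setting" where
  "ext_affine_setting R = \<lparr>
     rank = rd_rank R + 1 + (if rd_dil R then 1 else 0),
     imag_roots = affine_imag R,
     weyl_group = ext_affine_weyl R,
     Omega = ext_affine_Omega R,
     simple = affine_simple R,
     pos_re = affine_pos_re R,
     refl = affine_refl R \<rparr>"


subsection \<open>Admissible settings\<close>

definition kac_moody_case :: "setting \<Rightarrow> bool" where
  "kac_moody_case D \<longleftrightarrow> (\<exists>K. km_root_datum K \<and> D = km_setting K)"

definition ext_affine_case :: "setting \<Rightarrow> bool" where
  "ext_affine_case D \<longleftrightarrow>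
     (\<exists>R. reductive_root_datum R \<and> derived_simply_connected R \<and> D = ext_affine_setting R)"


section \<open>Polynomial and rational functions on \<open>\<hh>\<close>\<close>

text \<open>
  Polynomials in countably many variables; \<open>\<complex>[\<hh>]\<close> is the subring of those in the variables with
  index below the rank, the \<open>i\<close>-th variable being the \<open>i\<close>-th basis character of \<open>\<T>\<close>.
\<close>

type_synonym mpol = "(nat \<Rightarrow>\<^sub>0 nat) \<Rightarrow>\<^sub>0 complex"
type_synonym ratfun = "mpol fract"

definition poly_const :: "complex \<Rightarrow> mpol" where
  "poly_const c = Poly_Mapping.single 0 c"

definition poly_var :: "nat \<Rightarrow> mpol" where
  "poly_var i = Poly_Mapping.single (Poly_Mapping.single i 1) 1"

definition S_ring :: "setting \<Rightarrow> mpol set" where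
  "S_ring D = {p. \<forall>m\<in>Poly_Mapping.keys p. Poly_Mapping.keys m \<subseteq> {..<rank D}}"

definition lin :: "setting \<Rightarrow> weight \<Rightarrow> mpol" where
  "lin D v = (\<Sum>i<rank D. poly_const (of_int (v i)) * poly_var i)"

definition linQ :: "setting \<Rightarrow> weight \<Rightarrow> ratfun" where
  "linQ D v = Fract (lin D v) 1"

definition Q_ring :: "setting \<Rightarrow> ratfun set" where
  "Q_ring D = {Fract a b | a b. a \<in> S_ring D \<and> b \<in> S_ring D \<and> b \<noteq> 0 \<and>
     (\<forall>\<eta>\<in>imag_roots D. \<not> lin D \<eta> dvd b)}"

text \<open>
  The action of \<open>\<W>\<close> on functions on \<open>\<hh>\<close> extends its action on linear functions; the value of
  \<open>actQ\<close> does not depend on the chosen fraction.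
\<close>

definition actS :: "setting \<Rightarrow> weyl \<Rightarrow> mpol \<Rightarrow> mpol" where
  "actS D w p = (\<Sum>m\<in>Poly_Mapping.keys p. poly_const (Poly_Mapping.lookup p m) *
     (\<Prod>i\<in>Poly_Mapping.keys m. lin D (w (unit_vec i)) ^ Poly_Mapping.lookup m i))"

definition actQ :: "setting \<Rightarrow> weyl \<Rightarrow> ratfun \<Rightarrow> ratfun" where
  "actQ D w q =
     (case (SOME (a, b). a \<in> S_ring D \<and> b \<in> S_ring D \<and> b \<noteq> 0 \<and> q = Fract a b) of
        (a, b) \<Rightarrow> Fract (actS D w a) (actS D w b))"


section \<open>The twisted group ring and the nil-Hecke algebra\<close>

text \<open>An element \<open>\<Sum> f\<^sub>w [w]\<close> is the function \<open>w \<mapsto> f\<^sub>w\<close>.\<close>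

type_synonym twisted = "weyl \<Rightarrow> ratfun"

definition QW :: "setting \<Rightarrow> twisted set" where
  "QW D = {f. finite {w. f w \<noteq> 0} \<and> {w. f w \<noteq> 0} \<subseteq> weyl_group D \<and> (\<forall>w. f w \<in> Q_ring D)}"

definition tw_single :: "ratfun \<Rightarrow> weyl \<Rightarrow> twisted" where
  "tw_single q w = (\<lambda>u. if u = w then q else 0)"

definition tw_mult :: "setting \<Rightarrow> twisted \<Rightarrow> twisted \<Rightarrow> twisted" where
  "tw_mult D f g = (\<lambda>w. \<Sum>(u, v)\<in>{(u, v). f u \<noteq> 0 \<and> g v \<noteq> 0 \<and> u \<circ> v = w}. f u * actQ D u (g v))"

definition Dem_simple :: "setting \<Rightarrow> weight \<Rightarrow> twisted" where
  "Dem_simple D \<alpha> =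
     (\<lambda>u. tw_single (- (1 / linQ D \<alpha>)) (refl D \<alpha>) u + tw_single (1 / linQ D \<alpha>) id u)"

definition reduced_word :: "setting \<Rightarrow> weight list \<Rightarrow> bool" where
  "reduced_word D as \<longleftrightarrow> set as \<subseteq> simple D \<and>
     (\<forall>bs. set bs \<subseteq> simple D \<and> word_prod (refl D) bs = word_prod (refl D) as
        \<longrightarrow> length as \<le> length bs)"

definition Dem_word :: "setting \<Rightarrow> weight list \<Rightarrow> twisted" where
  "Dem_word D as = foldr (\<lambda>\<alpha> g. tw_mult D (Dem_simple D \<alpha>) g) as (tw_single 1 id)"

text \<open>\<open>D\<^sub>a\<close> for \<open>a\<close> in the Coxeter group generated by the simple reflections.\<close>

definition Dem_cox :: "setting \<Rightarrow> weyl \<Rightarrow> twisted" where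
  "Dem_cox D a = Dem_word D (SOME as. reduced_word D as \<and> word_prod (refl D) as = a)"

inductive_set nil_Hecke :: "setting \<Rightarrow> twisted set" for D :: setting where
  scalar: "p \<in> S_ring D \<Longrightarrow> tw_single (Fract p 1) id \<in> nil_Hecke D"
| Dem: "a \<in> refl_group (refl D) (simple D) \<Longrightarrow> \<omega> \<in> Omega D \<Longrightarrow>
          tw_mult D (Dem_cox D a) (tw_single 1 \<omega>) \<in> nil_Hecke D"
| diff: "f \<in> nil_Hecke D \<Longrightarrow> g \<in> nil_Hecke D \<Longrightarrow> (\<lambda>w. f w - g w) \<in> nil_Hecke D"
| mult: "f \<in> nil_Hecke D \<Longrightarrow> g \<in> nil_Hecke D \<Longrightarrow> tw_mult D f g \<in> nil_Hecke D"


section \<open>Twisting by a collection of characters\<close>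

text \<open>A collection \<open>\<Sigma>\<close> of characters is given by its multiplicity function \<open>m\<close>.\<close>

definition act_coll :: "weyl \<Rightarrow> (weight \<Rightarrow> nat) \<Rightarrow> (weight \<Rightarrow> nat)" where
  "act_coll w m = (\<lambda>v. m (inv w v))"

definition admissible_collection :: "setting \<Rightarrow> (weight \<Rightarrow> nat) \<Rightarrow> bool" where
  "admissible_collection D m \<longleftrightarrow>
     {v. m v \<noteq> 0} \<subseteq> lattice (rank D) \<and>
     (\<forall>w\<in>weyl_group D. finite {v. act_coll w m v - m v \<noteq> 0} \<and> finite {v. m v - act_coll w m v \<noteq> 0})"

definition Pi_ratio :: "setting \<Rightarrow> (weight \<Rightarrow> nat) \<Rightarrow> (weight \<Rightarrow> nat) \<Rightarrow> ratfun" where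
  "Pi_ratio D m m' = (\<Prod>v\<in>{v. m v \<noteq> m' v}. linQ D v powi (int (m v) - int (m' v)))"

definition coprime_S :: "setting \<Rightarrow> mpol \<Rightarrow> mpol \<Rightarrow> bool" where
  "coprime_S D a b \<longleftrightarrow> (\<forall>c\<in>S_ring D. c dvd a \<longrightarrow> c dvd b \<longrightarrow> c dvd 1)"

text \<open>
  \<open>\<Pi>_\<Sigma> / \<Pi>_w(\<Sigma>)\<close> in lowest terms: numerator and denominator, unique up to a common
  nonzero scalar.
\<close>

definition Pi_lowest :: "setting \<Rightarrow> (weight \<Rightarrow> nat) \<Rightarrow> weyl \<Rightarrow> mpol \<times> mpol" where
  "Pi_lowest D m w = (SOME (a, b). a \<in> S_ring D \<and> b \<in> S_ring D \<and> b \<noteq> 0 \<and> coprime_S D a b \<and>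
     Pi_ratio D m (act_coll w m) = Fract a b)"

text \<open>The denominator \<open>\<Pi>~_{w(\<Sigma>),\<Sigma>}\<close>.\<close>

definition Pi_tilde_den :: "setting \<Rightarrow> (weight \<Rightarrow> nat) \<Rightarrow> weyl \<Rightarrow> ratfun" where
  "Pi_tilde_den D m w = Fract (snd (Pi_lowest D m w)) 1"

definition Pi_conj :: "setting \<Rightarrow> (weight \<Rightarrow> nat) \<Rightarrow> twisted \<Rightarrow> twisted" where
  "Pi_conj D m f = (\<lambda>w. f w * Pi_ratio D (act_coll w m) m)"

definition nil_Hecke_Sigma :: "setting \<Rightarrow> (weight \<Rightarrow> nat) \<Rightarrow> twisted set" where
  "nil_Hecke_Sigma D m = nil_Hecke D \<inter> Pi_conj D m ` nil_Hecke D"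


section \<open>Poles and residues\<close>

text \<open>
  Distinct positive real roots have distinct hyperplanes \<open>\<hh>\<^sub>\<alpha>\<close>, so that the denominator below
  allows first order poles only.
\<close>

definition only_simple_real_poles :: "setting \<Rightarrow> ratfun \<Rightarrow> bool" where
  "only_simple_real_poles D g \<longleftrightarrow>
     (\<exists>F p. finite F \<and> F \<subseteq> pos_re D \<and> p \<in> S_ring D \<and> g = Fract p 1 / (\<Prod>\<alpha>\<in>F. linQ D \<alpha>))"

text \<open>
  The field of rational functions on \<open>\<hh>\<^sub>\<alpha>\<close> is the residue field of the local ring of rational
  functions on \<open>\<hh>\<close> which are regular at the generic point of \<open>\<hh>\<^sub>\<alpha>\<close>, and restriction to \<open>\<hh>\<^sub>\<alpha>\<close> is
  the passage to the class modulo the maximal ideal. Classes are represented as cosets, and are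
  added as sets.
\<close>

definition local_ring :: "setting \<Rightarrow> weight \<Rightarrow> ratfun set" where
  "local_ring D \<alpha> = {Fract a b | a b. a \<in> S_ring D \<and> b \<in> S_ring D \<and> \<not> lin D \<alpha> dvd b}"

definition restrict_hyp :: "setting \<Rightarrow> weight \<Rightarrow> ratfun \<Rightarrow> ratfun set" where
  "restrict_hyp D \<alpha> g = {g + linQ D \<alpha> * r | r. r \<in> local_ring D \<alpha>}"

definition Res :: "setting \<Rightarrow> weight \<Rightarrow> ratfun \<Rightarrow> ratfun set" where
  "Res D \<alpha> g = restrict_hyp D \<alpha> (linQ D \<alpha> * g)"

end

theory Submission
  imports Defs "HOL-Library.Multiset"
begin

text \<open>
  Call \<open>f = \<Sum> f\<^sub>w [w]\<close> a residue element if its coefficients have at most first order poles, all of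
  them along real root hyperplanes, and if \<open>f\<^sub>w + f\<^sub>u\<close> is regular at the generic point of the
  hyperplane of \<open>\<alpha>\<close> whenever \<open>u = s\<^sub>\<alpha> w\<close>. The heart of the matter is that the nil-Hecke algebra \<open>\<H>\<close>
  consists exactly of the residue elements (\<open>nil_Hecke_eq_residue_algebra\<close>). The rest is formal:
  \<open>f\<close> lies in the conjugate algebra iff the element with the coefficients
  \<open>f\<^sub>w \<Pi>\<^sub>\<Sigma> / \<Pi>\<^bsub>w(\<Sigma>)\<^esub>\<close> lies in \<open>\<H>\<close>. The residue condition for that element
  is the twisted one, and if the poles of \<open>f\<^sub>w\<close> are simple, its pole condition amounts to the one on
  the quotient of \<open>f\<^sub>w\<close> by the denominator of that ratio, because in lowest terms the denominator is
  a product of linear forms, which are prime and do not divide the numerator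
  (\<open>Pi_lowest\<close>, \<open>simple_poles_quotient_iff\<close>).

  Every element of \<open>\<H>\<close> is a residue element because the residue elements include the generators and
  form a ring. For the product, one hyperplane is considered at a time and the terms for \<open>u\<close> and
  \<open>s\<^sub>\<alpha> u\<close> are taken together; a double pole would come with the coefficient \<open>c - s\<^sub>\<alpha>(c)\<close>, which vanishes
  on the hyperplane (\<open>local_pair_product\<close>, \<open>tw_mult_residue_algebra\<close>).

  Conversely, a residue element is reduced to 0 by induction on the length of the elements of its
  support. If \<open>w\<close> has maximal length there and \<open>\<alpha>\<close> is not an inversion of \<open>w\<close>, then \<open>s\<^sub>\<alpha> w\<close>
  is longer than \<open>w\<close> and hence outside the support, so \<open>f\<^sub>w\<close> is regular along the hyperplane of \<open>\<alpha>\<close>. Thus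
  \<open>f\<^sub>w\<close> is a polynomial divided by the product of the inversions of \<open>w\<close>. The inverse of this product
  is, up to sign, the coefficient of \<open>D\<^sub>w\<close> at \<open>w\<close>, all other elements in the support of \<open>D\<^sub>w\<close> being shorter
  (\<open>Dem_word_leading\<close>), so that a polynomial multiple of \<open>D\<^sub>w\<close> removes \<open>w\<close> from the support.

  Of the group \<open>\<W>\<close> this uses the properties collected in the locale \<open>reflection_setting\<close>: real
  roots are positive or negative, each has a well-defined reflection, a simple reflection makes only its
  own root negative, and length is the finite number of inversions. In the Kac--Moody case
  the first of them comes down to dihedral groups (\<open>ascent_nonneg\<close>) and the second follows from
  symmetrizability (\<open>conjugate_reflection\<close>). In the extended affine case everything is explicit except
  for the behaviour of the affine simple reflections, which depends on the pairings
  of the roots with the coroots of highest roots (\<open>highest_coroot_le_1\<close>).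
\<close>

section \<open>Substitutions in polynomials\<close>

definition monom_val :: "(nat \<Rightarrow> mpol) \<Rightarrow> (nat \<Rightarrow>\<^sub>0 nat) \<Rightarrow> mpol" where
  "monom_val \<sigma> m = (\<Prod>i\<in>Poly_Mapping.keys m. \<sigma> i ^ Poly_Mapping.lookup m i)"

definition subst :: "(nat \<Rightarrow> mpol) \<Rightarrow> mpol \<Rightarrow> mpol" where
  "subst \<sigma> p = (\<Sum>m\<in>Poly_Mapping.keys p. poly_const (Poly_Mapping.lookup p m) * monom_val \<sigma> m)"

lemma actS_eq_subst: "actS D w = subst (\<lambda>i. lin D (w (unit_vec i)))"
  by (rule ext) (simp add: actS_def subst_def monom_val_def)

lemma poly_const_0 [simp]: "poly_const 0 = 0"
  and poly_const_1 [simp]: "poly_const 1 = 1"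
  and poly_const_add: "poly_const (a + b) = poly_const a + poly_const b"
  and poly_const_mult: "poly_const (a * b) = poly_const a * poly_const b"
  and poly_const_uminus: "poly_const (- a) = - poly_const a"
  by (simp_all add: poly_const_def single_add mult_single single_uminus)

lemma monom_val_superset:
  assumes "finite A" "Poly_Mapping.keys m \<subseteq> A"
  shows "monom_val \<sigma> m = (\<Prod>i\<in>A. \<sigma> i ^ Poly_Mapping.lookup m i)"
  unfolding monom_val_def using assms
  by (intro prod.mono_neutral_left) (auto simp: in_keys_iff)

lemma monom_val_add: "monom_val \<sigma> (m + m') = monom_val \<sigma> m * monom_val \<sigma> m'"
proof -
  let ?A = "Poly_Mapping.keys m \<union> Poly_Mapping.keys m'"
  have "Poly_Mapping.keys (m + m') \<subseteq> ?A" by (rule keys_add)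
  then show ?thesis
    by (subst (1 2 3) monom_val_superset[of ?A])
      (auto simp: lookup_add power_add prod.distrib)
qed

lemma monom_val_0 [simp]: "monom_val \<sigma> 0 = 1"
  by (simp add: monom_val_def)

lemma monom_val_single [simp]: "monom_val \<sigma> (Poly_Mapping.single i 1) = \<sigma> i"
  by (simp add: monom_val_def)

lemma subst_superset:
  assumes "finite A" "Poly_Mapping.keys p \<subseteq> A"
  shows "subst \<sigma> p = (\<Sum>m\<in>A. poly_const (Poly_Mapping.lookup p m) * monom_val \<sigma> m)"
  unfolding subst_def using assms
  by (intro sum.mono_neutral_left) (auto simp: in_keys_iff)

lemma subst_0 [simp]: "subst \<sigma> 0 = 0"
  by (simp add: subst_def)

lemma subst_add: "subst \<sigma> (p + q) = subst \<sigma> p + subst \<sigma> q"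
proof -
  let ?A = "Poly_Mapping.keys p \<union> Poly_Mapping.keys q"
  have "Poly_Mapping.keys (p + q) \<subseteq> ?A" by (rule keys_add)
  then show ?thesis
    by (subst (1 2 3) subst_superset[of ?A])
      (auto simp: lookup_add poly_const_add sum.distrib algebra_simps)
qed

lemma subst_single: "subst \<sigma> (Poly_Mapping.single m c) = poly_const c * monom_val \<sigma> m"
  by (simp add: subst_def)

lemma subst_sum: "subst \<sigma> (sum f A) = (\<Sum>x\<in>A. subst \<sigma> (f x))"
  by (induction A rule: infinite_finite_induct) (simp_all add: subst_add)

lemma poly_expansion:
  fixes p :: mpol
  shows "p = (\<Sum>m\<in>Poly_Mapping.keys p. Poly_Mapping.single m (Poly_Mapping.lookup p m))"
  by (rule poly_mapping_eqI) (auto simp: lookup_sum lookup_single when_def in_keys_iff sum.delta)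

lemma subst_mult: "subst \<sigma> (p * q) = subst \<sigma> p * subst \<sigma> q"
proof -
  have "subst \<sigma> (p * q) = subst \<sigma> (\<Sum>m\<in>Poly_Mapping.keys p. \<Sum>m'\<in>Poly_Mapping.keys q.
      Poly_Mapping.single (m + m') (Poly_Mapping.lookup p m * Poly_Mapping.lookup q m'))"
    by (subst (1) poly_expansion[of p], subst (1) poly_expansion[of q])
      (simp add: sum_product mult_single)
  also have "\<dots> = subst \<sigma> p * subst \<sigma> q"
    by (simp add: subst_sum subst_single poly_const_mult monom_val_add subst_def[of _ p]
        subst_def[of _ q] sum_product mult_ac)
  finally show ?thesis .
qed

lemma subst_const [simp]: "subst \<sigma> (poly_const c) = poly_const c"
  by (simp add: poly_const_def subst_single)

lemma subst_1 [simp]: "subst \<sigma> 1 = 1"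
  using subst_const[of \<sigma> 1] by simp

lemma subst_var [simp]: "subst \<sigma> (poly_var i) = \<sigma> i"
  unfolding poly_var_def subst_single monom_val_single by simp

lemma subst_dvd: "p dvd q \<Longrightarrow> subst \<sigma> p dvd subst \<sigma> q"
  by (auto simp: dvd_def subst_mult)

lemma subst_prod: "subst \<sigma> (prod f A) = (\<Prod>x\<in>A. subst \<sigma> (f x))"
  by (induction A rule: infinite_finite_induct) (simp_all add: subst_mult)

lemma subst_power: "subst \<sigma> (p ^ k) = subst \<sigma> p ^ k"
  by (induction k) (simp_all add: subst_mult)

definition vars :: "mpol \<Rightarrow> nat set" where
  "vars p = (\<Union>m\<in>Poly_Mapping.keys p. Poly_Mapping.keys m)"

lemma subst_subst:
  "subst \<sigma> (subst \<tau> p) = subst (\<lambda>i. subst \<sigma> (\<tau> i)) p"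
  unfolding subst_def[of \<tau> p] subst_def[of "\<lambda>i. subst \<sigma> (\<tau> i)" p]
  by (simp add: subst_sum subst_mult monom_val_def subst_prod subst_power)

lemma subst_cong: "(\<And>i. i \<in> vars p \<Longrightarrow> \<sigma> i = \<tau> i) \<Longrightarrow> subst \<sigma> p = subst \<tau> p"
  unfolding subst_def monom_val_def vars_def
  by (intro sum.cong arg_cong2[where f = "(*)"] prod.cong refl arg_cong2[where f = "(^)"]) auto

lemma monom_val_poly_var: "monom_val poly_var m = Poly_Mapping.single m 1"
proof -
  have pow: "poly_var i ^ k = Poly_Mapping.single (Poly_Mapping.single i k) 1" for i k
  proof (induction k)
    case (Suc k)
    then show ?case
      by (simp add: poly_var_def mult_single flip: single_add)
  qed simp
  have "(\<Prod>i\<in>A. Poly_Mapping.single (f i) (1::complex)) = Poly_Mapping.single (sum f A) 1"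
    if "finite A" for A and f :: "nat \<Rightarrow> (nat \<Rightarrow>\<^sub>0 nat)"
    using that by (induction A) (simp_all add: mult_single)
  moreover have "(\<Sum>i\<in>Poly_Mapping.keys m. Poly_Mapping.single i (Poly_Mapping.lookup m i)) = m"
    by (rule poly_mapping_eqI) (auto simp: lookup_sum lookup_single when_def in_keys_iff sum.delta)
  ultimately show ?thesis
    by (simp add: monom_val_def pow)
qed

lemma subst_poly_var [simp]: "subst poly_var p = p"
proof -
  have "subst poly_var p =
      (\<Sum>m\<in>Poly_Mapping.keys p. Poly_Mapping.single m (Poly_Mapping.lookup p m))"
    by (simp add: subst_def monom_val_poly_var poly_const_def mult_single)
  then show ?thesis using poly_expansion[of p] by simp
qed

lemma subst_cong_dvd:
  assumes "\<And>i. i \<in> vars p \<Longrightarrow> d dvd \<sigma> i - \<tau> i"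
  shows "d dvd subst \<sigma> p - subst \<tau> p"
proof -
  have mult: "d dvd a * b - a' * b'" if "d dvd a - a'" "d dvd b - b'" for a b a' b' :: mpol
  proof -
    have "a * b - a' * b' = a * (b - b') + (a - a') * b'" by (simp add: algebra_simps)
    then show ?thesis using that by (metis dvd_add dvd_mult dvd_mult2)
  qed
  have pow: "d dvd a ^ k - b ^ k" if "d dvd a - b" for a b :: mpol and k
    using that by (induction k) (auto intro: mult)
  have prod: "d dvd prod f A - prod g A"
    if "finite A" "\<And>i. i \<in> A \<Longrightarrow> d dvd f i - g i" for A and f g :: "nat \<Rightarrow> mpol"
    using that by (induction A) (auto intro: mult)
  have "d dvd (\<Sum>m\<in>Poly_Mapping.keys p. poly_const (Poly_Mapping.lookup p m) *
      (monom_val \<sigma> m - monom_val \<tau> m))"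
    unfolding monom_val_def using assms
    by (intro dvd_sum dvd_mult prod pow) (auto simp: vars_def)
  then show ?thesis by (simp add: subst_def sum_subtractf algebra_simps)
qed


section \<open>The ring of polynomial functions\<close>

text \<open>
  \<open>S\<close> is the image of the projection that kills the variables beyond the rank. Hence it is closed
  under whatever that ring homomorphism respects, in particular under exact division.
\<close>

definition proj_S :: "setting \<Rightarrow> mpol \<Rightarrow> mpol" where
  "proj_S D = subst (\<lambda>i. if i < rank D then poly_var i else 0)"

lemma S_ring_iff_vars: "p \<in> S_ring D \<longleftrightarrow> vars p \<subseteq> {..<rank D}"
  by (auto simp: S_ring_def vars_def)

lemma S_ring_0 [simp]: "0 \<in> S_ring D" by (simp add: S_ring_def)
lemma S_ring_const [simp]: "poly_const c \<in> S_ring D" by (simp add: S_ring_def poly_const_def)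
lemma S_ring_1 [simp]: "1 \<in> S_ring D" by (simp add: S_ring_def)
lemma S_ring_var [simp]: "i < rank D \<Longrightarrow> poly_var i \<in> S_ring D"
  by (simp add: S_ring_def poly_var_def)

lemma S_ring_add [intro]: "p \<in> S_ring D \<Longrightarrow> q \<in> S_ring D \<Longrightarrow> p + q \<in> S_ring D"
  unfolding S_ring_def using keys_add[of p q] by blast

lemma S_ring_mult [intro]: "p \<in> S_ring D \<Longrightarrow> q \<in> S_ring D \<Longrightarrow> p * q \<in> S_ring D"
proof -
  assume "p \<in> S_ring D" "q \<in> S_ring D"
  moreover have "Poly_Mapping.keys (a + b) \<subseteq> Poly_Mapping.keys a \<union> Poly_Mapping.keys b"
    for a b :: "nat \<Rightarrow>\<^sub>0 nat" by (rule keys_add)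
  ultimately show ?thesis
    unfolding S_ring_def using keys_mult[of p q] by blast
qed

lemma S_ring_uminus [intro]: "p \<in> S_ring D \<Longrightarrow> - p \<in> S_ring D"
  by (simp add: S_ring_def)

lemma S_ring_diff [intro]: "p \<in> S_ring D \<Longrightarrow> q \<in> S_ring D \<Longrightarrow> p - q \<in> S_ring D"
  using S_ring_add[of p D "- q"] by auto

lemma S_ring_sum: "(\<And>x. x \<in> A \<Longrightarrow> f x \<in> S_ring D) \<Longrightarrow> sum f A \<in> S_ring D"
  by (induction A rule: infinite_finite_induct) auto

lemma S_ring_prod: "(\<And>x. x \<in> A \<Longrightarrow> f x \<in> S_ring D) \<Longrightarrow> prod f A \<in> S_ring D"
  by (induction A rule: infinite_finite_induct) auto

lemma S_ring_power: "p \<in> S_ring D \<Longrightarrow> p ^ k \<in> S_ring D"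
  by (induction k) auto

lemma S_ring_subst:
  assumes "\<And>i. i \<in> vars p \<Longrightarrow> \<sigma> i \<in> S_ring D"
  shows "subst \<sigma> p \<in> S_ring D"
  unfolding subst_def monom_val_def using assms
  by (intro S_ring_sum S_ring_mult S_ring_const S_ring_prod S_ring_power) (auto simp: vars_def)

lemma proj_S_in_S: "proj_S D p \<in> S_ring D"
  unfolding proj_S_def by (rule S_ring_subst) auto

lemma proj_S_id:
  assumes "p \<in> S_ring D"
  shows "proj_S D p = p"
proof -
  have "proj_S D p = subst poly_var p"
    unfolding proj_S_def using assms by (intro subst_cong) (auto simp: S_ring_iff_vars)
  then show ?thesis by simp
qed

lemma S_ring_divisor:
  assumes "a = d * r" "a \<in> S_ring D" "d \<in> S_ring D" "d \<noteq> 0"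
  shows "r \<in> S_ring D"
proof -
  have "d * proj_S D r = d * r"
    using assms proj_S_id[of a D] proj_S_id[of d D] by (simp add: proj_S_def subst_mult)
  then have "proj_S D r = r" using assms by simp
  then show ?thesis using proj_S_in_S by metis
qed

lemma S_ring_dvd_cofactor:
  assumes "d dvd a" "a \<in> S_ring D" "d \<in> S_ring D"
  obtains r where "a = d * r" "r \<in> S_ring D"
proof (cases "d = 0")
  case True
  then show ?thesis using assms that[of 0] by auto
next
  case False
  then show ?thesis using assms S_ring_divisor that by (metis dvdE)
qed


section \<open>Linear forms\<close>

lemma lin_in_S [simp]: "lin D v \<in> S_ring D"
  unfolding lin_def by (intro S_ring_sum S_ring_mult) auto

lemma lin_comb: "lin D (\<lambda>j. a * u j + b * v j) =
    poly_const (of_int a) * lin D u + poly_const (of_int b) * lin D v"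
  by (simp add: lin_def sum_distrib_left poly_const_add poly_const_mult algebra_simps sum.distrib)

lemma lin_uminus: "lin D (\<lambda>j. - v j) = - lin D v"
  by (simp add: lin_def poly_const_uminus sum_negf)

lemma lookup_lin: "Poly_Mapping.lookup (lin D v) (Poly_Mapping.single j 1) =
    (if j < rank D then of_int (v j) else 0)"
proof -
  have inj: "Poly_Mapping.single i (1::nat) = Poly_Mapping.single j 1 \<longleftrightarrow> i = j" for i
    by (auto dest: arg_cong[where f = Poly_Mapping.keys])
  have "poly_const c * poly_var i = Poly_Mapping.single (Poly_Mapping.single i 1) c" for c i
    by (simp only: poly_const_def poly_var_def mult_single add_0_left mult_1_right)
  then show ?thesis
    by (simp only: lin_def lookup_sum lookup_single inj when_def) (simp add: sum.delta)
qed

lemma lin_eq_iff: "u \<in> lattice (rank D) \<Longrightarrow> v \<in> lattice (rank D) \<Longrightarrow> lin D u = lin D v \<longleftrightarrow> u = v"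
proof safe
  assume *: "u \<in> lattice (rank D)" "v \<in> lattice (rank D)" "lin D u = lin D v"
  show "u = v"
  proof
    fix j
    show "u j = v j"
      using * lookup_lin[of D u j] lookup_lin[of D v j]
      by (cases "j < rank D") (auto simp: lattice_def)
  qed
qed

lemma lin_zero [simp]: "lin D (\<lambda>_. 0) = 0"
  by (simp add: lin_def)

lemma lin_eq_0_iff: "v \<in> lattice (rank D) \<Longrightarrow> lin D v = 0 \<longleftrightarrow> v = (\<lambda>_. 0)"
  using lin_eq_iff[of v D "\<lambda>_. 0"] by (simp add: lattice_def)

text \<open>
  A nonzero linear form generates the kernel of the substitution that solves for one of its
  variables; as that substitution is an endomorphism of a domain, the form is prime.
\<close>

definition elim_var :: "setting \<Rightarrow> weight \<Rightarrow> nat \<Rightarrow> nat \<Rightarrow> mpol" where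
  "elim_var D v j = (\<lambda>i. if i = j then poly_var j - poly_const (1 / of_int (v j)) * lin D v
     else poly_var i)"

lemma subst_elim_var_lin:
  assumes "j < rank D"
  shows "subst (elim_var D v j) (lin D u) =
    lin D u - poly_const (of_int (u j) / of_int (v j)) * lin D v"
proof -
  have "subst (elim_var D v j) (lin D u) =
      (\<Sum>i<rank D. poly_const (of_int (u i)) * poly_var i -
        (if i = j then poly_const (of_int (u i)) * (poly_const (1 / of_int (v j)) * lin D v) else 0))"
    unfolding lin_def[of D u] by (auto simp: subst_sum subst_mult elim_var_def algebra_simps intro!: sum.cong)
  also have "\<dots> = lin D u - poly_const (of_int (u j) / of_int (v j)) * lin D v"
    using assms
    by (simp add: sum_subtractf sum.delta lin_def[of D u] flip: poly_const_mult mult.assoc)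
  finally show ?thesis .
qed

lemma lin_dvd_iff_elim_var:
  assumes "j < rank D" "v j \<noteq> 0"
  shows "lin D v dvd p \<longleftrightarrow> subst (elim_var D v j) p = 0"
proof
  assume "lin D v dvd p"
  moreover have "subst (elim_var D v j) (lin D v) = 0"
    using assms by (simp add: subst_elim_var_lin)
  ultimately show "subst (elim_var D v j) p = 0"
    using subst_dvd[of "lin D v" p "elim_var D v j"] by simp
next
  assume "subst (elim_var D v j) p = 0"
  moreover have "lin D v dvd subst poly_var p - subst (elim_var D v j) p"
    by (rule subst_cong_dvd) (auto simp: elim_var_def)
  ultimately show "lin D v dvd p" by simp
qed

lemma lattice_nonzero_coord:
  assumes "v \<in> lattice N" "v \<noteq> (\<lambda>_. 0)"
  obtains j where "j < N" "v j \<noteq> 0"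
  using assms unfolding lattice_def by (metis (mono_tags, lifting) linorder_not_le mem_Collect_eq ext)

lemma lin_prime:
  assumes "v \<in> lattice (rank D)" "v \<noteq> (\<lambda>_. 0)"
  shows "lin D v dvd p * q \<longleftrightarrow> lin D v dvd p \<or> lin D v dvd q"
proof -
  obtain j where "j < rank D" "v j \<noteq> 0" using assms by (rule lattice_nonzero_coord)
  then show ?thesis by (simp add: lin_dvd_iff_elim_var subst_mult)
qed

lemma lin_not_unit:
  assumes "v \<in> lattice (rank D)" "v \<noteq> (\<lambda>_. 0)"
  shows "\<not> lin D v dvd 1"
proof -
  obtain j where "j < rank D" "v j \<noteq> 0" using assms by (rule lattice_nonzero_coord)
  then show ?thesis by (simp add: lin_dvd_iff_elim_var)
qed

lemma lin_prime_prod: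
  assumes "v \<in> lattice (rank D)" "v \<noteq> (\<lambda>_. 0)" "lin D v dvd prod f A"
  shows "\<exists>x\<in>A. lin D v dvd f x"
  using assms(3)
  by (induction A rule: infinite_finite_induct) (use assms lin_not_unit lin_prime in auto)

lemma lin_dvd_lin:
  assumes "v \<in> lattice (rank D)" "v \<noteq> (\<lambda>_. 0)" "u \<in> lattice (rank D)" "lin D v dvd lin D u"
  shows "\<exists>a b. a \<noteq> 0 \<and> (\<forall>i. a * u i = b * v i)"
proof -
  obtain j where j: "j < rank D" "v j \<noteq> 0" using assms(1,2) by (rule lattice_nonzero_coord)
  then have eq: "lin D u = poly_const (of_int (u j) / of_int (v j)) * lin D v"
    using assms(4) by (simp add: lin_dvd_iff_elim_var subst_elim_var_lin)
  have "poly_const (of_int (v j)) * lin D u = poly_const (of_int (u j)) * lin D v"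
    using j by (subst eq) (simp flip: poly_const_mult mult.assoc)
  then have "lin D (\<lambda>i. v j * u i + (- u j) * v i) = 0"
    by (subst lin_comb) (simp add: poly_const_uminus)
  then have "(\<lambda>i. v j * u i + (- u j) * v i) = (\<lambda>_. 0)"
    using assms(1,3) by (subst (asm) lin_eq_0_iff) (auto simp: lattice_def)
  then have "\<forall>i. v j * u i = u j * v i" by (auto simp: fun_eq_iff)
  then show ?thesis using j by blast
qed

text \<open>
  The factors being prime, they are split off from \<open>p\<close> one after the other. In place of unique
  factorization this suffices, since all denominators will be products of linear forms.
\<close>

lemma lin_prod_dvd_cancel:
  assumes "\<And>v. v \<in># M \<Longrightarrow> v \<in> lattice (rank D) \<and> v \<noteq> (\<lambda>_. 0) \<and> \<not> lin D v dvd a"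
    and "prod_mset (image_mset (lin D) M) dvd a * p"
  shows "prod_mset (image_mset (lin D) M) dvd p"
  using assms
proof (induction M arbitrary: p)
  case (add v M)
  let ?P = "prod_mset (image_mset (lin D) M)"
  have v: "v \<in> lattice (rank D)" "v \<noteq> (\<lambda>_. 0)" "\<not> lin D v dvd a"
    using add.prems(1)[of v] by auto
  have dvd: "lin D v * ?P dvd a * p" using add.prems(2) by simp
  then have "lin D v dvd a * p" by (rule dvd_mult_left)
  then obtain r where r: "p = lin D v * r" using v by (auto simp: lin_prime)
  have nz: "lin D v \<noteq> 0" using v by (simp add: lin_eq_0_iff)
  have "a * p = lin D v * (a * r)" by (simp add: r)
  then have "lin D v * ?P dvd lin D v * (a * r)" using dvd by metis
  then have "?P dvd a * r" using nz dvd_mult_cancel_left by blast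
  moreover have "u \<in> lattice (rank D) \<and> u \<noteq> (\<lambda>_. 0) \<and> \<not> lin D u dvd a" if "u \<in># M" for u
    by (rule add.prems(1)) (use that in simp)
  ultimately have "?P dvd r" by (rule add.IH[rotated])
  then show ?case by (simp add: r mult_dvd_mono)
qed simp


section \<open>Weights\<close>

definition wneg :: "weight \<Rightarrow> weight" where
  "wneg v = (\<lambda>j. - v j)"

definition int_linear :: "weyl \<Rightarrow> bool" where
  "int_linear w \<longleftrightarrow> (\<forall>a b u v. w (\<lambda>j. a * u j + b * v j) = (\<lambda>j. a * w u j + b * w v j))"

lemma wneg_wneg [simp]: "wneg (wneg v) = v"
  by (simp add: wneg_def)

lemma int_linearD: "int_linear w \<Longrightarrow> w (\<lambda>j. a * u j + b * v j) = (\<lambda>j. a * w u j + b * w v j)"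
  by (simp add: int_linear_def)

lemma int_linear_scale: "int_linear w \<Longrightarrow> w (\<lambda>j. a * u j) = (\<lambda>j. a * w u j)"
  using int_linearD[of w a u 0 u] by simp

lemma int_linear_neg: "int_linear w \<Longrightarrow> w (wneg v) = wneg (w v)"
  using int_linear_scale[of w "-1" v] by (simp add: wneg_def)

lemma int_linear_0: "int_linear w \<Longrightarrow> w (\<lambda>_. 0) = (\<lambda>_. 0)"
  using int_linear_scale[of w 0] by simp

lemma int_linear_diff: "int_linear w \<Longrightarrow> w (\<lambda>j. u j - c * v j) = (\<lambda>j. w u j - c * w v j)"
  using int_linearD[of w 1 u "- c" v] by simp

lemma int_linear_sum:
  assumes "int_linear w"
  shows "w (\<lambda>j. \<Sum>x\<in>A. c x * v x j) = (\<lambda>j. \<Sum>x\<in>A. c x * w (v x) j)"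
proof (induction A rule: infinite_finite_induct)
  case (insert x A)
  have "w (\<lambda>j. c x * v x j + 1 * (\<Sum>x\<in>A. c x * v x j)) =
      (\<lambda>j. c x * w (v x) j + 1 * w (\<lambda>j. \<Sum>x\<in>A. c x * v x j) j)"
    by (rule int_linearD[OF assms])
  then show ?case using insert by simp
qed (simp_all add: int_linear_0[OF assms])

lemma int_linear_comp: "int_linear u \<Longrightarrow> int_linear v \<Longrightarrow> int_linear (u \<circ> v)"
  by (simp add: int_linear_def)

lemma int_linear_id: "int_linear id"
  by (simp add: int_linear_def)

lemma word_prod_Nil [simp]: "word_prod s [] = id"
  and word_prod_Cons [simp]: "word_prod s (x # xs) = s x \<circ> word_prod s xs"
  by (simp_all add: word_prod_def)

lemma word_prod_append: "word_prod s (xs @ ys) = word_prod s xs \<circ> word_prod s ys"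
  by (induction xs) (simp_all add: comp_assoc)


section \<open>Inversions and the exchange condition\<close>

text \<open>
  The properties of the group \<open>\<W>\<close> acting on the real roots that both cases share and that the
  structure of the nil-Hecke algebra depends on: the reflections and the simple roots behave as in a
  Coxeter group, up to elements that permute the positive roots.
\<close>

locale reflection_setting =
  fixes D :: setting
  assumes id_W: "id \<in> weyl_group D"
    and comp_W: "u \<in> weyl_group D \<Longrightarrow> w \<in> weyl_group D \<Longrightarrow> u \<circ> w \<in> weyl_group D"
    and inv_W: "w \<in> weyl_group D \<Longrightarrow> inv w \<in> weyl_group D"
    and bij_W: "w \<in> weyl_group D \<Longrightarrow> bij w"
    and linear_W: "w \<in> weyl_group D \<Longrightarrow> int_linear w"
    and lattice_W: "w \<in> weyl_group D \<Longrightarrow> v \<in> lattice (rank D) \<Longrightarrow> w v \<in> lattice (rank D)"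
    and pos_lattice: "\<alpha> \<in> pos_re D \<Longrightarrow> \<alpha> \<in> lattice (rank D)"
    and pos_not_neg: "\<alpha> \<in> pos_re D \<Longrightarrow> wneg \<alpha> \<notin> pos_re D"
    and pos_proportional: "\<alpha> \<in> pos_re D \<Longrightarrow> \<beta> \<in> pos_re D \<Longrightarrow> a \<noteq> 0 \<Longrightarrow>
      (\<And>j. a * \<alpha> j = b * \<beta> j) \<Longrightarrow> \<alpha> = \<beta>"
    and W_pos: "w \<in> weyl_group D \<Longrightarrow> \<alpha> \<in> pos_re D \<Longrightarrow> w \<alpha> \<in> pos_re D \<or> wneg (w \<alpha>) \<in> pos_re D"
    and refl_W: "\<alpha> \<in> pos_re D \<Longrightarrow> refl D \<alpha> \<in> weyl_group D"
    and refl_form: "\<alpha> \<in> pos_re D \<Longrightarrow> \<exists>c. refl D \<alpha> v = (\<lambda>j. v j - c * \<alpha> j)"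
    and refl_self: "\<alpha> \<in> pos_re D \<Longrightarrow> refl D \<alpha> \<alpha> = wneg \<alpha>"
    and refl_conj: "w \<in> weyl_group D \<Longrightarrow> \<alpha> \<in> pos_re D \<Longrightarrow> \<beta> \<in> pos_re D \<Longrightarrow>
      w \<alpha> = \<beta> \<or> w \<alpha> = wneg \<beta> \<Longrightarrow> refl D \<beta> \<circ> w = w \<circ> refl D \<alpha>"
    and simple_pos: "\<beta> \<in> simple D \<Longrightarrow> \<beta> \<in> pos_re D"
    and simple_refl_pos: "\<beta> \<in> simple D \<Longrightarrow> \<alpha> \<in> pos_re D \<Longrightarrow> \<alpha> \<noteq> \<beta> \<Longrightarrow> refl D \<beta> \<alpha> \<in> pos_re D"
    and finite_negated: "w \<in> weyl_group D \<Longrightarrow> finite {\<alpha> \<in> pos_re D. w \<alpha> \<notin> pos_re D}"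
    and simple_generate: "w \<in> weyl_group D \<Longrightarrow> (\<And>\<beta>. \<beta> \<in> simple D \<Longrightarrow> w \<beta> \<in> pos_re D) \<Longrightarrow>
      \<alpha> \<in> pos_re D \<Longrightarrow> w \<alpha> \<in> pos_re D"
    and imag_lattice: "\<eta> \<in> imag_roots D \<Longrightarrow> \<eta> \<in> lattice (rank D)"
    and imag_not_real: "\<eta> \<in> imag_roots D \<Longrightarrow> \<alpha> \<in> pos_re D \<Longrightarrow>
      (\<And>j. a * \<alpha> j = b * \<eta> j) \<Longrightarrow> a = 0"
    and imag_nonzero: "\<eta> \<in> imag_roots D \<Longrightarrow> \<eta> \<noteq> (\<lambda>_. 0)"
begin

abbreviation W where "W \<equiv> weyl_group D"

abbreviation s where "s \<equiv> refl D"

definition inversions :: "weyl \<Rightarrow> weight set" where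
  "inversions w = {\<alpha> \<in> pos_re D. inv w \<alpha> \<notin> pos_re D}"

definition len :: "weyl \<Rightarrow> nat" where
  "len w = card (inversions w)"

lemma finite_inversions: "w \<in> W \<Longrightarrow> finite (inversions w)"
  unfolding inversions_def by (intro finite_negated inv_W)

lemma pos_nonzero: "\<alpha> \<in> pos_re D \<Longrightarrow> \<alpha> \<noteq> (\<lambda>_. 0)"
  using pos_not_neg[of \<alpha>] by (auto simp: wneg_def)

lemma refl_refl: "\<alpha> \<in> pos_re D \<Longrightarrow> s \<alpha> (s \<alpha> v) = v"
proof -
  assume \<alpha>: "\<alpha> \<in> pos_re D"
  then obtain c where c: "s \<alpha> v = (\<lambda>j. v j - c * \<alpha> j)" using refl_form by blast
  have "s \<alpha> (s \<alpha> v) = (\<lambda>j. s \<alpha> v j - c * s \<alpha> \<alpha> j)"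
    by (subst c, rule int_linear_diff) (simp add: \<alpha> linear_W refl_W)
  then show ?thesis using \<alpha> by (simp add: refl_self c wneg_def)
qed

lemma refl_comp_refl: "\<alpha> \<in> pos_re D \<Longrightarrow> s \<alpha> \<circ> s \<alpha> = id"
  using refl_refl by auto

lemma refl_comp_refl': "\<alpha> \<in> pos_re D \<Longrightarrow> s \<alpha> \<circ> (s \<alpha> \<circ> w) = w"
  using refl_comp_refl[of \<alpha>] by (metis comp_assoc id_comp)

lemma inv_refl: "\<alpha> \<in> pos_re D \<Longrightarrow> inv (s \<alpha>) = s \<alpha>"
  by (meson refl_comp_refl inv_unique_comp)

lemma inv_refl_comp:
  "\<alpha> \<in> pos_re D \<Longrightarrow> w \<in> W \<Longrightarrow> inv (s \<alpha> \<circ> w) v = inv w (s \<alpha> v)"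
  using o_inv_distrib[of "s \<alpha>" w] by (simp add: bij_W refl_W inv_refl)

lemma W_neg: "w \<in> W \<Longrightarrow> w (wneg v) = wneg (w v)"
  by (simp add: linear_W int_linear_neg)

lemma refl_comp_W: "\<alpha> \<in> pos_re D \<Longrightarrow> w \<in> W \<Longrightarrow> s \<alpha> \<circ> w \<in> W"
  by (intro comp_W refl_W)

lemma inversions_refl_comp:
  assumes "\<alpha> \<in> pos_re D" "w \<in> W"
  shows "\<alpha> \<in> inversions (s \<alpha> \<circ> w) \<longleftrightarrow> \<alpha> \<notin> inversions w"
  using assms W_pos[of "inv w" \<alpha>] pos_not_neg[of "inv w \<alpha>"]
  by (auto simp: inversions_def inv_refl_comp refl_self W_neg inv_W)

text \<open>
  The simple reflection in \<open>\<beta>\<close> permutes the positive roots other than \<open>\<beta>\<close>, so apart from \<open>\<beta>\<close> it only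
  carries inversions to inversions.
\<close>

lemma inversions_ascend:
  assumes "\<beta> \<in> simple D" "w \<in> W" "\<beta> \<notin> inversions w"
  shows "inversions (s \<beta> \<circ> w) = insert \<beta> (s \<beta> ` inversions w)" (is ?A)
    and "\<beta> \<notin> s \<beta> ` inversions w" (is ?B)
proof -
  have \<beta>: "\<beta> \<in> pos_re D" using assms simple_pos by simp
  show ?B
  proof
    assume "\<beta> \<in> s \<beta> ` inversions w"
    then obtain \<gamma> where "\<gamma> \<in> inversions w" "\<beta> = s \<beta> \<gamma>" by blast
    then have "\<gamma> = wneg \<beta>" "\<gamma> \<in> pos_re D"
      using refl_refl[OF \<beta>, of \<gamma>] refl_self[OF \<beta>] by (auto simp: inversions_def)
    then show False using \<beta> pos_not_neg by blast
  qed
  show ?A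
  proof safe
    fix \<alpha> assume \<alpha>: "\<alpha> \<in> inversions (s \<beta> \<circ> w)" "\<alpha> \<notin> s \<beta> ` inversions w"
    show "\<alpha> = \<beta>"
    proof (rule ccontr)
      assume "\<alpha> \<noteq> \<beta>"
      then have "s \<beta> \<alpha> \<in> inversions w"
        using \<alpha> assms \<beta> by (auto simp: inversions_def inv_refl_comp simple_refl_pos)
      then show False using \<alpha> refl_refl[OF \<beta>, of \<alpha>] by (metis image_eqI)
    qed
  next
    show "\<beta> \<in> inversions (s \<beta> \<circ> w)" using assms \<beta> inversions_refl_comp by blast
  next
    fix \<gamma> assume "\<gamma> \<in> inversions w"
    then show "s \<beta> \<gamma> \<in> inversions (s \<beta> \<circ> w)"
      using assms \<beta> by (auto simp: inversions_def inv_refl_comp refl_refl intro!: simple_refl_pos)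
  qed
qed

lemma len_ascend:
  assumes "\<beta> \<in> simple D" "w \<in> W" "\<beta> \<notin> inversions w"
  shows "len (s \<beta> \<circ> w) = Suc (len w)"
proof -
  have "inj_on (s \<beta>) (inversions w)"
    using bij_W[OF refl_W[OF simple_pos[OF assms(1)]]] by (meson bij_is_inj inj_on_subset subset_UNIV)
  then show ?thesis
    using inversions_ascend[OF assms] finite_inversions[OF assms(2)]
    by (simp add: len_def card_image)
qed

lemma len_descend:
  assumes "\<beta> \<in> simple D" "w \<in> W" "\<beta> \<in> inversions w"
  shows "len w = Suc (len (s \<beta> \<circ> w))"
proof -
  have \<beta>: "\<beta> \<in> pos_re D" using assms simple_pos by simp
  have "len (s \<beta> \<circ> (s \<beta> \<circ> w)) = Suc (len (s \<beta> \<circ> w))"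
    using assms \<beta> by (intro len_ascend) (simp_all add: inversions_refl_comp refl_comp_W)
  then show ?thesis by (simp add: refl_comp_refl' \<beta>)
qed

lemma len_simple_le: "\<beta> \<in> simple D \<Longrightarrow> w \<in> W \<Longrightarrow> len (s \<beta> \<circ> w) \<le> Suc (len w)"
  using len_ascend[of \<beta> w] len_descend[of \<beta> w] by fastforce

lemma simple_inversion:
  assumes "w \<in> W" "inversions w \<noteq> {}"
  obtains \<beta> where "\<beta> \<in> simple D" "\<beta> \<in> inversions w"
  using assms simple_generate[of "inv w"] simple_pos by (auto simp: inversions_def inv_W)

lemma refl_conj_simple:
  assumes "\<beta> \<in> pos_re D" "\<alpha> \<in> pos_re D" "s \<beta> \<alpha> \<in> pos_re D"
  shows "s (s \<beta> \<alpha>) \<circ> (s \<beta> \<circ> w) = s \<beta> \<circ> (s \<alpha> \<circ> w)"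
  using refl_conj[of "s \<beta>" \<alpha> "s \<beta> \<alpha>"] assms by (metis comp_assoc refl_W)

text \<open>
  A simple reflection that shortens \<open>w\<close> carries an inversion \<open>\<alpha>\<close> of \<open>w\<close> to an inversion of a shorter
  element unless it is the reflection in \<open>\<alpha>\<close>, which makes induction on the length possible.
\<close>

lemma len_refl_less:
  assumes "w \<in> W" "\<alpha> \<in> inversions w"
  shows "len (s \<alpha> \<circ> w) < len w"
  using assms
proof (induction "len w" arbitrary: w \<alpha> rule: less_induct)
  case less
  obtain \<beta> where \<beta>: "\<beta> \<in> simple D" "\<beta> \<in> inversions w"
    using simple_inversion less.prems by blast
  have \<beta>': "\<beta> \<in> pos_re D" and \<alpha>: "\<alpha> \<in> pos_re D"
    using \<beta> simple_pos less.prems by (auto simp: inversions_def)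
  have l: "len w = Suc (len (s \<beta> \<circ> w))" using len_descend \<beta> less.prems by simp
  show ?case
  proof (cases "\<alpha> = \<beta>")
    case True
    then show ?thesis using l by simp
  next
    case False
    let ?\<alpha> = "s \<beta> \<alpha>"
    have \<alpha>': "?\<alpha> \<in> pos_re D" using False \<alpha> \<beta> simple_refl_pos by simp
    have "?\<alpha> \<in> inversions (s \<beta> \<circ> w)"
      using \<alpha>' \<beta>' less.prems by (simp add: inversions_def inv_refl_comp refl_refl)
    then have "len (s ?\<alpha> \<circ> (s \<beta> \<circ> w)) < len (s \<beta> \<circ> w)"
      using less.hyps[of "s \<beta> \<circ> w" ?\<alpha>] l less.prems \<beta>' by (simp add: refl_comp_W)
    then have "len (s \<beta> \<circ> (s \<alpha> \<circ> w)) < len (s \<beta> \<circ> w)"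
      by (simp only: refl_conj_simple[OF \<beta>' \<alpha> \<alpha>'])
    moreover have "len (s \<beta> \<circ> (s \<beta> \<circ> (s \<alpha> \<circ> w))) \<le> Suc (len (s \<beta> \<circ> (s \<alpha> \<circ> w)))"
      using \<beta> \<beta>' \<alpha> less.prems by (intro len_simple_le refl_comp_W)
    ultimately show ?thesis using l by (simp add: refl_comp_refl' \<beta>')
  qed
qed

lemma len_refl_greater:
  assumes "w \<in> W" "\<alpha> \<in> pos_re D" "\<alpha> \<notin> inversions w"
  shows "len w < len (s \<alpha> \<circ> w)"
  using len_refl_less[of "s \<alpha> \<circ> w" \<alpha>] assms
  by (simp add: inversions_refl_comp refl_comp_W refl_comp_refl')

lemma word_W: "set as \<subseteq> simple D \<Longrightarrow> word_prod s as \<in> W"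
  by (induction as) (auto simp: id_W intro!: refl_comp_W simple_pos)

text \<open>
  Moved past the letters of the word one by one, the reflection in \<open>\<alpha>\<close> becomes the reflection in the
  image of \<open>\<alpha>\<close> under them. As \<open>\<alpha>\<close> is an inversion, it meets a letter that it equals, and cancels it.
\<close>

lemma exchange:
  assumes "set as \<subseteq> simple D" "\<alpha> \<in> inversions (word_prod s as)"
  shows "\<exists>bs. set bs \<subseteq> simple D \<and> length as = Suc (length bs) \<and>
    word_prod s bs = s \<alpha> \<circ> word_prod s as"
  using assms
proof (induction as arbitrary: \<alpha>)
  case Nil
  then show ?case by (simp add: inversions_def inv_id)
next
  case (Cons \<beta> as)
  have \<beta>: "\<beta> \<in> simple D" "\<beta> \<in> pos_re D" and as: "set as \<subseteq> simple D"
    using Cons.prems simple_pos by auto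
  have \<alpha>: "\<alpha> \<in> pos_re D" using Cons.prems by (simp add: inversions_def)
  show ?case
  proof (cases "\<alpha> = \<beta>")
    case True
    then have "word_prod s as = s \<alpha> \<circ> word_prod s (\<beta> # as)"
      using \<beta> by (simp only: word_prod_Cons refl_comp_refl')
    then show ?thesis using as by (metis length_Cons)
  next
    case False
    let ?\<alpha> = "s \<beta> \<alpha>"
    have \<alpha>': "?\<alpha> \<in> pos_re D" using False \<alpha> \<beta> simple_refl_pos by simp
    have "?\<alpha> \<in> inversions (word_prod s as)"
      using Cons.prems(2) \<alpha>'
      unfolding word_prod_Cons inversions_def mem_Collect_eq inv_refl_comp[OF \<beta>(2) word_W[OF as]]
      by blast
    then obtain bs where bs: "set bs \<subseteq> simple D" "length as = Suc (length bs)"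
      "word_prod s bs = s ?\<alpha> \<circ> word_prod s as"
      using Cons.IH[OF as] by blast
    have "s ?\<alpha> \<circ> word_prod s as = s \<beta> \<circ> (s \<alpha> \<circ> (s \<beta> \<circ> word_prod s as))"
      using refl_conj_simple[OF \<beta>(2) \<alpha> \<alpha>', of "s \<beta> \<circ> word_prod s as"]
      unfolding refl_comp_refl'[OF \<beta>(2)] .
    then have "s \<beta> \<circ> (s ?\<alpha> \<circ> word_prod s as) = s \<alpha> \<circ> (s \<beta> \<circ> word_prod s as)"
      unfolding refl_comp_refl'[OF \<beta>(2)] by (simp only: refl_comp_refl'[OF \<beta>(2)])
    then show ?thesis
      using bs \<beta> by (intro exI[of _ "\<beta> # bs"]) simp
  qed
qed

text \<open>
  In a word of minimal length no letter can remove an inversion, because the exchange condition would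
  yield a word shorter by two letters. So such a word has as many letters as its product has inversions.
\<close>

lemma reduced_word_Cons:
  assumes "reduced_word D (\<beta> # as)"
  shows "\<beta> \<in> simple D" "set as \<subseteq> simple D" "reduced_word D as"
    "\<beta> \<notin> inversions (word_prod s as)"
proof -
  show \<beta>: "\<beta> \<in> simple D" and as: "set as \<subseteq> simple D"
    using assms by (auto simp: reduced_word_def)
  have minimal: "length (\<beta> # as) \<le> length bs"
    if "set bs \<subseteq> simple D" "word_prod s bs = word_prod s (\<beta> # as)" for bs
    using assms that unfolding reduced_word_def by blast
  show "reduced_word D as"
    unfolding reduced_word_def
  proof (intro conjI as allI impI)
    fix bs assume "set bs \<subseteq> simple D \<and> word_prod s bs = word_prod s as"
    then show "length as \<le> length bs"
      using minimal[of "\<beta> # bs"] \<beta> by simp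
  qed
  show "\<beta> \<notin> inversions (word_prod s as)"
  proof
    assume "\<beta> \<in> inversions (word_prod s as)"
    then obtain bs where "set bs \<subseteq> simple D" "length as = Suc (length bs)"
      "word_prod s bs = word_prod s (\<beta> # as)"
      using exchange[OF as] by auto
    then show False using minimal[of bs] by simp
  qed
qed

lemma len_reduced: "reduced_word D as \<Longrightarrow> len (word_prod s as) = length as"
proof (induction as)
  case Nil
  then show ?case by (simp add: len_def inversions_def inv_id)
next
  case (Cons \<beta> as)
  note as = reduced_word_Cons[OF Cons.prems]
  have "len (s \<beta> \<circ> word_prod s as) = Suc (len (word_prod s as))"
    by (rule len_ascend[OF as(1) word_W[OF as(2)] as(4)])
  then show ?case using Cons.IH[OF as(3)]
    by (metis length_Cons word_prod_Cons)
qed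

lemma reduced_word_exists:
  assumes "a \<in> refl_group s (simple D)"
  obtains as where "reduced_word D as" "word_prod s as = a"
proof -
  let ?P = "\<lambda>n. \<exists>as. set as \<subseteq> simple D \<and> word_prod s as = a \<and> length as = n"
  obtain as where as: "set as \<subseteq> simple D" "word_prod s as = a"
    using assms by (auto simp: refl_group_def)
  then have "\<exists>n. ?P n" by blast
  then have "?P (LEAST n. ?P n)" by (rule LeastI_ex)
  then obtain bs where bs: "set bs \<subseteq> simple D" "word_prod s bs = a" "length bs = (LEAST n. ?P n)"
    by blast
  have "reduced_word D bs"
    unfolding reduced_word_def
  proof (intro conjI bs allI impI)
    fix cs assume "set cs \<subseteq> simple D \<and> word_prod s cs = word_prod s bs"
    then have "?P (length cs)" using bs by auto
    then show "length bs \<le> length cs" unfolding bs(3) by (rule Least_le)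
  qed
  then show ?thesis using that bs by blast
qed

lemma reflection_group_W: "refl_group s (simple D) \<subseteq> W"
  using word_W by (auto simp: refl_group_def)

text \<open>
  As long as there is an inversion there is a simple one, whose reflection can be stripped off.
\<close>

lemma cox_times_positive:
  assumes "w \<in> W"
  shows "\<exists>a \<omega>. a \<in> refl_group s (simple D) \<and> \<omega> \<in> W \<and> inversions \<omega> = {} \<and> w = a \<circ> \<omega>"
  using assms
proof (induction "len w" arbitrary: w rule: less_induct)
  case less
  show ?case
  proof (cases "inversions w = {}")
    case True
    have "id \<in> refl_group s (simple D)"
      unfolding refl_group_def by (auto intro!: exI[of _ "[]"])
    then show ?thesis using True less.prems by (metis id_comp)
  next
    case False
    then obtain \<beta> where \<beta>: "\<beta> \<in> simple D" "\<beta> \<in> inversions w"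
      using simple_inversion less.prems by blast
    have \<beta>': "\<beta> \<in> pos_re D" using \<beta> simple_pos by simp
    obtain a \<omega> where a: "a \<in> refl_group s (simple D)" "\<omega> \<in> W" "inversions \<omega> = {}" "s \<beta> \<circ> w = a \<circ> \<omega>"
      using less.hyps[of "s \<beta> \<circ> w"] len_descend[OF \<beta>(1) less.prems \<beta>(2)] less.prems \<beta>'
      by (auto simp: refl_comp_W)
    obtain as where as: "set as \<subseteq> simple D" "a = word_prod s as"
      using a(1) by (auto simp: refl_group_def)
    have "s \<beta> \<circ> a \<in> refl_group s (simple D)"
      unfolding refl_group_def using as \<beta> by (auto intro!: exI[of _ "\<beta> # as"])
    moreover have "w = (s \<beta> \<circ> a) \<circ> \<omega>"
      using a(4) refl_comp_refl'[OF \<beta>', of w] by (simp add: comp_assoc)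
    ultimately show ?thesis using a by blast
  qed
qed

lemma positive_preserves:
  assumes "\<omega> \<in> W"
  shows "inversions \<omega> = {} \<longleftrightarrow> (\<forall>\<alpha>\<in>pos_re D. \<omega> \<alpha> \<in> pos_re D)"
proof -
  have *: "\<forall>\<alpha>\<in>pos_re D. inv u \<alpha> \<in> pos_re D" if "u \<in> W" "\<forall>\<alpha>\<in>pos_re D. u \<alpha> \<in> pos_re D" for u
  proof
    fix \<alpha> assume \<alpha>: "\<alpha> \<in> pos_re D"
    show "inv u \<alpha> \<in> pos_re D"
    proof (rule ccontr)
      assume "inv u \<alpha> \<notin> pos_re D"
      then have "wneg (inv u \<alpha>) \<in> pos_re D" using W_pos[OF inv_W[OF that(1)] \<alpha>] by blast
      then have "u (wneg (inv u \<alpha>)) \<in> pos_re D" using that by blast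
      then have "wneg \<alpha> \<in> pos_re D"
        using that by (simp add: W_neg surj_f_inv_f bij_is_surj bij_W)
      then show False using \<alpha> pos_not_neg by blast
    qed
  qed
  show ?thesis
    using *[OF assms] *[OF inv_W[OF assms]] inv_inv_eq[OF bij_W[OF assms]]
    by (auto simp: inversions_def)
qed

text \<open>A reduced word has as many letters as its product has inversions.\<close>

lemma cox_positive_trivial:
  assumes "w \<in> refl_group s (simple D)" "inversions w = {}"
  shows "w = id"
proof -
  obtain as where as: "reduced_word D as" "word_prod s as = w"
    using assms(1) by (rule reduced_word_exists)
  then have "length as = 0" using len_reduced[OF as(1)] assms(2) by (simp add: len_def)
  then show ?thesis using as by simp
qed

end


section \<open>Rational functions and the action of the Weyl group\<close>

abbreviation emb :: "mpol \<Rightarrow> ratfun" where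
  "emb p \<equiv> Fract p 1"

lemma emb_eq_iff [simp]: "emb p = emb q \<longleftrightarrow> p = q"
  by (simp add: eq_fract)

lemma emb_0: "emb 0 = 0"
  and emb_1: "emb 1 = 1"
  by (simp_all add: Zero_fract_def One_fract_def)

lemma emb_eq_0_iff [simp]: "emb p = 0 \<longleftrightarrow> p = 0"
  by (simp add: Zero_fract_def eq_fract)

lemma emb_add: "emb (p + q) = emb p + emb q"
  and emb_mult: "emb (p * q) = emb p * emb q"
  and emb_uminus: "emb (- p) = - emb p"
  by simp_all

lemma emb_prod: "emb (prod f A) = (\<Prod>x\<in>A. emb (f x))"
  by (induction A rule: infinite_finite_induct) (simp_all add: emb_1 emb_mult del: mult_fract)

lemma Fract_eq_divide: "Fract a b = emb a / emb b"
  by simp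

lemma linQ_eq_emb: "linQ D v = emb (lin D v)"
  by (simp add: linQ_def)

lemma linQ_wneg: "linQ D (wneg v) = - linQ D v"
  by (simp add: linQ_def wneg_def lin_uminus)

definition Frac_S :: "setting \<Rightarrow> ratfun set" where
  "Frac_S D = {Fract a b | a b. a \<in> S_ring D \<and> b \<in> S_ring D \<and> b \<noteq> 0}"

lemma Frac_SI: "a \<in> S_ring D \<Longrightarrow> b \<in> S_ring D \<Longrightarrow> b \<noteq> 0 \<Longrightarrow> Fract a b \<in> Frac_S D"
  by (auto simp: Frac_S_def)

lemma Frac_SE:
  assumes "x \<in> Frac_S D"
  obtains a b where "x = Fract a b" "a \<in> S_ring D" "b \<in> S_ring D" "b \<noteq> 0"
  using assms by (auto simp: Frac_S_def)

lemma Frac_S_emb: "p \<in> S_ring D \<Longrightarrow> emb p \<in> Frac_S D"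
  by (intro Frac_SI) auto

lemma Frac_S_0 [simp]: "0 \<in> Frac_S D"
  using Frac_S_emb[of 0 D] by (simp add: emb_0)

lemma Frac_S_1 [simp]: "1 \<in> Frac_S D"
  using Frac_S_emb[of 1 D] by (simp add: emb_1)

lemma Frac_S_add: "x \<in> Frac_S D \<Longrightarrow> y \<in> Frac_S D \<Longrightarrow> x + y \<in> Frac_S D"
  by (elim Frac_SE) (auto intro!: Frac_SI)

lemma Frac_S_mult: "x \<in> Frac_S D \<Longrightarrow> y \<in> Frac_S D \<Longrightarrow> x * y \<in> Frac_S D"
  by (elim Frac_SE) (auto intro!: Frac_SI)

lemma Frac_S_uminus: "x \<in> Frac_S D \<Longrightarrow> - x \<in> Frac_S D"
  by (elim Frac_SE) (auto intro!: Frac_SI)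

lemma Frac_S_inverse: "x \<in> Frac_S D \<Longrightarrow> inverse x \<in> Frac_S D"
proof (elim Frac_SE)
  fix a b assume *: "x = Fract a b" "a \<in> S_ring D" "b \<in> S_ring D" "b \<noteq> 0"
  show "inverse x \<in> Frac_S D"
  proof (cases "a = 0")
    case True
    then have "x = 0" using * by (simp add: fract_collapse)
    then show ?thesis by simp
  next
    case False
    then show ?thesis using * by (auto intro: Frac_SI)
  qed
qed

lemma Frac_S_divide: "x \<in> Frac_S D \<Longrightarrow> y \<in> Frac_S D \<Longrightarrow> x / y \<in> Frac_S D"
  by (simp add: divide_inverse Frac_S_mult Frac_S_inverse)

lemma Frac_S_linQ: "linQ D v \<in> Frac_S D"
  by (simp add: linQ_eq_emb Frac_S_emb)

lemma local_ring_Frac_S: "x \<in> local_ring D \<alpha> \<Longrightarrow> x \<in> Frac_S D"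
  unfolding local_ring_def by (auto intro!: Frac_SI)

lemma actS_in_S: "p \<in> S_ring D \<Longrightarrow> actS D w p \<in> S_ring D"
  by (simp add: actS_eq_subst S_ring_subst)

lemma actS_0 [simp]: "actS D w 0 = 0"
  and actS_1 [simp]: "actS D w 1 = 1"
  and actS_mult: "actS D w (p * q) = actS D w p * actS D w q"
  and actS_add: "actS D w (p + q) = actS D w p + actS D w q"
  by (simp_all add: actS_eq_subst subst_mult subst_add)

lemma unit_vec_lattice: "i < N \<Longrightarrow> unit_vec i \<in> lattice N"
  by (simp add: unit_vec_def lattice_def)

lemma lin_unit_vec: "i < rank D \<Longrightarrow> lin D (unit_vec i) = poly_var i"
  by (simp add: lin_def unit_vec_def if_distrib[of of_int] if_distrib[of poly_const]
      if_distrib[of "\<lambda>x. x * _"] sum.delta cong: if_cong)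

lemma lattice_expansion:
  assumes "v \<in> lattice N"
  shows "v = (\<lambda>j. \<Sum>i<N. v i * unit_vec i j)"
proof
  fix j
  show "v j = (\<Sum>i<N. v i * unit_vec i j)"
    using assms by (cases "j < N") (simp_all add: unit_vec_def lattice_def if_distrib sum.delta cong: if_cong)
qed

lemma lin_sum: "lin D (\<lambda>j. \<Sum>x\<in>A. c x * v x j) = (\<Sum>x\<in>A. poly_const (of_int (c x)) * lin D (v x))"
proof (induction A rule: infinite_finite_induct)
  case (insert x A)
  then show ?case using lin_comb[of D "c x" "v x" 1 "\<lambda>j. \<Sum>x\<in>A. c x * v x j"] by simp
qed simp_all

lemma actS_lin:
  assumes "int_linear w" "v \<in> lattice (rank D)"
  shows "actS D w (lin D v) = lin D (w v)"
proof -
  have "w v = (\<lambda>j. \<Sum>i<rank D. v i * w (unit_vec i) j)"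
    by (subst lattice_expansion[OF assms(2)]) (rule int_linear_sum[OF assms(1)])
  then have "lin D (w v) = (\<Sum>i<rank D. poly_const (of_int (v i)) * lin D (w (unit_vec i)))"
    by (simp only: lin_sum)
  then show ?thesis
    by (simp add: lin_def[of D v] actS_eq_subst subst_sum subst_mult)
qed

context reflection_setting
begin

abbreviation S where "S \<equiv> S_ring D"

abbreviation \<Phi> where "\<Phi> \<equiv> pos_re D"

lemma actS_lin_W: "w \<in> W \<Longrightarrow> v \<in> lattice (rank D) \<Longrightarrow> actS D w (lin D v) = lin D (w v)"
  by (simp add: actS_lin linear_W)

lemma actS_id: "p \<in> S \<Longrightarrow> actS D id p = p"
proof -
  assume "p \<in> S"
  then have "actS D id p = subst poly_var p"
    unfolding actS_eq_subst by (intro subst_cong) (auto simp: S_ring_iff_vars lin_unit_vec)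
  then show ?thesis by simp
qed

lemma actS_comp:
  assumes "u \<in> W" "w \<in> W" "p \<in> S"
  shows "actS D u (actS D w p) = actS D (u \<circ> w) p"
proof -
  have "subst (\<lambda>i. actS D u (lin D (w (unit_vec i)))) p = actS D (u \<circ> w) p"
    unfolding actS_eq_subst[of D "u \<circ> w"] using assms
    by (intro subst_cong) (auto simp: S_ring_iff_vars actS_lin_W lattice_W unit_vec_lattice)
  then show ?thesis
    by (simp add: actS_eq_subst subst_subst)
qed

lemma inv_comp_W: "w \<in> W \<Longrightarrow> inv w \<circ> w = id"
  by (simp add: bij_W bij_is_inj)

lemma comp_inv_W: "w \<in> W \<Longrightarrow> w \<circ> inv w = id"
  by (metis bij_W bij_is_surj surj_iff)

lemma actS_eq_0_iff: "w \<in> W \<Longrightarrow> p \<in> S \<Longrightarrow> actS D w p = 0 \<longleftrightarrow> p = 0"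
proof
  assume "w \<in> W" "p \<in> S" "actS D w p = 0"
  then show "p = 0"
    using actS_comp[of "inv w" w p] by (simp add: inv_W inv_comp_W actS_id)
qed simp

text \<open>
  The action respects cross multiplication and does not annihilate denominators, so it
  does not depend on the fraction that was chosen.
\<close>

lemma actQ_Fract:
  assumes "w \<in> W" "a \<in> S" "b \<in> S" "b \<noteq> 0"
  shows "actQ D w (Fract a b) = Fract (actS D w a) (actS D w b)"
proof -
  let ?P = "\<lambda>(a', b'). a' \<in> S \<and> b' \<in> S \<and> b' \<noteq> 0 \<and> Fract a b = Fract a' b'"
  obtain a' b' where ab: "(SOME ab. ?P ab) = (a', b')" by force
  have "?P (SOME ab. ?P ab)" using assms by (intro someI[of ?P "(a, b)"]) auto
  then have ab': "a' \<in> S" "b' \<in> S" "b' \<noteq> 0" "Fract a b = Fract a' b'" by (auto simp: ab)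
  then have "actS D w a * actS D w b' = actS D w a' * actS D w b"
    using assms by (simp add: eq_fract flip: actS_mult)
  then have "Fract (actS D w a') (actS D w b') = Fract (actS D w a) (actS D w b)"
    using ab' assms by (simp add: actS_eq_0_iff eq_fract)
  then show ?thesis
    unfolding actQ_def ab by simp
qed

lemma actQ_add:
  "w \<in> W \<Longrightarrow> x \<in> Frac_S D \<Longrightarrow> y \<in> Frac_S D \<Longrightarrow> actQ D w (x + y) = actQ D w x + actQ D w y"
  by (elim Frac_SE)
    (auto simp: actQ_Fract actS_eq_0_iff S_ring_mult S_ring_add actS_mult actS_add)

lemma actQ_mult:
  "w \<in> W \<Longrightarrow> x \<in> Frac_S D \<Longrightarrow> y \<in> Frac_S D \<Longrightarrow> actQ D w (x * y) = actQ D w x * actQ D w y"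
  by (elim Frac_SE)
    (auto simp: actQ_Fract actS_eq_0_iff S_ring_mult S_ring_add actS_mult actS_add)

lemma actQ_emb: "w \<in> W \<Longrightarrow> p \<in> S \<Longrightarrow> actQ D w (emb p) = emb (actS D w p)"
  by (simp add: actQ_Fract)

lemma actQ_0: "w \<in> W \<Longrightarrow> actQ D w 0 = 0"
  using actQ_emb[of w 0] by (simp add: emb_0)

lemma actQ_1: "w \<in> W \<Longrightarrow> actQ D w 1 = 1"
  using actQ_emb[of w 1] by (simp add: emb_1)

lemma actQ_uminus: "w \<in> W \<Longrightarrow> x \<in> Frac_S D \<Longrightarrow> actQ D w (- x) = - actQ D w x"
  using actQ_add[of w x "- x"] by (simp add: Frac_S_uminus actQ_0 eq_neg_iff_add_eq_0 add.commute)

lemma actQ_diff: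
  "w \<in> W \<Longrightarrow> x \<in> Frac_S D \<Longrightarrow> y \<in> Frac_S D \<Longrightarrow> actQ D w (x - y) = actQ D w x - actQ D w y"
  using actQ_add[of w x "- y"] by (simp add: Frac_S_uminus actQ_uminus)

lemma actQ_inverse:
  assumes "w \<in> W" "x \<in> Frac_S D"
  shows "actQ D w (inverse x) = inverse (actQ D w x)"
proof (cases "x = 0")
  case False
  then have "actQ D w x * actQ D w (inverse x) = 1"
    using assms by (simp add: actQ_1 Frac_S_inverse flip: actQ_mult)
  then show ?thesis by (rule inverse_unique[symmetric])
qed (simp add: actQ_0 assms)

lemma actQ_comp:
  "u \<in> W \<Longrightarrow> w \<in> W \<Longrightarrow> x \<in> Frac_S D \<Longrightarrow> actQ D u (actQ D w x) = actQ D (u \<circ> w) x"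
  by (elim Frac_SE) (auto simp: actQ_Fract actS_in_S actS_eq_0_iff comp_W actS_comp)

lemma actQ_id: "x \<in> Frac_S D \<Longrightarrow> actQ D id x = x"
  by (elim Frac_SE) (auto simp: actQ_Fract id_W actS_id)

lemma actQ_linQ: "w \<in> W \<Longrightarrow> v \<in> lattice (rank D) \<Longrightarrow> actQ D w (linQ D v) = linQ D (w v)"
  by (simp add: linQ_eq_emb actQ_emb actS_lin_W)

lemma linQ_pos_nonzero: "\<alpha> \<in> \<Phi> \<Longrightarrow> linQ D \<alpha> \<noteq> 0"
  by (simp add: linQ_eq_emb lin_eq_0_iff pos_lattice pos_nonzero)

lemma lin_pos_prime: "\<alpha> \<in> \<Phi> \<Longrightarrow> lin D \<alpha> dvd p * q \<longleftrightarrow> lin D \<alpha> dvd p \<or> lin D \<alpha> dvd q"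
  by (rule lin_prime[OF pos_lattice pos_nonzero])

lemma lin_pos_dvd:
  assumes "\<alpha> \<in> \<Phi>" "\<beta> \<in> \<Phi>" "lin D \<alpha> dvd lin D \<beta>"
  shows "\<alpha> = \<beta>"
proof -
  obtain a b where "a \<noteq> 0" "\<And>j. a * \<beta> j = b * \<alpha> j"
    using lin_dvd_lin[of \<alpha> D \<beta>] assms by (auto simp: pos_lattice pos_nonzero)
  then show ?thesis using pos_proportional assms by metis
qed


section \<open>Rings of functions with poles along real root hyperplanes\<close>

subsection \<open>The local ring of a root hyperplane\<close>

lemma local_ringI: "a \<in> S \<Longrightarrow> b \<in> S \<Longrightarrow> \<not> lin D \<alpha> dvd b \<Longrightarrow> Fract a b \<in> local_ring D \<alpha>"
  by (auto simp: local_ring_def)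

lemma local_ringE:
  assumes "x \<in> local_ring D \<alpha>"
  obtains a b where "x = Fract a b" "a \<in> S" "b \<in> S" "\<not> lin D \<alpha> dvd b" "b \<noteq> 0"
  using assms by (auto simp: local_ring_def)

lemma local_emb: "\<alpha> \<in> \<Phi> \<Longrightarrow> p \<in> S \<Longrightarrow> emb p \<in> local_ring D \<alpha>"
  by (intro local_ringI lin_not_unit pos_lattice pos_nonzero) auto

lemma local_0: "\<alpha> \<in> \<Phi> \<Longrightarrow> 0 \<in> local_ring D \<alpha>"
  using local_emb[of \<alpha> 0] by (simp add: emb_0)

lemma local_1: "\<alpha> \<in> \<Phi> \<Longrightarrow> 1 \<in> local_ring D \<alpha>"
  using local_emb[of \<alpha> 1] by (simp add: emb_1)

lemma local_linQ: "\<alpha> \<in> \<Phi> \<Longrightarrow> linQ D v \<in> local_ring D \<alpha>"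
  using local_emb[of \<alpha> "lin D v"] by (simp add: linQ_eq_emb)

lemma local_add: "\<alpha> \<in> \<Phi> \<Longrightarrow> x \<in> local_ring D \<alpha> \<Longrightarrow> y \<in> local_ring D \<alpha> \<Longrightarrow> x + y \<in> local_ring D \<alpha>"
  by (elim local_ringE) (auto simp: lin_pos_prime intro!: local_ringI)

lemma local_mult: "\<alpha> \<in> \<Phi> \<Longrightarrow> x \<in> local_ring D \<alpha> \<Longrightarrow> y \<in> local_ring D \<alpha> \<Longrightarrow> x * y \<in> local_ring D \<alpha>"
  by (elim local_ringE) (auto simp: lin_pos_prime intro!: local_ringI)

lemma local_uminus: "x \<in> local_ring D \<alpha> \<Longrightarrow> - x \<in> local_ring D \<alpha>"
  by (elim local_ringE) (auto intro!: local_ringI)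

lemma local_diff: "\<alpha> \<in> \<Phi> \<Longrightarrow> x \<in> local_ring D \<alpha> \<Longrightarrow> y \<in> local_ring D \<alpha> \<Longrightarrow> x - y \<in> local_ring D \<alpha>"
  using local_add[of \<alpha> x "- y"] by (simp add: local_uminus)

lemma local_sum:
  "\<alpha> \<in> \<Phi> \<Longrightarrow> (\<And>x. x \<in> A \<Longrightarrow> f x \<in> local_ring D \<alpha>) \<Longrightarrow> sum f A \<in> local_ring D \<alpha>"
  by (induction A rule: infinite_finite_induct) (auto simp: local_0 local_add)

lemma local_inverse_linQ:
  "\<alpha> \<in> \<Phi> \<Longrightarrow> \<beta> \<in> \<Phi> \<Longrightarrow> \<alpha> \<noteq> \<beta> \<Longrightarrow> 1 / linQ D \<beta> \<in> local_ring D \<alpha>"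
  using local_ringI[of 1 "lin D \<beta>" \<alpha>] lin_pos_dvd[of \<alpha> \<beta>]
  by (auto simp: linQ_eq_emb One_fract_def)

lemma local_ring_wneg: "local_ring D (wneg \<alpha>) = local_ring D \<alpha>"
  by (simp add: local_ring_def wneg_def lin_uminus)

lemma actQ_local:
  assumes "w \<in> W" "\<alpha> \<in> lattice (rank D)" "x \<in> local_ring D \<alpha>"
  shows "actQ D w x \<in> local_ring D (w \<alpha>)"
proof -
  obtain a b where x: "x = Fract a b" "a \<in> S" "b \<in> S" "\<not> lin D \<alpha> dvd b" "b \<noteq> 0"
    using assms(3) by (rule local_ringE)
  have "\<not> lin D (w \<alpha>) dvd actS D w b"
  proof
    assume "lin D (w \<alpha>) dvd actS D w b"
    then have "actS D (inv w) (lin D (w \<alpha>)) dvd actS D (inv w) (actS D w b)"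
      by (simp add: actS_eq_subst subst_dvd)
    then show False
      using assms x by (simp add: actS_comp actS_lin_W inv_W lattice_W inv_comp_W actS_id bij_W
          bij_is_inj)
  qed
  then show ?thesis
    using assms x by (simp add: actQ_Fract actS_in_S local_ringI)
qed

lemma actQ_refl_local: "\<alpha> \<in> \<Phi> \<Longrightarrow> x \<in> local_ring D \<alpha> \<Longrightarrow> actQ D (s \<alpha>) x \<in> local_ring D \<alpha>"
  using actQ_local[of "s \<alpha>" \<alpha> x] by (simp add: refl_W pos_lattice refl_self local_ring_wneg)

text \<open>A reflection acts trivially on its hyperplane.\<close>

lemma lin_dvd_diff_actS_refl:
  assumes "\<alpha> \<in> \<Phi>" "p \<in> S"
  shows "lin D \<alpha> dvd p - actS D (s \<alpha>) p"
proof -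
  have "lin D \<alpha> dvd subst poly_var p - actS D (s \<alpha>) p"
    unfolding actS_eq_subst
  proof (rule subst_cong_dvd)
    fix i assume "i \<in> vars p"
    then have i: "i < rank D" using assms by (auto simp: S_ring_iff_vars)
    obtain c where "s \<alpha> (unit_vec i) = (\<lambda>j. unit_vec i j - c * \<alpha> j)"
      using refl_form assms by blast
    then have "lin D (s \<alpha> (unit_vec i)) = poly_var i - poly_const (of_int c) * lin D \<alpha>"
      using lin_comb[of D 1 "unit_vec i" "- c" \<alpha>] i by (simp add: lin_unit_vec poly_const_uminus)
    then show "lin D \<alpha> dvd poly_var i - lin D (s \<alpha> (unit_vec i))" by simp
  qed
  then show ?thesis by simp
qed

text \<open>
  Numerator and denominator are congruent to their images modulo the root; this is what cancels double
  poles in products.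
\<close>

lemma local_diff_actQ_refl:
  assumes "\<alpha> \<in> \<Phi>" "x \<in> local_ring D \<alpha>"
  shows "(x - actQ D (s \<alpha>) x) / linQ D \<alpha> \<in> local_ring D \<alpha>"
proof -
  obtain a b where x: "x = Fract a b" "a \<in> S" "b \<in> S" "\<not> lin D \<alpha> dvd b" "b \<noteq> 0"
    using assms(2) by (rule local_ringE)
  let ?s = "actS D (s \<alpha>)"
  have sW: "s \<alpha> \<in> W" using assms refl_W by simp
  obtain a' b' where a': "a - ?s a = lin D \<alpha> * a'" "a' \<in> S" and b': "b - ?s b = lin D \<alpha> * b'" "b' \<in> S"
    using lin_dvd_diff_actS_refl[OF assms(1)] x actS_in_S S_ring_dvd_cofactor lin_in_S S_ring_diff
    by metis
  have nz: "?s b \<noteq> 0" using actS_eq_0_iff sW x by simp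
  have ndvd: "\<not> lin D \<alpha> dvd ?s b"
    using b' x by (metis diff_eq_eq dvd_add_right_iff dvd_triv_left)
  have eq: "a * ?s b - ?s a * b = lin D \<alpha> * (a' * b - a * b')"
  proof -
    have "a * ?s b - ?s a * b = (a - ?s a) * b - a * (b - ?s b)" by (simp add: algebra_simps)
    then show ?thesis by (simp add: a' b' algebra_simps)
  qed
  have "x - actQ D (s \<alpha>) x = Fract (a * ?s b - ?s a * b) (b * ?s b)"
    using x nz sW by (simp add: actQ_Fract)
  also have "\<dots> = linQ D \<alpha> * Fract (a' * b - a * b') (b * ?s b)"
    by (simp add: eq linQ_eq_emb)
  finally have "(x - actQ D (s \<alpha>) x) / linQ D \<alpha> = Fract (a' * b - a * b') (b * ?s b)"
    using linQ_pos_nonzero[OF assms(1)] by simp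
  moreover have "Fract (a' * b - a * b') (b * ?s b) \<in> local_ring D \<alpha>"
    using x a' b' ndvd assms by (intro local_ringI) (auto simp: lin_pos_prime actS_in_S)
  ultimately show ?thesis by simp
qed

lemma simple_pole_Frac_S:
  assumes "\<alpha> \<in> \<Phi>" "linQ D \<alpha> * x \<in> local_ring D \<alpha>"
  shows "x \<in> Frac_S D"
proof -
  have "linQ D \<alpha> * x / linQ D \<alpha> \<in> Frac_S D"
    by (intro Frac_S_divide local_ring_Frac_S[OF assms(2)] Frac_S_linQ)
  then show ?thesis using linQ_pos_nonzero[OF assms(1)] by simp
qed

text \<open>
  Adding cosets adds their representatives, so residues cancel iff the sum of the functions is regular.
\<close>

lemma residues_local_iff:
  assumes "\<alpha> \<in> \<Phi>"
  shows "Res D \<alpha> x + Res D \<alpha> y = restrict_hyp D \<alpha> 0 \<longleftrightarrow> x + y \<in> local_ring D \<alpha>"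
proof -
  let ?t = "linQ D \<alpha>" and ?O = "local_ring D \<alpha>"
  have t: "?t \<noteq> 0" using assms by (rule linQ_pos_nonzero)
  have "Res D \<alpha> x + Res D \<alpha> y = {?t * (x + y + r) | r. r \<in> ?O}"
  proof safe
    fix z assume "z \<in> Res D \<alpha> x + Res D \<alpha> y"
    then obtain r r' where "r \<in> ?O" "r' \<in> ?O" "z = (?t * x + ?t * r) + (?t * y + ?t * r')"
      by (auto simp: set_plus_def Res_def restrict_hyp_def)
    then show "\<exists>r. z = ?t * (x + y + r) \<and> r \<in> ?O"
      using local_add[OF assms] by (intro exI[of _ "r + r'"]) (auto simp: algebra_simps)
  next
    fix r assume r: "r \<in> ?O"
    have "?t * (x + y + r) = (?t * x + ?t * r) + (?t * y + ?t * 0)"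
      by (simp add: algebra_simps)
    then show "?t * (x + y + r) \<in> Res D \<alpha> x + Res D \<alpha> y"
      using r local_0[OF assms] unfolding Res_def restrict_hyp_def
      by (auto simp: set_plus_def simp del: mult_zero_right)
  qed
  moreover have "restrict_hyp D \<alpha> 0 = {?t * r | r. r \<in> ?O}"
    by (simp add: restrict_hyp_def)
  moreover have "{?t * (x + y + r) | r. r \<in> ?O} = {?t * r | r. r \<in> ?O} \<longleftrightarrow> x + y \<in> ?O"
  proof
    assume "{?t * (x + y + r) | r. r \<in> ?O} = {?t * r | r. r \<in> ?O}"
    moreover have "?t * (x + y + 0) \<in> {?t * (x + y + r) | r. r \<in> ?O}"
      using local_0[OF assms] by blast
    ultimately obtain r where "?t * (x + y + 0) = ?t * r" "r \<in> ?O" by auto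
    then show "x + y \<in> ?O" using t by simp
  next
    assume *: "x + y \<in> ?O"
    show "{?t * (x + y + r) | r. r \<in> ?O} = {?t * r | r. r \<in> ?O}"
    proof safe
      fix r assume "r \<in> ?O"
      then show "\<exists>r'. ?t * (x + y + r) = ?t * r' \<and> r' \<in> ?O"
        using * local_add[OF assms] by blast
    next
      fix r assume "r \<in> ?O"
      then have "r - (x + y) \<in> ?O" using * local_diff[OF assms] by blast
      then show "\<exists>r'. ?t * r = ?t * (x + y + r') \<and> r' \<in> ?O"
        by (intro exI[of _ "r - (x + y)"]) simp
    qed
  qed
  ultimately show ?thesis by simp
qed

end


subsection \<open>Functions with poles along real root hyperplanes only\<close>

text \<open>
  The ring that results from \<open>S\<close> by inverting the real roots. With generators instead of
  fractions the stability under the group is an induction over the generators.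
\<close>

inductive_set real_poles :: "setting \<Rightarrow> ratfun set" for D :: setting where
  poly: "p \<in> S_ring D \<Longrightarrow> emb p \<in> real_poles D"
| inverse_root: "\<alpha> \<in> pos_re D \<Longrightarrow> 1 / linQ D \<alpha> \<in> real_poles D"
| add: "x \<in> real_poles D \<Longrightarrow> y \<in> real_poles D \<Longrightarrow> x + y \<in> real_poles D"
| mult: "x \<in> real_poles D \<Longrightarrow> y \<in> real_poles D \<Longrightarrow> x * y \<in> real_poles D"

lemma real_poles_uminus: "x \<in> real_poles D \<Longrightarrow> - x \<in> real_poles D"
  using real_poles.mult[OF real_poles.poly[of "-1" D], of x] S_ring_uminus[OF S_ring_1]
  by (simp add: emb_uminus emb_1 del: minus_fract)

lemma real_poles_0: "0 \<in> real_poles D"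
  using real_poles.poly[of 0 D] by (simp add: emb_0)

lemma real_poles_sum: "(\<And>x. x \<in> A \<Longrightarrow> f x \<in> real_poles D) \<Longrightarrow> sum f A \<in> real_poles D"
  by (induction A rule: infinite_finite_induct) (auto simp: real_poles_0 intro: real_poles.add)

lemma real_poles_Frac_S: "x \<in> real_poles D \<Longrightarrow> x \<in> Frac_S D"
  by (induction rule: real_poles.induct)
    (auto simp: Frac_S_emb Frac_S_divide Frac_S_linQ Frac_S_add Frac_S_mult)

definition root_product :: "setting \<Rightarrow> weight multiset \<Rightarrow> mpol" where
  "root_product D M = prod_mset (image_mset (lin D) M)"

lemma root_product_empty [simp]: "root_product D {#} = 1"
  and root_product_add [simp]: "root_product D (add_mset \<alpha> M) = lin D \<alpha> * root_product D M"
  and root_product_union: "root_product D (M + N) = root_product D M * root_product D N"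
  by (simp_all add: root_product_def)

lemma root_product_mset_set: "root_product D (mset_set F) = prod (lin D) F"
  by (simp add: root_product_def prod_unfold_prod_mset)

lemma root_product_in_S: "root_product D M \<in> S_ring D"
  by (induction M) auto

lemma linQ_prod: "(\<Prod>\<alpha>\<in>F. linQ D \<alpha>) = emb (prod (lin D) F)"
  by (simp add: linQ_eq_emb emb_prod)

lemma only_simple_real_poles_iff:
  "only_simple_real_poles D x \<longleftrightarrow>
    (\<exists>F p. finite F \<and> F \<subseteq> pos_re D \<and> p \<in> S_ring D \<and> x = emb p / emb (prod (lin D) F))"
  by (simp only: only_simple_real_poles_def linQ_prod)

context reflection_setting
begin

lemma root_product_nonzero: "set_mset M \<subseteq> \<Phi> \<Longrightarrow> root_product D M \<noteq> 0"
  by (induction M) (auto simp: lin_eq_0_iff pos_lattice pos_nonzero)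

lemma root_prod_nonzero: "finite F \<Longrightarrow> F \<subseteq> \<Phi> \<Longrightarrow> prod (lin D) F \<noteq> 0"
  using lin_eq_0_iff pos_lattice pos_nonzero by (simp add: prod_zero_iff) (metis subsetD)

lemma real_poles_normal_form:
  assumes "x \<in> real_poles D"
  shows "\<exists>M p. set_mset M \<subseteq> \<Phi> \<and> p \<in> S \<and> x = Fract p (root_product D M)"
  using assms
proof induction
  case (poly p)
  then show ?case by (intro exI[of _ "{#}"]) auto
next
  case (inverse_root \<alpha>)
  then show ?case
    by (intro exI[of _ "{#\<alpha>#}"] exI[of _ 1]) (auto simp: linQ_eq_emb One_fract_def)
next
  case (add x y)
  then obtain M p N q where "set_mset M \<subseteq> \<Phi>" "p \<in> S" "x = Fract p (root_product D M)"
    "set_mset N \<subseteq> \<Phi>" "q \<in> S" "y = Fract q (root_product D N)" by blast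
  moreover from this have "p * root_product D N + q * root_product D M \<in> S"
    by (intro S_ring_add S_ring_mult root_product_in_S)
  ultimately show ?case
    by (intro exI[of _ "M + N"] exI[of _ "p * root_product D N + q * root_product D M"])
      (auto simp: root_product_nonzero root_product_union)
next
  case (mult x y)
  then obtain M p N q where "set_mset M \<subseteq> \<Phi>" "p \<in> S" "x = Fract p (root_product D M)"
    "set_mset N \<subseteq> \<Phi>" "q \<in> S" "y = Fract q (root_product D N)" by blast
  then show ?case
    by (intro exI[of _ "M + N"] exI[of _ "p * q"]) (auto simp: root_product_union)
qed

lemma real_poles_divide_prod:
  assumes "finite F" "F \<subseteq> \<Phi>" "p \<in> S"
  shows "emb p / emb (prod (lin D) F) \<in> real_poles D"
  using assms
proof (induction F)
  case empty
  then show ?case using real_poles.poly[of p D] by (simp flip: One_fract_def)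
next
  case (insert \<alpha> F)
  then have "1 / linQ D \<alpha> * (emb p / emb (prod (lin D) F)) \<in> real_poles D"
    by (intro real_poles.mult real_poles.inverse_root) auto
  then show ?case using insert by (simp add: linQ_eq_emb One_fract_def)
qed

lemma only_simple_poles_real_poles: "only_simple_real_poles D x \<Longrightarrow> x \<in> real_poles D"
  unfolding only_simple_real_poles_iff using real_poles_divide_prod by blast

lemma real_poles_actQ:
  assumes "w \<in> W" "x \<in> real_poles D"
  shows "actQ D w x \<in> real_poles D"
  using assms(2)
proof induction
  case (poly p)
  then show ?case using assms(1) by (simp add: actQ_emb actS_in_S real_poles.poly)
next
  case (inverse_root \<alpha>)
  have "actQ D w (1 / linQ D \<alpha>) = 1 / linQ D (w \<alpha>)"
    using assms(1) inverse_root actQ_inverse[of w "linQ D \<alpha>"]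
    by (simp add: actQ_linQ pos_lattice Frac_S_linQ inverse_eq_divide)
  moreover have "1 / linQ D (w \<alpha>) \<in> real_poles D"
  proof (cases "w \<alpha> \<in> \<Phi>")
    case False
    then have "1 / linQ D (wneg (w \<alpha>)) \<in> real_poles D"
      using W_pos assms(1) inverse_root real_poles.inverse_root by blast
    then show ?thesis using real_poles_uminus[of "1 / linQ D (wneg (w \<alpha>))" D] by (simp add: linQ_wneg)
  qed (rule real_poles.inverse_root)
  ultimately show ?case by simp
next
  case (add x y)
  then show ?case using assms(1) by (simp add: actQ_add real_poles_Frac_S real_poles.add)
next
  case (mult x y)
  then show ?case using assms(1) by (simp add: actQ_mult real_poles_Frac_S real_poles.mult)
qed

lemma real_poles_Q_ring:
  assumes "x \<in> real_poles D"
  shows "x \<in> Q_ring D"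
proof -
  obtain M p where M: "set_mset M \<subseteq> \<Phi>" "p \<in> S" "x = Fract p (root_product D M)"
    using real_poles_normal_form[OF assms] by blast
  have "\<not> lin D \<eta> dvd root_product D M" if \<eta>: "\<eta> \<in> imag_roots D" for \<eta>
  proof
    have lat: "\<eta> \<in> lattice (rank D)" "\<eta> \<noteq> (\<lambda>_. 0)" using \<eta> imag_lattice imag_nonzero by auto
    assume "lin D \<eta> dvd root_product D M"
    then show False using M(1)
    proof (induction M)
      case empty
      then show ?case using lin_not_unit[OF lat] by simp
    next
      case (add \<alpha> M)
      then have "lin D \<eta> dvd lin D \<alpha>" using lin_prime[OF lat] by auto
      then obtain a b where "a \<noteq> 0" "\<And>i. a * \<alpha> i = b * \<eta> i"
        using lin_dvd_lin[OF lat, of \<alpha>] add.prems pos_lattice by auto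
      then show ?case using imag_not_real[OF \<eta>, of \<alpha> a b] add.prems by auto
    qed
  qed
  then show ?thesis
    unfolding Q_ring_def using M root_product_in_S root_product_nonzero[OF M(1)] by blast
qed

text \<open>
  Whether the poles along the root hyperplanes are simple can be tested on one hyperplane at a time:
  a linear factor that is repeated in a denominator divides the numerator.
\<close>

lemma only_simple_poles_if_locally:
  assumes "x \<in> real_poles D" "\<And>\<alpha>. \<alpha> \<in> \<Phi> \<Longrightarrow> linQ D \<alpha> * x \<in> local_ring D \<alpha>"
  shows "only_simple_real_poles D x"
proof -
  obtain M p where "set_mset M \<subseteq> \<Phi>" "p \<in> S" "x = Fract p (root_product D M)"
    using real_poles_normal_form[OF assms(1)] by blast
  then show ?thesis
  proof (induction "size M" arbitrary: M p rule: less_induct)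
    case less
    show ?case
    proof (cases "\<exists>\<alpha> N. M = add_mset \<alpha> (add_mset \<alpha> N)")
      case True
      then obtain \<alpha> N where M: "M = add_mset \<alpha> (add_mset \<alpha> N)" by blast
      have \<alpha>: "\<alpha> \<in> \<Phi>" and N: "set_mset N \<subseteq> \<Phi>" using less.prems(1) by (auto simp: M)
      have nz: "lin D \<alpha> \<noteq> 0" "root_product D N \<noteq> 0"
        using \<alpha> N root_product_nonzero by (simp_all add: lin_eq_0_iff pos_lattice pos_nonzero)
      obtain a b where ab: "linQ D \<alpha> * x = Fract a b" "\<not> lin D \<alpha> dvd b" "b \<noteq> 0"
        using assms(2)[OF \<alpha>] by (elim local_ringE)
      have "linQ D \<alpha> * x = Fract p (lin D \<alpha> * root_product D N)"
        using less.prems(3) nz by (simp add: M linQ_eq_emb eq_fract mult_ac)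
      then have "p * b = lin D \<alpha> * (root_product D N * a)"
        using ab nz by (simp add: eq_fract mult_ac)
      then have "lin D \<alpha> dvd p"
        using ab(2) \<alpha> lin_pos_prime by (metis dvd_triv_left)
      then obtain q where q: "p = lin D \<alpha> * q" "q \<in> S"
        using less.prems(2) by (rule S_ring_dvd_cofactor) auto
      have "x = Fract q (root_product D (add_mset \<alpha> N))"
        using less.prems(3) nz by (simp add: M q eq_fract)
      then show ?thesis
        using less.hyps[of "add_mset \<alpha> N" q] q \<alpha> N by (simp add: M)
    next
      case False
      have "count M \<alpha> = 1" if "\<alpha> \<in># M" for \<alpha>
      proof (rule ccontr)
        assume "count M \<alpha> \<noteq> 1"
        moreover obtain M' where M': "M = add_mset \<alpha> M'" using \<open>\<alpha> \<in># M\<close> by (metis insert_DiffM)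
        ultimately have "\<alpha> \<in># M'" by (simp add: not_in_iff)
        then obtain N where "M' = add_mset \<alpha> N" by (metis insert_DiffM)
        then show False using False M' by blast
      qed
      then have "M = mset_set (set_mset M)"
        by (intro multiset_eqI) (metis count_mset_set(1,3) finite_set_mset not_in_iff)
      then have "root_product D M = prod (lin D) (set_mset M)"
        by (metis root_product_mset_set)
      then show ?thesis
        unfolding only_simple_real_poles_iff using less.prems
        by (intro exI[of _ "set_mset M"] exI[of _ p]) simp
    qed
  qed
qed

lemma simple_poles_local:
  assumes "only_simple_real_poles D x" "\<alpha> \<in> \<Phi>"
  shows "linQ D \<alpha> * x \<in> local_ring D \<alpha>"
proof -
  obtain F p where F: "finite F" "F \<subseteq> \<Phi>" "p \<in> S" "x = emb p / emb (prod (lin D) F)"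
    using assms(1) by (auto simp: only_simple_real_poles_iff)
  have nz: "prod (lin D) F \<noteq> 0" "lin D \<alpha> \<noteq> 0"
    using F assms root_prod_nonzero lin_eq_0_iff pos_lattice pos_nonzero by auto
  have ndvd: "\<not> lin D \<alpha> dvd prod (lin D) (F - {\<alpha>})"
  proof
    assume "lin D \<alpha> dvd prod (lin D) (F - {\<alpha>})"
    then obtain \<beta> where "\<beta> \<in> F - {\<alpha>}" "lin D \<alpha> dvd lin D \<beta>"
      using lin_prime_prod pos_lattice pos_nonzero assms(2) by metis
    then show False using lin_pos_dvd[of \<alpha> \<beta>] F assms by auto
  qed
  have "linQ D \<alpha> * x = Fract (if \<alpha> \<in> F then p else lin D \<alpha> * p) (prod (lin D) (F - {\<alpha>}))"
    using F nz by (auto simp: linQ_eq_emb prod.remove[of F \<alpha>] eq_fract)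
  then show ?thesis
    using F ndvd by (auto intro!: local_ringI S_ring_prod)
qed

text \<open>
  The numerator is divisible by each root of the denominator along whose hyperplane the function is
  regular.
\<close>

lemma clear_simple_poles:
  assumes "only_simple_real_poles D x" "finite N" "N \<subseteq> \<Phi>"
    and "\<And>\<alpha>. \<alpha> \<in> \<Phi> \<Longrightarrow> \<alpha> \<notin> N \<Longrightarrow> x \<in> local_ring D \<alpha>"
  shows "\<exists>q\<in>S. x = emb q / (\<Prod>\<alpha>\<in>N. linQ D \<alpha>)"
proof -
  obtain F p where "finite F" "F \<subseteq> \<Phi>" "p \<in> S" "x = emb p / emb (prod (lin D) F)"
    using assms(1) by (auto simp: only_simple_real_poles_iff)
  then show ?thesis
  proof (induction "card F" arbitrary: F p rule: less_induct)
    case less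
    have nz: "prod (lin D) F \<noteq> 0" "prod (lin D) N \<noteq> 0"
      using less.prems assms root_prod_nonzero by auto
    show ?case
    proof (cases "F \<subseteq> N")
      case True
      then have "prod (lin D) N = prod (lin D) F * prod (lin D) (N - F)"
        using assms(2) by (metis mult.commute prod.subset_diff)
      then have "x = emb (p * prod (lin D) (N - F)) / (\<Prod>\<alpha>\<in>N. linQ D \<alpha>)"
        using less.prems nz by (simp add: linQ_prod eq_fract)
      then show ?thesis using less.prems by (blast intro: S_ring_prod lin_in_S)
    next
      case False
      then obtain \<alpha> where \<alpha>: "\<alpha> \<in> F" "\<alpha> \<notin> N" by blast
      then have \<alpha>': "\<alpha> \<in> \<Phi>" using less.prems by blast
      have split: "prod (lin D) F = lin D \<alpha> * prod (lin D) (F - {\<alpha>})"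
        using less.prems \<alpha> by (simp add: prod.remove)
      obtain a b where ab: "x = Fract a b" "\<not> lin D \<alpha> dvd b" "b \<noteq> 0"
        using assms(4)[OF \<alpha>' \<alpha>(2)] by (elim local_ringE)
      then have "p * b = lin D \<alpha> * (prod (lin D) (F - {\<alpha>}) * a)"
        using less.prems(4) nz by (simp add: eq_fract split mult_ac)
      then have "lin D \<alpha> dvd p"
        using ab(2) \<alpha>' lin_pos_prime by (metis dvd_triv_left)
      then obtain q where q: "p = lin D \<alpha> * q" "q \<in> S"
        using less.prems(3) by (rule S_ring_dvd_cofactor) auto
      have "x = emb q / emb (prod (lin D) (F - {\<alpha>}))"
        using less.prems(4) nz by (simp add: split q eq_fract)
      moreover have "card (F - {\<alpha>}) < card F" using less.prems \<alpha> by (intro card_Diff1_less)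
      ultimately show ?thesis using less.hyps[of "F - {\<alpha>}" q] q less.prems by blast
    qed
  qed
qed


section \<open>The residue description of the nil-Hecke algebra\<close>

definition residue_algebra :: "twisted set" where
  "residue_algebra = {f \<in> QW D. (\<forall>w\<in>W. only_simple_real_poles D (f w)) \<and>
     (\<forall>w\<in>W. \<forall>\<alpha>\<in>\<Phi>. f w + f (s \<alpha> \<circ> w) \<in> local_ring D \<alpha>)}"

text \<open>
  Products are treated on one hyperplane at a time; this is the part of the conditions that
  concerns a single one.
\<close>

definition locally_admissible :: "weight \<Rightarrow> twisted \<Rightarrow> bool" where
  "locally_admissible \<alpha> f \<longleftrightarrow> (\<forall>w\<in>W. linQ D \<alpha> * f w \<in> local_ring D \<alpha> \<and>
     f w + f (s \<alpha> \<circ> w) \<in> local_ring D \<alpha>)"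

lemma residue_algebra_iff:
  "f \<in> residue_algebra \<longleftrightarrow> finite {w. f w \<noteq> 0} \<and> {w. f w \<noteq> 0} \<subseteq> W \<and>
     (\<forall>w. f w \<in> real_poles D) \<and> (\<forall>\<alpha>\<in>\<Phi>. locally_admissible \<alpha> f)" (is "?L \<longleftrightarrow> ?R")
proof
  assume f: ?L
  have "f w \<in> real_poles D" for w
  proof (cases "w \<in> W")
    case False
    then have "f w = 0" using f by (auto simp: residue_algebra_def QW_def)
    then show ?thesis by (simp add: real_poles_0)
  qed (use f only_simple_poles_real_poles in \<open>auto simp: residue_algebra_def\<close>)
  then show ?R
    using f simple_poles_local by (auto simp: residue_algebra_def locally_admissible_def QW_def)
next
  assume f: ?R
  then show ?L
    using only_simple_poles_if_locally real_poles_Q_ring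
    by (auto simp: residue_algebra_def QW_def locally_admissible_def)
qed

lemma residue_algebraD:
  assumes "f \<in> residue_algebra"
  shows "finite {w. f w \<noteq> 0}" "{w. f w \<noteq> 0} \<subseteq> W" "f w \<in> real_poles D"
    "w \<in> W \<Longrightarrow> \<alpha> \<in> \<Phi> \<Longrightarrow> linQ D \<alpha> * f w \<in> local_ring D \<alpha>"
    "w \<in> W \<Longrightarrow> \<alpha> \<in> \<Phi> \<Longrightarrow> f w + f (s \<alpha> \<circ> w) \<in> local_ring D \<alpha>"
  using assms unfolding residue_algebra_iff locally_admissible_def by blast+

text \<open>
  With \<open>t\<close> an equation of the hyperplane, the following is the multiplication table of the local
  version of the algebra at one reflection: \<open>f\<^sub>0 [1] + f\<^sub>1 [s]\<close> is applied to the pair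
  \<open>(g\<^sub>0, g\<^sub>1)\<close> of coefficients at \<open>w\<close> and \<open>s w\<close>. Both are of the form \<open>c (1, -1) / t\<close> plus regular
  terms, and the double pole cancels because \<open>c - s(c)\<close> is divisible by \<open>t\<close>.
\<close>

lemma local_pair_product:
  assumes \<alpha>: "\<alpha> \<in> \<Phi>"
    and f: "linQ D \<alpha> * f0 \<in> local_ring D \<alpha>" "f0 + f1 \<in> local_ring D \<alpha>"
    and g: "linQ D \<alpha> * g0 \<in> local_ring D \<alpha>" "linQ D \<alpha> * g1 \<in> local_ring D \<alpha>"
      "g0 + g1 \<in> local_ring D \<alpha>"
  defines "P \<equiv> \<lambda>a b. f0 * a + f1 * actQ D (s \<alpha>) b"
  shows "linQ D \<alpha> * P g0 g1 \<in> local_ring D \<alpha>" "P g0 g1 + P g1 g0 \<in> local_ring D \<alpha>"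
proof -
  let ?t = "linQ D \<alpha>" and ?O = "local_ring D \<alpha>" and ?s = "actQ D (s \<alpha>)"
  have sW: "s \<alpha> \<in> W" and t: "?t \<noteq> 0" using \<alpha> by (simp_all add: refl_W linQ_pos_nonzero)
  have K: "g0 \<in> Frac_S D" "g1 \<in> Frac_S D"
    using simple_pole_Frac_S[OF \<alpha>] g by auto
  have st: "?s (?t * x) = - ?t * ?s x" if "x \<in> Frac_S D" for x
    using that sW \<alpha> by (simp add: actQ_mult Frac_S_linQ actQ_linQ pos_lattice refl_self linQ_wneg)
  define b c where "b = f0 + f1" and "c = g0 + g1"
  have b: "b \<in> ?O" and c: "c \<in> ?O" using f g by (simp_all add: b_def c_def)
  have f1: "f1 = b - f0" and g1: "g1 = c - g0" by (simp_all add: b_def c_def)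
  have cK: "c \<in> Frac_S D" using c by (rule local_ring_Frac_S)
  have "(?t * g0 - ?s (?t * g0)) / ?t - ?s c \<in> ?O"
    using \<alpha> g c by (intro local_diff local_diff_actQ_refl actQ_refl_local)
  also have "(?t * g0 - ?s (?t * g0)) / ?t - ?s c = g0 - ?s g1"
    using t K cK sW unfolding st[OF K(1)] by (simp add: g1 actQ_diff add_divide_distrib)
  finally have d: "g0 - ?s g1 \<in> ?O" .
  have "- ?s (?t * g1) \<in> ?O"
    using \<alpha> g by (intro local_uminus actQ_refl_local)
  then have e: "?t * ?s g1 \<in> ?O" using K by (simp add: st)
  have "(?t * f0) * (g0 - ?s g1) + b * (?t * ?s g1) \<in> ?O"
    by (rule local_add[OF \<alpha> local_mult[OF \<alpha> f(1) d] local_mult[OF \<alpha> b e]])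
  then show "?t * P g0 g1 \<in> ?O"
    by (simp add: P_def f1 algebra_simps)
  have "(?t * f0) * ((c - ?s c) / ?t) + b * ?s c \<in> ?O"
    by (rule local_add[OF \<alpha> local_mult[OF \<alpha> f(1) local_diff_actQ_refl[OF \<alpha> c]]
          local_mult[OF \<alpha> _ actQ_refl_local[OF \<alpha> c]]]) (use f in \<open>simp add: b_def\<close>)
  moreover have "P g0 g1 + P g1 g0 = (?t * f0) * ((c - ?s c) / ?t) + b * ?s c"
  proof -
    have "(?t * f0) * ((c - ?s c) / ?t) = f0 * (c - ?s c)" using t by simp
    then show ?thesis using K sW by (simp add: P_def f1 c_def actQ_add algebra_simps)
  qed
  ultimately show "P g0 g1 + P g1 g0 \<in> ?O" by simp
qed

lemma tw_mult_sum:
  assumes f: "finite A" "A \<subseteq> W" "{u. f u \<noteq> 0} \<subseteq> A"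
  shows "tw_mult D f g w = (\<Sum>u\<in>A. f u * actQ D u (g (inv u \<circ> w)))"
proof -
  let ?A = "{u \<in> A. f u \<noteq> 0 \<and> g (inv u \<circ> w) \<noteq> 0}"
  have eq: "{(u, v). f u \<noteq> 0 \<and> g v \<noteq> 0 \<and> u \<circ> v = w} = (\<lambda>u. (u, inv u \<circ> w)) ` ?A"
  proof safe
    fix u v assume uv: "f u \<noteq> 0" "g v \<noteq> 0" "w = u \<circ> v"
    then have u: "u \<in> A" "u \<in> W" using f by auto
    then have "inv u \<circ> (u \<circ> v) = v" by (simp add: inv_comp_W flip: comp_assoc)
    then show "(u, v) \<in> (\<lambda>u'. (u', inv u' \<circ> (u \<circ> v))) ` {u' \<in> A. f u' \<noteq> 0 \<and> g (inv u' \<circ> (u \<circ> v)) \<noteq> 0}"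
      using uv u by (intro image_eqI[of _ _ u]) auto
  next
    fix u assume "u \<in> A"
    then have "u \<circ> inv u = id" using f comp_inv_W by auto
    then show "u \<circ> (inv u \<circ> w) = w" by (simp flip: comp_assoc)
  qed
  have "inj_on (\<lambda>u. (u, inv u \<circ> w)) ?A" by (auto simp: inj_on_def)
  then have "tw_mult D f g w = (\<Sum>u\<in>?A. f u * actQ D u (g (inv u \<circ> w)))"
    unfolding tw_mult_def eq by (subst sum.reindex) simp_all
  also have "\<dots> = (\<Sum>u\<in>A. f u * actQ D u (g (inv u \<circ> w)))"
    using f by (intro sum.mono_neutral_left) (auto simp: actQ_0)
  finally show ?thesis .
qed

lemma tw_mult_support: "{w. tw_mult D f g w \<noteq> 0} \<subseteq> (\<lambda>(u, v). u \<circ> v) ` ({u. f u \<noteq> 0} \<times> {v. g v \<noteq> 0})"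
proof
  fix w assume "w \<in> {w. tw_mult D f g w \<noteq> 0}"
  then have "{(u, v). f u \<noteq> 0 \<and> g v \<noteq> 0 \<and> u \<circ> v = w} \<noteq> {}"
    unfolding tw_mult_def by force
  then show "w \<in> (\<lambda>(u, v). u \<circ> v) ` ({u. f u \<noteq> 0} \<times> {v. g v \<noteq> 0})" by force
qed

text \<open>
  A product is admissible at \<open>\<alpha>\<close> if its left factor is so and its right factor is admissible at all
  roots, as \<open>u\<close> moves the hyperplane of \<open>u\<inverse> \<alpha>\<close> to that of \<open>\<alpha>\<close>. The terms
  for \<open>u\<close> and \<open>s u\<close> are paired to form a local product.
\<close>

lemma tw_mult_residue_algebra:
  assumes f: "f \<in> residue_algebra" and g: "g \<in> residue_algebra"
  shows "tw_mult D f g \<in> residue_algebra"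
  unfolding residue_algebra_iff
proof (intro conjI allI ballI)
  let ?h = "tw_mult D f g"
  note fD = residue_algebraD[OF f] and gD = residue_algebraD[OF g]
  show "finite {w. ?h w \<noteq> 0}"
    using tw_mult_support fD(1) gD(1) by (meson finite_SigmaI finite_imageI finite_subset)
  show "{w. ?h w \<noteq> 0} \<subseteq> W"
    using tw_mult_support[of f g] fD(2) gD(2) comp_W by force
  show "?h w \<in> real_poles D" for w
    using fD(2) by (subst tw_mult_sum[OF fD(1,2)])
      (auto intro!: real_poles_sum real_poles.mult real_poles_actQ fD(3) gD(3))
  fix \<alpha> assume \<alpha>: "\<alpha> \<in> \<Phi>"
  let ?O = "local_ring D \<alpha>" and ?t = "linQ D \<alpha>"
  define A where "A = {u. f u \<noteq> 0} \<union> (\<lambda>u. s \<alpha> \<circ> u) ` {u. f u \<noteq> 0}"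
  have A: "finite A" "A \<subseteq> W" "{u. f u \<noteq> 0} \<subseteq> A"
    using fD(1,2) \<alpha> refl_comp_W by (auto simp: A_def)
  have sA: "(\<lambda>u. s \<alpha> \<circ> u) ` A = A"
    unfolding A_def image_Un image_image refl_comp_refl'[OF \<alpha>] by auto
  define G where "G u w = actQ D u (g (inv u \<circ> w))" for u w
  define P where "P u w = f u * G u w + f (s \<alpha> \<circ> u) * actQ D (s \<alpha>) (G u (s \<alpha> \<circ> w))" for u w
  \<comment> \<open>The sum over all \<open>u\<close> of the paired terms counts every term twice.\<close>
  have half: "emb (poly_const (1 / 2)) \<in> ?O" using local_emb[OF \<alpha>] by simp
  have "emb (poly_const (1 / 2)) * 2 = emb (poly_const (1 / 2) + poly_const (1 / 2))"
    by (simp only: emb_add mult_2_right)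
  then have half2: "emb (poly_const (1 / 2)) * 2 = 1"
    by (simp add: emb_1 flip: poly_const_add)
  have h: "?h w = emb (poly_const (1 / 2)) * (\<Sum>u\<in>A. P u w)" if w: "w \<in> W" for w
  proof -
    let ?T = "\<lambda>u. f u * G u w"
    have h: "?h w = sum ?T A" by (simp add: tw_mult_sum[OF A] G_def)
    have "inj_on (\<lambda>u. s \<alpha> \<circ> u) A"
      by (rule inj_on_inverseI[of _ "\<lambda>u. s \<alpha> \<circ> u"]) (rule refl_comp_refl'[OF \<alpha>])
    then have "sum ?T A = (\<Sum>u\<in>A. ?T (s \<alpha> \<circ> u))"
      using sum.reindex[of "\<lambda>u. s \<alpha> \<circ> u" A ?T] unfolding sA comp_def[of ?T] by blast
    moreover have "?T (s \<alpha> \<circ> u) = f (s \<alpha> \<circ> u) * actQ D (s \<alpha>) (G u (s \<alpha> \<circ> w))" if "u \<in> A" for u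
    proof -
      have u: "u \<in> W" using that A by blast
      have "inv (s \<alpha> \<circ> u) = inv u \<circ> s \<alpha>"
        by (rule ext) (simp only: inv_refl_comp[OF \<alpha> u] comp_apply)
      then show ?thesis
        using \<alpha> u real_poles_Frac_S[OF gD(3)]
        by (simp add: G_def actQ_comp refl_W comp_assoc)
    qed
    ultimately have "sum ?T A + sum ?T A = (\<Sum>u\<in>A. P u w)"
      by (simp add: P_def sum.distrib)
    then have "emb (poly_const (1 / 2)) * (\<Sum>u\<in>A. P u w) = (emb (poly_const (1 / 2)) * 2) * sum ?T A"
      by (simp only: mult_2_right[symmetric] mult.assoc mult_2)
    then show ?thesis by (simp only: half2 h mult_1)
  qed
  have P: "?t * P u w \<in> ?O \<and> P u w + P u (s \<alpha> \<circ> w) \<in> ?O" if "u \<in> A" and w: "w \<in> W" for u w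
  proof -
    have u: "u \<in> W" "inv u \<in> W" using that A inv_W by auto
    obtain \<beta> where \<beta>: "\<beta> \<in> \<Phi>" "inv u \<alpha> = \<beta> \<or> inv u \<alpha> = wneg \<beta>"
      using W_pos[OF u(2) \<alpha>] by (metis wneg_wneg)
    have u\<beta>: "u \<beta> = \<alpha> \<or> u \<beta> = wneg \<alpha>"
      using \<beta>(2) u by (metis W_neg bij_W bij_inv_eq_iff wneg_wneg)
    have loc: "actQ D u x \<in> ?O" if "x \<in> local_ring D \<beta>" for x
      using actQ_local[OF u(1) pos_lattice[OF \<beta>(1)] that] u\<beta> by (auto simp: local_ring_wneg)
    have polar: "?t * G u v \<in> ?O" if v: "v \<in> W" for v
    proof -
      have "actQ D u (linQ D \<beta> * g (inv u \<circ> v)) \<in> ?O"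
        using \<beta> u v by (intro loc gD(4)) (simp_all add: comp_W)
      then have "linQ D (u \<beta>) * G u v \<in> ?O"
        using u \<beta> real_poles_Frac_S[OF gD(3)]
        by (simp add: actQ_mult Frac_S_linQ actQ_linQ pos_lattice G_def)
      then show ?thesis
        using u\<beta> local_uminus[of "- (?t * G u v)" \<alpha>] by (auto simp: linQ_wneg)
    qed
    have "s \<beta> \<circ> (inv u \<circ> w) = inv u \<circ> (s \<alpha> \<circ> w)"
      using refl_conj[OF u(2) \<alpha> \<beta>] by (metis comp_assoc)
    then have "actQ D u (g (inv u \<circ> w) + g (inv u \<circ> (s \<alpha> \<circ> w))) \<in> ?O"
      using gD(5)[of "inv u \<circ> w" \<beta>] \<beta> u w by (intro loc) (simp add: comp_W)
    then have pair: "G u w + G u (s \<alpha> \<circ> w) \<in> ?O"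
      using u real_poles_Frac_S[OF gD(3)] by (simp add: actQ_add G_def)
    show ?thesis
      using local_pair_product[OF \<alpha> fD(4)[OF u(1) \<alpha>] fD(5)[OF u(1) \<alpha>] polar[OF w]
          polar[OF refl_comp_W[OF \<alpha> w]] pair]
      by (simp only: P_def refl_comp_refl'[OF \<alpha>])
  qed
  show "locally_admissible \<alpha> ?h"
    unfolding locally_admissible_def
  proof (intro ballI conjI)
    fix w assume w: "w \<in> W"
    have "emb (poly_const (1 / 2)) * (\<Sum>u\<in>A. ?t * P u w) \<in> ?O"
      using P w by (intro local_mult[OF \<alpha> half] local_sum[OF \<alpha>]) blast
    then show "?t * ?h w \<in> ?O"
      by (simp only: h[OF w] mult.left_commute[of ?t] flip: sum_distrib_left)
    have "emb (poly_const (1 / 2)) * (\<Sum>u\<in>A. P u w + P u (s \<alpha> \<circ> w)) \<in> ?O"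
      using P w by (intro local_mult[OF \<alpha> half] local_sum[OF \<alpha>]) blast
    then show "?h w + ?h (s \<alpha> \<circ> w) \<in> ?O"
      by (simp only: h[OF w] h[OF refl_comp_W[OF \<alpha> w]] sum.distrib distrib_left)
  qed
qed

lemma diff_residue_algebra:
  assumes f: "f \<in> residue_algebra" and g: "g \<in> residue_algebra"
  shows "(\<lambda>w. f w - g w) \<in> residue_algebra"
  unfolding residue_algebra_iff
proof (intro conjI allI ballI)
  note fD = residue_algebraD[OF f] and gD = residue_algebraD[OF g]
  have sub: "{w. f w - g w \<noteq> 0} \<subseteq> {w. f w \<noteq> 0} \<union> {w. g w \<noteq> 0}" by auto
  then show "finite {w. f w - g w \<noteq> 0}" using fD(1) gD(1) by (meson finite_UnI finite_subset)
  show "{w. f w - g w \<noteq> 0} \<subseteq> W" using sub fD(2) gD(2) by blast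
  show "f w - g w \<in> real_poles D" for w
    using real_poles.add[OF fD(3) real_poles_uminus[OF gD(3)]] by simp
  fix \<alpha> assume \<alpha>: "\<alpha> \<in> \<Phi>"
  show "locally_admissible \<alpha> (\<lambda>w. f w - g w)"
    unfolding locally_admissible_def
  proof (intro ballI conjI)
    fix w assume w: "w \<in> W"
    show "linQ D \<alpha> * (f w - g w) \<in> local_ring D \<alpha>"
      using local_diff[OF \<alpha> fD(4)[OF w \<alpha>] gD(4)[OF w \<alpha>]] by (simp add: algebra_simps)
    show "f w - g w + (f (s \<alpha> \<circ> w) - g (s \<alpha> \<circ> w)) \<in> local_ring D \<alpha>"
      using local_diff[OF \<alpha> fD(5)[OF w \<alpha>] gD(5)[OF w \<alpha>]] by (simp add: algebra_simps)
  qed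
qed

lemma tw_single_residue_algebra:
  assumes "p \<in> S" "w \<in> W"
  shows "tw_single (emb p) w \<in> residue_algebra"
proof -
  have "tw_single (emb p) w u \<in> real_poles D"
    "\<alpha> \<in> \<Phi> \<Longrightarrow> tw_single (emb p) w u \<in> local_ring D \<alpha>" for u \<alpha>
    using assms by (simp_all add: tw_single_def real_poles.poly real_poles_0 local_emb local_0)
  moreover have sub: "{u. tw_single (emb p) w u \<noteq> 0} \<subseteq> {w}" by (auto simp: tw_single_def)
  moreover have "finite {u. tw_single (emb p) w u \<noteq> 0}" using sub by (rule finite_subset) simp
  moreover have "{u. tw_single (emb p) w u \<noteq> 0} \<subseteq> W" using sub assms(2) by blast
  ultimately show ?thesis
    unfolding residue_algebra_iff locally_admissible_def
    by (intro conjI allI ballI) (simp_all add: local_mult local_add local_linQ)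
qed

lemma refl_not_id: "\<alpha> \<in> \<Phi> \<Longrightarrow> s \<alpha> \<noteq> id"
  using refl_self pos_not_neg by force

lemma Dem_simple_eq:
  "\<alpha> \<in> \<Phi> \<Longrightarrow> Dem_simple D \<alpha> u =
    (if u = id then 1 / linQ D \<alpha> else if u = s \<alpha> then - (1 / linQ D \<alpha>) else 0)"
  using refl_not_id[of \<alpha>] by (cases "u = id"; cases "u = s \<alpha>") (simp_all add: Dem_simple_def tw_single_def)

lemma Dem_simple_residue_algebra:
  assumes \<alpha>: "\<alpha> \<in> \<Phi>"
  shows "Dem_simple D \<alpha> \<in> residue_algebra"
  unfolding residue_algebra_iff
proof (intro conjI allI ballI)
  have sub: "{w. Dem_simple D \<alpha> w \<noteq> 0} \<subseteq> {id, s \<alpha>}"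
    by (auto simp: Dem_simple_eq[OF \<alpha>])
  then show "finite {w. Dem_simple D \<alpha> w \<noteq> 0}" by (rule finite_subset) simp
  show "{w. Dem_simple D \<alpha> w \<noteq> 0} \<subseteq> W" using sub id_W refl_W[OF \<alpha>] by blast
  show "Dem_simple D \<alpha> w \<in> real_poles D" for w
    using real_poles.inverse_root[OF \<alpha>] real_poles_uminus[OF real_poles.inverse_root[OF \<alpha>]]
    by (auto simp: Dem_simple_eq[OF \<alpha>] real_poles_0)
  fix \<beta> assume \<beta>: "\<beta> \<in> \<Phi>"
  show "locally_admissible \<beta> (Dem_simple D \<alpha>)"
  proof (cases "\<alpha> = \<beta>")
    case False
    then have "1 / linQ D \<alpha> \<in> local_ring D \<beta>" using local_inverse_linQ \<alpha> \<beta> by blast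
    then have "Dem_simple D \<alpha> w \<in> local_ring D \<beta>" for w
      using local_uminus[of "1 / linQ D \<alpha>" \<beta>] local_0[OF \<beta>] by (auto simp: Dem_simple_eq[OF \<alpha>])
    then show ?thesis
      by (simp add: locally_admissible_def local_mult local_add local_linQ \<beta>)
  next
    case True
    have "s \<alpha> \<circ> w = id \<longleftrightarrow> w = s \<alpha>" "s \<alpha> \<circ> w = s \<alpha> \<longleftrightarrow> w = id" for w
      using refl_comp_refl'[OF \<alpha>, of w] refl_comp_refl[OF \<alpha>] by (metis comp_id)+
    then have "Dem_simple D \<alpha> w + Dem_simple D \<alpha> (s \<alpha> \<circ> w) = 0" for w
      using refl_not_id[OF \<alpha>] by (simp add: Dem_simple_eq[OF \<alpha>])
    moreover have "linQ D \<alpha> * Dem_simple D \<alpha> w \<in> {0, 1, - 1}" for w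
      using linQ_pos_nonzero[OF \<alpha>] by (simp add: Dem_simple_eq[OF \<alpha>])
    then have "linQ D \<alpha> * Dem_simple D \<alpha> w \<in> local_ring D \<alpha>" for w
      using local_0[OF \<alpha>] local_1[OF \<alpha>] local_uminus[OF local_1[OF \<alpha>]] by (metis empty_iff insert_iff)
    ultimately show ?thesis
      using True local_0[OF \<beta>] by (simp add: locally_admissible_def)
  qed
qed

lemma Dem_word_residue_algebra: "set as \<subseteq> simple D \<Longrightarrow> Dem_word D as \<in> residue_algebra"
proof (induction as)
  case Nil
  then show ?case
    using tw_single_residue_algebra[of 1 id] by (simp add: Dem_word_def id_W emb_1)
next
  case (Cons \<alpha> as)
  then show ?case
    by (simp add: Dem_word_def tw_mult_residue_algebra Dem_simple_residue_algebra simple_pos)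
qed

lemma Dem_cox_word:
  assumes "a \<in> refl_group s (simple D)"
  obtains as where "reduced_word D as" "word_prod s as = a" "Dem_cox D a = Dem_word D as"
proof -
  let ?P = "\<lambda>as. reduced_word D as \<and> word_prod s as = a"
  obtain as where "?P as" using reduced_word_exists[OF assms] by blast
  then have "?P (Eps ?P)" by (rule someI)
  then show ?thesis using that by (auto simp: Dem_cox_def)
qed

lemma Dem_cox_residue_algebra:
  "a \<in> refl_group s (simple D) \<Longrightarrow> Dem_cox D a \<in> residue_algebra"
  by (metis Dem_cox_word Dem_word_residue_algebra reduced_word_def)

subsection \<open>Leading coefficients of the Demazure elements\<close>

lemma Dem_word_Cons:
  assumes "\<beta> \<in> \<Phi>" "set as \<subseteq> simple D"
  shows "Dem_word D (\<beta> # as) w =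
    (Dem_word D as w - actQ D (s \<beta>) (Dem_word D as (s \<beta> \<circ> w))) / linQ D \<beta>"
proof -
  let ?g = "Dem_word D as"
  have g: "?g w \<in> Frac_S D"
    using residue_algebraD(3)[OF Dem_word_residue_algebra[OF assms(2)]] by (rule real_poles_Frac_S)
  have "Dem_word D (\<beta> # as) w =
      (\<Sum>u\<in>{id, s \<beta>}. Dem_simple D \<beta> u * actQ D u (?g (inv u \<circ> w)))"
    unfolding Dem_word_def foldr.simps(2) comp_apply[of "tw_mult D (Dem_simple D \<beta>)"]
    using assms id_W refl_W by (intro tw_mult_sum) (auto simp: Dem_simple_eq split: if_splits)
  also have "\<dots> = 1 / linQ D \<beta> * ?g w - 1 / linQ D \<beta> * actQ D (s \<beta>) (?g (s \<beta> \<circ> w))"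
    using assms refl_not_id[OF assms(1)] g
    by (simp add: Dem_simple_eq inv_refl actQ_id inv_id eq_commute[of id])
  finally show ?thesis by (simp add: diff_divide_distrib)
qed


lemma actQ_prod:
  assumes "w \<in> W" "\<And>x. x \<in> A \<Longrightarrow> f x \<in> Frac_S D"
  shows "actQ D w (prod f A) = (\<Prod>x\<in>A. actQ D w (f x)) \<and> prod f A \<in> Frac_S D"
  using assms(2)
  by (induction A rule: infinite_finite_induct) (auto simp: actQ_1 actQ_mult assms Frac_S_mult)

text \<open>
  A letter raises the length by at most one, so only the leading element of the shorter word
  can contribute to the leading element of the longer one. There the coefficient is divided by \<open>-\<beta>\<close> and
  acted on by \<open>s\<^sub>\<beta>\<close>, just as the inversions change.
\<close>

lemma Dem_word_leading:
  assumes "reduced_word D as"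
  shows "Dem_word D as w \<noteq> 0 \<Longrightarrow> len w \<le> length as \<and> (len w = length as \<longrightarrow> w = word_prod s as)"
    and "Dem_word D as (word_prod s as) * (\<Prod>\<alpha>\<in>inversions (word_prod s as). linQ D \<alpha>) \<in> {1, - 1}"
  using assms
proof (induction as arbitrary: w)
  case Nil
  {
    case 1
    then show ?case by (auto simp: Dem_word_def tw_single_def len_def inversions_def split: if_splits)
  next
    case 2
    have "inversions id = {}" by (auto simp: inversions_def)
    then show ?case by (simp add: Dem_word_def tw_single_def id_def)
  }
next
  case (Cons \<beta> as)
  {
    case 1
    note as = reduced_word_Cons[OF 1(2)]
    have \<beta>: "\<beta> \<in> \<Phi>" using as(1) by (rule simple_pos)
    show ?case
    proof (cases "Dem_word D as w = 0")
      case False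
      then show ?thesis using Cons.IH(1)[OF _ as(3), of w] by simp
    next
      case True
      let ?v = "s \<beta> \<circ> w"
      have v: "Dem_word D as ?v \<noteq> 0"
        using 1(1) True actQ_0[OF refl_W[OF \<beta>]] by (auto simp: Dem_word_Cons[OF \<beta> as(2)])
      then have "?v \<in> W" using residue_algebraD(2)[OF Dem_word_residue_algebra[OF as(2)]] by blast
      then have "len (s \<beta> \<circ> ?v) \<le> Suc (len ?v)" by (rule len_simple_le[OF as(1)])
      then have le: "len w \<le> Suc (len ?v)" by (simp only: refl_comp_refl'[OF \<beta>])
      have IH: "len ?v \<le> length as" "len ?v = length as \<longrightarrow> ?v = word_prod s as"
        using Cons.IH(1)[OF v as(3)] by blast+
      show ?thesis
      proof (intro conjI impI)
        show "len w \<le> length (\<beta> # as)" using le IH(1) by simp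
        assume "len w = length (\<beta> # as)"
        then have "?v = word_prod s as" using le IH by simp
        then show "w = word_prod s (\<beta> # as)"
          using refl_comp_refl'[OF \<beta>, of w] by (metis word_prod_Cons)
      qed
    qed
  next
    case 2
    note as = reduced_word_Cons[OF 2]
    have \<beta>: "\<beta> \<in> \<Phi>" using as(1) by (rule simple_pos)
    let ?u = "word_prod s as" and ?g = "Dem_word D as"
    have u: "?u \<in> W" using as(2) by (rule word_W)
    have "?g (word_prod s (\<beta> # as)) = 0"
      using Cons.IH(1)[OF _ as(3), of "word_prod s (\<beta> # as)"] len_reduced[OF 2] by fastforce
    then have D: "Dem_word D (\<beta> # as) (word_prod s (\<beta> # as)) = - actQ D (s \<beta>) (?g ?u) / linQ D \<beta>"
      unfolding Dem_word_Cons[OF \<beta> as(2)] word_prod_Cons refl_comp_refl'[OF \<beta>] by simp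
    have inj: "inj_on (s \<beta>) (inversions ?u)"
      using bij_W[OF refl_W[OF \<beta>]] by (meson bij_is_inj inj_on_subset subset_UNIV)
    have pos: "\<gamma> \<in> inversions ?u \<Longrightarrow> \<gamma> \<in> \<Phi>" for \<gamma> by (simp add: inversions_def)
    have act: "actQ D (s \<beta>) (\<Prod>\<gamma>\<in>inversions ?u. linQ D \<gamma>) = (\<Prod>\<gamma>\<in>inversions ?u. linQ D (s \<beta> \<gamma>))"
      "(\<Prod>\<gamma>\<in>inversions ?u. linQ D \<gamma>) \<in> Frac_S D"
      using actQ_prod[OF refl_W[OF \<beta>], of "inversions ?u" "linQ D"] pos
      by (simp_all add: Frac_S_linQ actQ_linQ refl_W \<beta> pos_lattice)
    have "(\<Prod>\<alpha>\<in>inversions (word_prod s (\<beta> # as)). linQ D \<alpha>) =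
        linQ D \<beta> * (\<Prod>\<gamma>\<in>inversions ?u. linQ D (s \<beta> \<gamma>))"
      unfolding word_prod_Cons inversions_ascend(1)[OF as(1) u as(4)]
      using inversions_ascend(2)[OF as(1) u as(4)] finite_inversions[OF u]
      by (simp add: prod.reindex[OF inj] o_def)
    then have "Dem_word D (\<beta> # as) (word_prod s (\<beta> # as)) *
        (\<Prod>\<alpha>\<in>inversions (word_prod s (\<beta> # as)). linQ D \<alpha>) =
        - (actQ D (s \<beta>) (?g ?u) * actQ D (s \<beta>) (\<Prod>\<gamma>\<in>inversions ?u. linQ D \<gamma>))"
      unfolding D act using linQ_pos_nonzero[OF \<beta>] by simp
    also have "\<dots> = - actQ D (s \<beta>) (?g ?u * (\<Prod>\<gamma>\<in>inversions ?u. linQ D \<gamma>))"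
      using act(2) refl_W[OF \<beta>] residue_algebraD(3)[OF Dem_word_residue_algebra[OF as(2)]]
      by (simp add: actQ_mult real_poles_Frac_S)
    also have "\<dots> \<in> {1, - 1}"
      using Cons.IH(2)[OF as(3)] refl_W[OF \<beta>] by (auto simp: actQ_1 actQ_uminus)
    finally show ?case .
  }
qed

lemma inversions_comp_positive:
  assumes "u \<in> W" "\<omega> \<in> W" "inversions \<omega> = {}"
  shows "inversions (u \<circ> \<omega>) = inversions u"
proof -
  have iff: "inv \<omega> \<beta> \<in> \<Phi> \<longleftrightarrow> \<beta> \<in> \<Phi>" if "\<beta> \<in> \<Phi> \<or> wneg \<beta> \<in> \<Phi>" for \<beta>
  proof
    assume "inv \<omega> \<beta> \<in> \<Phi>"
    show "\<beta> \<in> \<Phi>"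
    proof (rule ccontr)
      assume "\<beta> \<notin> \<Phi>"
      then have "inv \<omega> (wneg \<beta>) \<in> \<Phi>" using that assms(3) by (auto simp: inversions_def)
      then show False
        using \<open>inv \<omega> \<beta> \<in> \<Phi>\<close> pos_not_neg by (simp add: W_neg inv_W assms)
    qed
  next
    assume "\<beta> \<in> \<Phi>"
    then show "inv \<omega> \<beta> \<in> \<Phi>" using assms(3) by (auto simp: inversions_def)
  qed
  have "inv (u \<circ> \<omega>) \<alpha> = inv \<omega> (inv u \<alpha>)" for \<alpha>
    using o_inv_distrib[of u \<omega>] assms by (simp add: bij_W)
  then show ?thesis
    unfolding inversions_def using iff W_pos[OF inv_W[OF assms(1)]] by auto
qed

lemma tw_mult_single:
  assumes "f \<in> residue_algebra" "\<omega> \<in> W"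
  shows "tw_mult D f (tw_single 1 \<omega>) v = f (v \<circ> inv \<omega>)"
proof -
  note fD = residue_algebraD[OF assms(1)]
  have "tw_mult D f (tw_single 1 \<omega>) v =
      (\<Sum>u\<in>{u. f u \<noteq> 0}. f u * actQ D u (tw_single 1 \<omega> (inv u \<circ> v)))"
    using fD by (intro tw_mult_sum) auto
  also have "\<dots> = (\<Sum>u\<in>{u. f u \<noteq> 0}. if u = v \<circ> inv \<omega> then f u else 0)"
  proof (rule sum.cong)
    fix u assume "u \<in> {u. f u \<noteq> 0}"
    then have u: "u \<in> W" using fD by blast
    have "inv u \<circ> v = \<omega> \<longleftrightarrow> u = v \<circ> inv \<omega>"
    proof
      assume "inv u \<circ> v = \<omega>"
      then have "v \<circ> inv \<omega> = u \<circ> (inv u \<circ> v) \<circ> inv \<omega>"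
        using comp_inv_W[OF u] by (metis comp_assoc id_comp)
      then show "u = v \<circ> inv \<omega>"
        using \<open>inv u \<circ> v = \<omega>\<close> comp_inv_W[OF assms(2)] by (metis comp_assoc comp_id)
    next
      assume "u = v \<circ> inv \<omega>"
      then have "inv u \<circ> v = inv u \<circ> u \<circ> \<omega>"
        using inv_comp_W[OF assms(2)] by (metis comp_assoc comp_id)
      then show "inv u \<circ> v = \<omega>" using inv_comp_W[OF u] by simp
    qed
    then show "f u * actQ D u (tw_single 1 \<omega> (inv u \<circ> v)) = (if u = v \<circ> inv \<omega> then f u else 0)"
      using actQ_0[OF u] actQ_1[OF u] by (auto simp: tw_single_def)
  qed simp
  also have "\<dots> = f (v \<circ> inv \<omega>)"
    using fD(1) by (simp add: sum.delta)
  finally show ?thesis .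
qed

lemma tw_mult_scalar:
  assumes "p \<in> S" "g \<in> residue_algebra"
  shows "tw_mult D (tw_single (emb p) id) g = (\<lambda>w. emb p * g w)"
proof
  fix w
  have "tw_mult D (tw_single (emb p) id) g w =
      (\<Sum>u\<in>{id}. tw_single (emb p) id u * actQ D u (g (inv u \<circ> w)))"
    using id_W by (intro tw_mult_sum) (auto simp: tw_single_def)
  then show "tw_mult D (tw_single (emb p) id) g w = emb p * g w"
    using real_poles_Frac_S[OF residue_algebraD(3)[OF assms(2)]]
    by (simp add: tw_single_def inv_id actQ_id)
qed

end

locale weyl_setting = reflection_setting +
  assumes Omega_eq: "Omega D = {\<omega> \<in> weyl_group D. \<forall>\<alpha>\<in>pos_re D. \<omega> \<alpha> \<in> pos_re D}"
begin

lemma Omega_iff: "\<omega> \<in> Omega D \<longleftrightarrow> \<omega> \<in> W \<and> inversions \<omega> = {}"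
  using positive_preserves by (auto simp: Omega_eq)

lemma nil_Hecke_subset: "f \<in> nil_Hecke D \<Longrightarrow> f \<in> residue_algebra"
proof (induction rule: nil_Hecke.induct)
  case (Dem a \<omega>)
  then show ?case
    using tw_single_residue_algebra[of 1 \<omega>]
    by (intro tw_mult_residue_algebra Dem_cox_residue_algebra) (simp_all add: Omega_iff emb_1)
qed (auto intro: diff_residue_algebra tw_mult_residue_algebra tw_single_residue_algebra id_W)

lemma nil_Hecke_zero: "(\<lambda>_. 0) \<in> nil_Hecke D"
  using nil_Hecke.diff[OF nil_Hecke.scalar[of 0 D] nil_Hecke.scalar[of 0 D]] by simp

lemma nil_Hecke_add: "f \<in> nil_Hecke D \<Longrightarrow> g \<in> nil_Hecke D \<Longrightarrow> (\<lambda>w. f w + g w) \<in> nil_Hecke D"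
  using nil_Hecke.diff[of f D "\<lambda>w. 0 - g w"] nil_Hecke.diff[OF nil_Hecke_zero, of g] by simp

lemma nil_Hecke_scale: "p \<in> S \<Longrightarrow> f \<in> nil_Hecke D \<Longrightarrow> (\<lambda>w. emb p * f w) \<in> nil_Hecke D"
  using nil_Hecke.mult[OF nil_Hecke.scalar, of p D f] by (simp add: tw_mult_scalar nil_Hecke_subset)

lemma leading_element:
  assumes "w \<in> W"
  obtains T c where "T \<in> nil_Hecke D" "c \<in> {1, - 1}" "T w * (\<Prod>\<alpha>\<in>inversions w. linQ D \<alpha>) = c"
    "\<And>v. T v \<noteq> 0 \<Longrightarrow> len v \<le> len w \<and> (len v = len w \<longrightarrow> v = w)"
proof -
  obtain a \<omega> where a: "a \<in> refl_group s (simple D)" and \<omega>: "\<omega> \<in> W" "inversions \<omega> = {}"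
    and w: "w = a \<circ> \<omega>"
    using cox_times_positive[OF assms] by blast
  obtain as where as: "reduced_word D as" "word_prod s as = a" "Dem_cox D a = Dem_word D as"
    using a by (rule Dem_cox_word)
  have aW: "a \<in> W" using a reflection_group_W by blast
  let ?T = "tw_mult D (Dem_cox D a) (tw_single 1 \<omega>)"
  have T: "?T v = Dem_word D as (v \<circ> inv \<omega>)" for v
    using tw_mult_single[OF Dem_cox_residue_algebra[OF a] \<omega>(1)] as by simp
  have mem: "?T \<in> nil_Hecke D" using a \<omega> by (intro nil_Hecke.Dem) (simp_all add: Omega_iff)
  have inv_w: "inversions w = inversions a"
    unfolding w using aW \<omega> by (rule inversions_comp_positive)
  have len_w: "len w = length as" using len_reduced[OF as(1)] as(2) by (simp add: len_def inv_w)
  have wa: "w \<circ> inv \<omega> = a" using comp_inv_W[OF \<omega>(1)] by (metis w comp_assoc comp_id)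
  have "len v \<le> len w \<and> (len v = len w \<longrightarrow> v = w)" if "?T v \<noteq> 0" for v
  proof -
    let ?u = "v \<circ> inv \<omega>"
    have nz: "Dem_word D as ?u \<noteq> 0" using that T by simp
    have "?u \<in> W"
      using nz residue_algebraD(2)[OF Dem_cox_residue_algebra[OF a]] as(3) by auto
    moreover have v: "v = ?u \<circ> \<omega>" using inv_comp_W[OF \<omega>(1)] by (metis comp_assoc comp_id)
    ultimately have "len v = len ?u"
      using inversions_comp_positive[OF _ \<omega>, of ?u] by (simp add: len_def)
    moreover have "len ?u \<le> length as \<and> (len ?u = length as \<longrightarrow> ?u = a)"
      using Dem_word_leading(1)[OF as(1) nz] as(2) by simp
    ultimately show ?thesis using v w len_w by metis
  qed
  moreover have "?T w * (\<Prod>\<alpha>\<in>inversions w. linQ D \<alpha>) \<in> {1, - 1}"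
    using Dem_word_leading(2)[OF as(1)] as(2) by (simp only: T wa inv_w)
  ultimately show ?thesis using that[OF mem _ refl] by blast
qed

text \<open>
  At an element \<open>w\<close> of maximal length in the support, the residue condition forces the coefficient to
  be regular along the hyperplanes of all non-inversions \<open>\<alpha>\<close> of \<open>w\<close>, as \<open>s\<^sub>\<alpha> w\<close> is longer. Hence that
  coefficient is a polynomial multiple of the leading coefficient of \<open>D\<^sub>w\<close> and can be removed.
\<close>

lemma residue_algebra_subset:
  assumes "f \<in> residue_algebra" "\<And>w. f w \<noteq> 0 \<Longrightarrow> len w < L"
  shows "f \<in> nil_Hecke D"
  using assms
proof (induction L arbitrary: f)
  case 0
  then have "f = (\<lambda>_. 0)" by blast
  then show ?case using nil_Hecke_zero by simp
next
  case (Suc L)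
  have "g \<in> nil_Hecke D" if "finite A" "g \<in> residue_algebra"
    "\<And>w. g w \<noteq> 0 \<Longrightarrow> len w < L \<or> len w = L \<and> w \<in> A" for A g
    using that
  proof (induction A arbitrary: g)
    case empty
    then show ?case using Suc.IH by blast
  next
    case (insert w A)
    show ?case
    proof (cases "g w \<noteq> 0 \<and> len w = L")
      case False
      then show ?thesis using insert by blast
    next
      case True
      then have w: "w \<in> W" using residue_algebraD(2)[OF insert.prems(1)] by blast
      have "g w \<in> local_ring D \<alpha>" if \<alpha>: "\<alpha> \<in> \<Phi>" "\<alpha> \<notin> inversions w" for \<alpha>
      proof -
        have "L < len (s \<alpha> \<circ> w)" using len_refl_greater[OF w \<alpha>] True by simp
        then have "g (s \<alpha> \<circ> w) = 0" using insert.prems(2) by (metis less_asym nat_neq_iff)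
        then show ?thesis using residue_algebraD(5)[OF insert.prems(1) w \<alpha>(1)]
          by (metis add_0_right)
      qed
      moreover have "only_simple_real_poles D (g w)"
        using insert.prems(1) w by (simp add: residue_algebra_def)
      ultimately obtain q where q: "q \<in> S" "g w = emb q / (\<Prod>\<alpha>\<in>inversions w. linQ D \<alpha>)"
        using clear_simple_poles[of "g w" "inversions w"] finite_inversions[OF w]
        by (auto simp: inversions_def)
      obtain T c where T: "T \<in> nil_Hecke D" "c \<in> {1, - 1}" "T w * (\<Prod>\<alpha>\<in>inversions w. linQ D \<alpha>) = c"
        "\<And>v. T v \<noteq> 0 \<Longrightarrow> len v \<le> len w \<and> (len v = len w \<longrightarrow> v = w)"
        using leading_element[OF w] by metis
      have P: "(\<Prod>\<alpha>\<in>inversions w. linQ D \<alpha>) \<noteq> 0" using T(2,3) by auto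
      obtain p where p: "p \<in> S" "emb p * c = emb q"
      proof (cases "c = 1")
        case True
        then show ?thesis using that[of q] q(1) by simp
      next
        case False
        then have "c = - 1" using T(2) by simp
        then show ?thesis using that[of "- q"] q(1) by (auto simp: emb_uminus simp del: minus_fract)
      qed
      have "emb p * T w * (\<Prod>\<alpha>\<in>inversions w. linQ D \<alpha>) = emb q" using T(3) p(2) by (simp only: mult.assoc)
      then have eq: "g w = emb p * T w" using P q(2) by (metis nonzero_mult_div_cancel_right)
      let ?h = "\<lambda>v. emb p * T v"
      have h: "?h \<in> nil_Hecke D" by (rule nil_Hecke_scale[OF p(1) T(1)])
      have "(\<lambda>v. g v - ?h v) \<in> nil_Hecke D"
      proof (rule insert.IH)
        show "(\<lambda>v. g v - ?h v) \<in> residue_algebra"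
          using insert.prems(1) nil_Hecke_subset[OF h] by (rule diff_residue_algebra)
        fix v assume v: "g v - ?h v \<noteq> 0"
        then have "v \<noteq> w" using eq by auto
        moreover have "g v \<noteq> 0 \<or> T v \<noteq> 0" using v by auto
        ultimately show "len v < L \<or> len v = L \<and> v \<in> A"
          using insert.prems(2)[of v] T(4)[of v] True by (metis insertE nat_less_le)
      qed
      then have "(\<lambda>v. g v - ?h v + ?h v) \<in> nil_Hecke D" using h by (rule nil_Hecke_add)
      then show ?thesis by simp
    qed
  qed
  from this[OF residue_algebraD(1)[OF Suc.prems(1)] Suc.prems(1)] show ?case
    using Suc.prems(2) by (auto simp: less_Suc_eq)
qed

theorem nil_Hecke_eq_residue_algebra: "nil_Hecke D = residue_algebra"
proof (intro equalityI subsetI nil_Hecke_subset)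
  fix f assume f: "f \<in> residue_algebra"
  have fin: "finite (len ` {w. f w \<noteq> 0})" using residue_algebraD(1)[OF f] by simp
  show "f \<in> nil_Hecke D"
  proof (rule residue_algebra_subset[OF f])
    fix w assume "f w \<noteq> 0"
    then show "len w < Suc (Max (len ` {w. f w \<noteq> 0}))" using fin by (simp add: less_Suc_eq_le)
  qed
qed

end


section \<open>Twisting by a collection of characters\<close>

lemma root_product_nonzero':
  assumes "\<And>v. v \<in># M \<Longrightarrow> v \<in> lattice (rank D) \<and> v \<noteq> (\<lambda>_. 0)"
  shows "root_product D M \<noteq> 0"
  using assms by (induction M) (auto simp: lin_eq_0_iff)

text \<open>
  Common linear factors of a numerator and of a product of linear forms can be cancelled; what
  remains is coprime, because every divisor of a product of primes is a unit or divisible by one of them.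
\<close>

lemma cancel_linear_factors:
  assumes "a \<in> S_ring D" "\<And>v. v \<in># M \<Longrightarrow> v \<in> lattice (rank D) \<and> v \<noteq> (\<lambda>_. 0)"
  shows "\<exists>a' M'. a' \<in> S_ring D \<and> M' \<subseteq># M \<and> Fract a (root_product D M) = Fract a' (root_product D M') \<and>
    (\<forall>v\<in>#M'. \<not> lin D v dvd a')"
  using assms
proof (induction "size M" arbitrary: a M rule: less_induct)
  case less
  show ?case
  proof (cases "\<exists>v\<in>#M. lin D v dvd a")
    case True
    then obtain v where v: "v \<in># M" "lin D v dvd a" by blast
    then obtain N where M: "M = add_mset v N" by (metis insert_DiffM)
    obtain b where b: "a = lin D v * b" "b \<in> S_ring D"
      using v(2) less.prems(1) lin_in_S by (rule S_ring_dvd_cofactor)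
    have nz: "lin D v \<noteq> 0" using less.prems(2)[OF v(1)] by (simp add: lin_eq_0_iff)
    have "\<And>u. u \<in># N \<Longrightarrow> u \<in> lattice (rank D) \<and> u \<noteq> (\<lambda>_. 0)"
      using less.prems(2) by (simp add: M)
    then obtain a' M' where *: "a' \<in> S_ring D" "M' \<subseteq># N" "Fract b (root_product D N) = Fract a' (root_product D M')"
      "\<forall>v\<in>#M'. \<not> lin D v dvd a'"
      using less.hyps[of N b] b by (auto simp: M)
    moreover have "Fract a (root_product D M) = Fract b (root_product D N)"
      using nz by (simp add: M b mult_fract_cancel)
    moreover have "M' \<subseteq># M" using *(2) by (simp add: M subset_mset.order_trans)
    ultimately show ?thesis by metis
  next
    case False
    then show ?thesis using less.prems by (intro exI[of _ a] exI[of _ M]) auto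
  qed
qed

lemma coprime_linear_factors:
  assumes "\<And>v. v \<in># M \<Longrightarrow> v \<in> lattice (rank D) \<and> v \<noteq> (\<lambda>_. 0) \<and> \<not> lin D v dvd a"
    and "c dvd a" "c dvd root_product D M"
  shows "c dvd 1"
  using assms(1,3)
proof (induction M)
  case (add v M)
  have v: "v \<in> lattice (rank D)" "v \<noteq> (\<lambda>_. 0)" "\<not> lin D v dvd a" using add.prems(1)[of v] by auto
  obtain d where d: "lin D v * root_product D M = c * d" using add.prems(2) by (auto elim: dvdE)
  have "\<not> lin D v dvd c" using v(3) assms(2) dvd_trans by blast
  then have "lin D v dvd d" using lin_prime[OF v(1,2), of c d] d by (metis dvd_triv_left)
  then obtain e where e: "d = lin D v * e" by (elim dvdE)
  have "lin D v * root_product D M = lin D v * (c * e)" using d by (simp add: e mult_ac)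
  then have "root_product D M = c * e" using v by (simp add: lin_eq_0_iff)
  then show ?case using add.IH add.prems(1) by simp
qed simp

lemma linQ_powi_prod:
  assumes "finite V" "\<And>v. v \<in> V \<Longrightarrow> v \<in> lattice (rank D) \<and> v \<noteq> (\<lambda>_. 0)"
  shows "\<exists>a M. a \<in> S_ring D \<and> set_mset M \<subseteq> V \<and>
    (\<Prod>v\<in>V. linQ D v powi e v) = Fract a (root_product D M)"
  using assms
proof (induction V)
  case empty
  then show ?case by (intro exI[of _ 1] exI[of _ "{#}"]) (simp add: One_fract_def)
next
  case (insert v V)
  then obtain a M where *: "a \<in> S_ring D" "set_mset M \<subseteq> V"
    "(\<Prod>v\<in>V. linQ D v powi e v) = Fract a (root_product D M)" by auto
  have pow: "linQ D v ^ n = emb (lin D v ^ n)" for n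
    by (induction n) (simp_all add: linQ_eq_emb emb_1)
  have rep: "root_product D (replicate_mset n v) = lin D v ^ n" for n
    by (induction n) simp_all
  show ?case
  proof (cases "e v \<ge> 0")
    case True
    then have "linQ D v powi e v = emb (lin D v ^ nat (e v))"
      by (simp add: power_int_def pow)
    then show ?thesis using * insert.hyps
      by (intro exI[of _ "lin D v ^ nat (e v) * a"] exI[of _ M]) (auto intro!: S_ring_power)
  next
    case False
    then have "linQ D v powi e v = Fract 1 (lin D v ^ nat (- e v))"
      by (simp add: power_int_def power_inverse pow)
    then show ?thesis using * insert.hyps
      by (intro exI[of _ a] exI[of _ "replicate_mset (nat (- e v)) v + M"])
        (auto simp: root_product_union rep)
  qed
qed

context weyl_setting
begin

context
  fixes m :: "weight \<Rightarrow> nat"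
  assumes adm: "admissible_collection D m"
begin

lemma support_difference:
  assumes "w \<in> W"
  shows "finite {v. m v \<noteq> act_coll w m v}"
    and "m v \<noteq> act_coll w m v \<Longrightarrow> v \<in> lattice (rank D) \<and> v \<noteq> (\<lambda>_. 0)"
proof -
  have "{v. m v \<noteq> act_coll w m v} \<subseteq> {v. act_coll w m v - m v \<noteq> 0} \<union> {v. m v - act_coll w m v \<noteq> 0}"
    by auto
  then show "finite {v. m v \<noteq> act_coll w m v}"
    using adm assms unfolding admissible_collection_def by (meson finite_UnI finite_subset)
  assume v: "m v \<noteq> act_coll w m v"
  then have "m v \<noteq> 0 \<or> m (inv w v) \<noteq> 0" by (auto simp: act_coll_def)
  then have "v \<in> lattice (rank D) \<or> inv w v \<in> lattice (rank D)"
    using adm by (auto simp: admissible_collection_def)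
  then have "v \<in> lattice (rank D)"
    using lattice_W[OF assms, of "inv w v"] assms by (auto simp: surj_f_inv_f bij_is_surj bij_W)
  moreover have "act_coll w m (\<lambda>_. 0) = m (\<lambda>_. 0)"
    using int_linear_0[OF linear_W[OF inv_W[OF assms]]] by (simp add: act_coll_def)
  ultimately show "v \<in> lattice (rank D) \<and> v \<noteq> (\<lambda>_. 0)" using v by auto
qed

lemma Pi_ratio_inverse:
  assumes "w \<in> W"
  shows "Pi_ratio D (act_coll w m) m * Pi_ratio D m (act_coll w m) = 1"
proof -
  let ?V = "{v. m v \<noteq> act_coll w m v}"
  have V: "{v. act_coll w m v \<noteq> m v} = ?V" by auto
  have "linQ D v \<noteq> 0" if "v \<in> ?V" for v
    using support_difference(2)[OF assms, of v] that by (simp add: linQ_eq_emb lin_eq_0_iff)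
  then have "linQ D v powi (int (act_coll w m v) - int (m v)) *
      linQ D v powi (int (m v) - int (act_coll w m v)) = 1" if "v \<in> ?V" for v
    using that by (simp flip: power_int_add)
  then show ?thesis
    unfolding Pi_ratio_def V prod.distrib[symmetric] by (simp add: prod.neutral)
qed

text \<open>
  The chosen fraction in lowest terms differs from the one that results from cancelling common linear
  factors by a unit. So its denominator is a product of primes that do not divide the numerator.
\<close>

lemma Pi_lowest:
  assumes "w \<in> W"
  obtains a b where "Pi_lowest D m w = (a, b)" "a \<in> S" "b \<in> S" "b \<noteq> 0"
    "Pi_ratio D m (act_coll w m) = Fract a b" "\<And>y. b dvd a * y \<Longrightarrow> b dvd y"
proof -
  let ?r = "Pi_ratio D m (act_coll w m)" and ?V = "{v. m v \<noteq> act_coll w m v}"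
  let ?P = "\<lambda>(a, b). a \<in> S \<and> b \<in> S \<and> b \<noteq> 0 \<and> coprime_S D a b \<and> ?r = Fract a b"
  obtain a0 M0 where 0: "a0 \<in> S" "set_mset M0 \<subseteq> ?V" "?r = Fract a0 (root_product D M0)"
    using linQ_powi_prod[of ?V D "\<lambda>v. int (m v) - int (act_coll w m v)"]
      support_difference[OF assms] unfolding Pi_ratio_def by auto
  have lat0: "\<And>v. v \<in># M0 \<Longrightarrow> v \<in> lattice (rank D) \<and> v \<noteq> (\<lambda>_. 0)"
    using 0(2) support_difference(2)[OF assms] by blast
  obtain a' M where M: "a' \<in> S" "M \<subseteq># M0" "?r = Fract a' (root_product D M)"
    "\<forall>v\<in>#M. \<not> lin D v dvd a'"
    using cancel_linear_factors[OF 0(1), of M0] lat0 0(3) by metis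
  have lat: "v \<in> lattice (rank D) \<and> v \<noteq> (\<lambda>_. 0) \<and> \<not> lin D v dvd a'" if "v \<in># M" for v
    using lat0[of v] M(2,4) that by (meson mset_subset_eqD)
  have nz: "root_product D M \<noteq> 0" using lat by (intro root_product_nonzero') blast
  have "coprime_S D a' (root_product D M)"
    unfolding coprime_S_def using coprime_linear_factors[of M D a'] lat by blast
  then have "?P (a', root_product D M)" using M nz root_product_in_S by simp
  then have "?P (Pi_lowest D m w)" unfolding Pi_lowest_def by (rule someI)
  then obtain a b where ab: "Pi_lowest D m w = (a, b)" "a \<in> S" "b \<in> S" "b \<noteq> 0" "coprime_S D a b"
    "?r = Fract a b" by auto
  have cross: "a' * b = a * root_product D M" using M(3) ab(4,6) nz by (simp add: eq_fract)
  then have "root_product D M dvd a' * b" by simp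
  then have "root_product D M dvd b"
    using lin_prod_dvd_cancel[of M D a' b] lat by (simp add: root_product_def)
  then obtain c where c: "b = root_product D M * c" "c \<in> S"
    using ab(3) root_product_in_S by (rule S_ring_dvd_cofactor)
  have a: "a = a' * c" using cross nz by (simp add: c mult_ac)
  have "c dvd 1" using ab(5) c a unfolding coprime_S_def by (metis dvd_triv_right)
  then obtain d where d: "1 = c * d" by (elim dvdE)
  have "b dvd y" if "b dvd a * y" for y
  proof -
    have "root_product D M * c dvd a' * (c * y)" using that by (simp only: a c mult.assoc)
    then have "root_product D M dvd a' * (c * y)" by (rule dvd_mult_left)
    then have "root_product D M dvd c * y"
      using lin_prod_dvd_cancel[of M D a' "c * y"] lat by (simp add: root_product_def)
    then have "root_product D M * c dvd c * y * c" by (rule mult_dvd_mono) simp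
    then have "b dvd c * y * c * (d * d)" unfolding c by (rule dvd_mult2)
    also have "c * y * c * (d * d) = y * (c * d) * (c * d)" by (simp add: mult_ac)
    finally show ?thesis by (simp flip: d)
  qed
  then show ?thesis using that ab by metis
qed

text \<open>
  If the poles of \<open>x\<close> are simple and those of \<open>a x / b\<close> are so as well, then \<open>b\<close> divides, up to further
  root factors, the product of \<open>a\<close> with the numerator of \<open>x\<close>, and hence that numerator itself.
\<close>

lemma simple_poles_quotient_iff:
  assumes w: "w \<in> W" and x: "only_simple_real_poles D x"
  shows "only_simple_real_poles D (Pi_ratio D m (act_coll w m) * x) \<longleftrightarrow>
    only_simple_real_poles D (x / Pi_tilde_den D m w)"
proof -
  obtain a b where ab: "Pi_lowest D m w = (a, b)" "a \<in> S" "b \<in> S" "b \<noteq> 0"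
    "Pi_ratio D m (act_coll w m) = Fract a b" "\<And>y. b dvd a * y \<Longrightarrow> b dvd y"
    using Pi_lowest[OF w] by metis
  have den: "Pi_tilde_den D m w = emb b" by (simp add: Pi_tilde_den_def ab)
  obtain F p where F: "finite F" "F \<subseteq> \<Phi>" "p \<in> S" "x = emb p / emb (prod (lin D) F)"
    using x by (auto simp: only_simple_real_poles_iff)
  let ?L = "prod (lin D)"
  have nz: "?L F \<noteq> 0" using F root_prod_nonzero by simp
  show ?thesis
  proof
    assume "only_simple_real_poles D (x / Pi_tilde_den D m w)"
    then obtain G q where G: "finite G" "G \<subseteq> \<Phi>" "q \<in> S" "x / emb b = emb q / emb (?L G)"
      by (auto simp: only_simple_real_poles_iff den)
    have "Fract a b * x = emb a * (x / emb b)" by (simp add: Fract_eq_divide[of a b] del: divide_fract)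
    also have "\<dots> = emb (a * q) / emb (?L G)" by (simp add: G(4))
    finally show "only_simple_real_poles D (Pi_ratio D m (act_coll w m) * x)"
      unfolding only_simple_real_poles_iff ab(5) using G ab(2) by blast
  next
    assume "only_simple_real_poles D (Pi_ratio D m (act_coll w m) * x)"
    then obtain G q where G: "finite G" "G \<subseteq> \<Phi>" "q \<in> S" "Fract a b * x = emb q / emb (?L G)"
      by (auto simp: only_simple_real_poles_iff ab)
    have nz': "?L G \<noteq> 0" "?L (F \<inter> G) \<noteq> 0" "?L (F \<union> G) \<noteq> 0" "?L (F - G) \<noteq> 0"
      using F G root_prod_nonzero[of G] root_prod_nonzero[of "F \<inter> G"] root_prod_nonzero[of "F \<union> G"]
        root_prod_nonzero[of "F - G"] by auto
    have LF: "?L F = ?L (F \<inter> G) * ?L (F - G)" and LG: "?L G = ?L (F \<inter> G) * ?L (G - F)"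
      and LU: "?L (F \<union> G) = ?L F * ?L (G - F)"
      using F(1) G(1) prod.Int_Diff[of F "lin D" G] prod.Int_Diff[of G "lin D" F]
        prod.union_disjoint[of F "G - F" "lin D"] by (auto simp: Int_commute)
    have "a * p * ?L G = q * (b * ?L F)"
      using G(4) nz nz' ab(4) by (simp add: F(4) eq_fract)
    then have "a * (p * ?L (G - F)) = b * (q * ?L (F - G))"
      using nz' by (simp add: LF LG mult_ac)
    then have "b dvd p * ?L (G - F)" by (metis ab(6) dvd_triv_left)
    then obtain y where y: "p * ?L (G - F) = b * y" "y \<in> S"
      using ab(3) F(3) by (elim S_ring_dvd_cofactor) (auto intro!: S_ring_mult S_ring_prod)
    have "p * ?L (F \<union> G) = y * (?L F * b)"
      using y(1) by (simp add: LU mult_ac)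
    then have "x / emb b = emb y / emb (?L (F \<union> G))"
      using nz nz' ab(4) by (simp add: F(4) eq_fract)
    then show "only_simple_real_poles D (x / Pi_tilde_den D m w)"
      unfolding only_simple_real_poles_iff den using F(1,2) G(1,2) y(2)
      by (intro exI[of _ "F \<union> G"] exI[of _ y]) auto
  qed
qed

lemma nil_Hecke_Sigma_iff:
  "f \<in> nil_Hecke_Sigma D m \<longleftrightarrow>
    f \<in> nil_Hecke D \<and> (\<lambda>w. Pi_ratio D m (act_coll w m) * f w) \<in> nil_Hecke D"
proof -
  let ?r = "\<lambda>w. Pi_ratio D m (act_coll w m)"
  have off: "g w = 0" if "g \<in> nil_Hecke D" "w \<notin> W" for g w
    using residue_algebraD(2)[OF nil_Hecke_subset[OF that(1)]] that(2) by blast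
  have "f \<in> Pi_conj D m ` nil_Hecke D \<longleftrightarrow> (\<lambda>w. ?r w * f w) \<in> nil_Hecke D" if f: "f \<in> nil_Hecke D"
  proof
    assume "f \<in> Pi_conj D m ` nil_Hecke D"
    then obtain g where g: "g \<in> nil_Hecke D" "f = Pi_conj D m g" by blast
    have "?r w * f w = g w" for w
    proof (cases "w \<in> W")
      case True
      then show ?thesis
        using Pi_ratio_inverse[OF True] by (simp add: g(2) Pi_conj_def mult_ac)
    next
      case False
      then show ?thesis using off[OF g(1)] off[OF f] by simp
    qed
    then show "(\<lambda>w. ?r w * f w) \<in> nil_Hecke D" using g(1) by simp
  next
    assume *: "(\<lambda>w. ?r w * f w) \<in> nil_Hecke D"
    have "f w = ?r w * f w * Pi_ratio D (act_coll w m) m" for w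
    proof (cases "w \<in> W")
      case True
      then show ?thesis using Pi_ratio_inverse[OF True] by (simp add: mult_ac)
    next
      case False
      then show ?thesis using off[OF f] by simp
    qed
    then have "f = Pi_conj D m (\<lambda>w. ?r w * f w)" by (simp add: Pi_conj_def fun_eq_iff)
    then show "f \<in> Pi_conj D m ` nil_Hecke D" using * by (rule image_eqI)
  qed
  then show ?thesis by (auto simp: nil_Hecke_Sigma_def)
qed

theorem nil_Hecke_Sigma_residues:
  "nil_Hecke_Sigma D m =
    {f \<in> QW D.
       (\<forall>w\<in>weyl_group D. only_simple_real_poles D (f w)) \<and>
       (\<forall>w\<in>weyl_group D. \<forall>\<alpha>\<in>pos_re D.
          Res D \<alpha> (f w) + Res D \<alpha> (f (refl D \<alpha> \<circ> w)) = restrict_hyp D \<alpha> 0) \<and>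
       (\<forall>w\<in>weyl_group D. \<forall>\<alpha>\<in>pos_re D.
          Res D \<alpha> (Pi_ratio D m (act_coll w m) * f w) +
          Res D \<alpha> (Pi_ratio D m (act_coll (refl D \<alpha> \<circ> w) m) * f (refl D \<alpha> \<circ> w))
            = restrict_hyp D \<alpha> 0) \<and>
       (\<forall>w\<in>weyl_group D. only_simple_real_poles D (f w / Pi_tilde_den D m w))}"
proof -
  let ?r = "\<lambda>w. Pi_ratio D m (act_coll w m)"
  have twisted: "(\<lambda>w. ?r w * f w) \<in> residue_algebra \<longleftrightarrow>
      (\<forall>w\<in>W. only_simple_real_poles D (?r w * f w)) \<and>
      (\<forall>w\<in>W. \<forall>\<alpha>\<in>\<Phi>. ?r w * f w + ?r (s \<alpha> \<circ> w) * f (s \<alpha> \<circ> w) \<in> local_ring D \<alpha>)"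
    if "f \<in> QW D" for f
  proof -
    have f: "finite {w. f w \<noteq> 0}" "{w. f w \<noteq> 0} \<subseteq> W" using that by (auto simp: QW_def)
    have sub: "{w. ?r w * f w \<noteq> 0} \<subseteq> {w. f w \<noteq> 0}" by auto
    have "?r w * f w \<in> Q_ring D" if *: "\<forall>w\<in>W. only_simple_real_poles D (?r w * f w)" for w
    proof (cases "w \<in> W")
      case True
      then show ?thesis using * only_simple_poles_real_poles real_poles_Q_ring by blast
    next
      case False
      then have "?r w * f w = 0" using f by auto
      then show ?thesis using real_poles_Q_ring[OF real_poles_0] by (simp only:)
    qed
    then have "(\<lambda>w. ?r w * f w) \<in> QW D" if "\<forall>w\<in>W. only_simple_real_poles D (?r w * f w)"
      using that f finite_subset[OF sub] sub unfolding QW_def by blast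
    then show ?thesis unfolding residue_algebra_def by blast
  qed
  show ?thesis
  proof (intro set_eqI)
    fix f
    show "f \<in> nil_Hecke_Sigma D m \<longleftrightarrow> f \<in> {f \<in> QW D.
       (\<forall>w\<in>weyl_group D. only_simple_real_poles D (f w)) \<and>
       (\<forall>w\<in>weyl_group D. \<forall>\<alpha>\<in>pos_re D.
          Res D \<alpha> (f w) + Res D \<alpha> (f (refl D \<alpha> \<circ> w)) = restrict_hyp D \<alpha> 0) \<and>
       (\<forall>w\<in>weyl_group D. \<forall>\<alpha>\<in>pos_re D.
          Res D \<alpha> (Pi_ratio D m (act_coll w m) * f w) +
          Res D \<alpha> (Pi_ratio D m (act_coll (refl D \<alpha> \<circ> w) m) * f (refl D \<alpha> \<circ> w))
            = restrict_hyp D \<alpha> 0) \<and>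
       (\<forall>w\<in>weyl_group D. only_simple_real_poles D (f w / Pi_tilde_den D m w))}"
      unfolding nil_Hecke_Sigma_iff nil_Hecke_eq_residue_algebra mem_Collect_eq
      using twisted[of f] simple_poles_quotient_iff
      by (simp only: residue_algebra_def mem_Collect_eq residues_local_iff cong: ball_cong conj_cong) blast
  qed
qed

end

end


section \<open>Reflections of a lattice\<close>

lemma pairing_comb: "pairing N c (\<lambda>j. a * u j + b * v j) = a * pairing N c u + b * pairing N c v"
  by (simp add: pairing_def sum_distrib_left sum.distrib algebra_simps)

lemma pairing_diff: "pairing N c (\<lambda>j. u j - b * v j) = pairing N c u - b * pairing N c v"
  using pairing_comb[of N c 1 u "- b" v] by simp

lemma pairing_sum_left: "pairing N (\<lambda>j. \<Sum>i\<in>I. k i * c i j) v = (\<Sum>i\<in>I. k i * pairing N (c i) v)"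
  unfolding pairing_def sum_distrib_right sum_distrib_left
  by (subst sum.swap) (simp add: mult.assoc)

lemma pairing_sum_right: "pairing N c (\<lambda>j. \<Sum>i\<in>I. k i * v i j) = (\<Sum>i\<in>I. k i * pairing N c (v i))"
  unfolding pairing_def sum_distrib_right sum_distrib_left
  by (subst sum.swap) (simp add: mult.left_commute)

lemma pairing_wneg: "pairing N c (wneg v) = - pairing N c v"
  by (simp add: pairing_def wneg_def sum_negf)

lemma reflection_linear: "int_linear (reflection N c a)"
  by (auto simp: int_linear_def reflection_def pairing_comb algebra_simps)

lemma reflection_involution:
  assumes "pairing N c a = 2"
  shows "reflection N c a \<circ> reflection N c a = id"
proof (rule ext)
  fix v
  have "pairing N c (reflection N c a v) = - pairing N c v"
    unfolding reflection_def pairing_diff assms by simp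
  then have "reflection N c a (reflection N c a v) = (\<lambda>j. reflection N c a v j + pairing N c v * a j)"
    by (subst reflection_def) simp
  then show "(reflection N c a \<circ> reflection N c a) v = id v"
    by (simp add: reflection_def)
qed

lemma reflection_lattice: "a \<in> lattice M \<Longrightarrow> v \<in> lattice M \<Longrightarrow> reflection N c a v \<in> lattice M"
  by (simp add: lattice_def reflection_def)

lemma refl_group_id: "id \<in> refl_group s I"
  unfolding refl_group_def by (auto intro!: exI[of _ "[]"])

lemma refl_group_comp: "u \<in> refl_group s I \<Longrightarrow> w \<in> refl_group s I \<Longrightarrow> u \<circ> w \<in> refl_group s I"
proof -
  assume "u \<in> refl_group s I" "w \<in> refl_group s I"
  then obtain xs ys where "set xs \<subseteq> I" "u = word_prod s xs" "set ys \<subseteq> I" "w = word_prod s ys"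
    by (auto simp: refl_group_def)
  then show ?thesis
    unfolding refl_group_def by (auto simp: word_prod_append intro!: exI[of _ "xs @ ys"])
qed

lemma refl_group_gen: "i \<in> I \<Longrightarrow> s i \<in> refl_group s I"
  unfolding refl_group_def by (auto intro!: exI[of _ "[i]"])

lemma refl_group_induct [consumes 1, case_names id refl]:
  assumes "w \<in> refl_group s I" "P id"
    and "\<And>i w. i \<in> I \<Longrightarrow> w \<in> refl_group s I \<Longrightarrow> P w \<Longrightarrow> P (s i \<circ> w)"
  shows "P w"
proof -
  obtain xs where "set xs \<subseteq> I" "w = word_prod s xs" using assms(1) by (auto simp: refl_group_def)
  then show ?thesis
  proof (induction xs arbitrary: w)
    case (Cons i xs)
    then have "word_prod s xs \<in> refl_group s I" "P (word_prod s xs)" by (auto simp: refl_group_def)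
    then have "P (s i \<circ> word_prod s xs)" using Cons.prems by (intro assms(3)) auto
    then show ?case using Cons.prems by (simp only: word_prod_Cons)
  qed (simp add: assms(2) id_def[symmetric])
qed

lemma word_prod_rev:
  assumes "\<And>i. i \<in> set xs \<Longrightarrow> s i \<circ> s i = id"
  shows "word_prod s (rev xs) \<circ> word_prod s xs = id"
  using assms
proof (induction xs)
  case (Cons i xs)
  have i: "s i \<circ> s i = id" by (rule Cons.prems) simp
  have IH: "word_prod s (rev xs) \<circ> word_prod s xs = id"
    by (rule Cons.IH, rule Cons.prems) simp
  have "word_prod s (rev (i # xs)) \<circ> word_prod s (i # xs) =
      word_prod s (rev xs) \<circ> (s i \<circ> s i) \<circ> word_prod s xs"
    by (simp only: rev.simps word_prod_append word_prod_Cons word_prod_Nil comp_id comp_assoc)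
  then show ?case by (simp only: i comp_id IH)
qed simp

lemma refl_group_inverse:
  assumes "\<And>i. i \<in> I \<Longrightarrow> s i \<circ> s i = id" "w \<in> refl_group s I"
  shows "bij w" "inv w \<in> refl_group s I"
proof -
  obtain xs where xs: "set xs \<subseteq> I" "w = word_prod s xs" using assms(2) by (auto simp: refl_group_def)
  have 1: "word_prod s (rev xs) \<circ> w = id"
    using word_prod_rev[of xs s] xs assms(1) by blast
  have 2: "w \<circ> word_prod s (rev xs) = id"
    using word_prod_rev[of "rev xs" s] xs assms(1) by auto
  show "bij w" using 1 2 by (rule o_bij)
  have "inv w = word_prod s (rev xs)" using 2 1 by (intro inv_unique_comp)
  then show "inv w \<in> refl_group s I" using xs unfolding refl_group_def by (metis (mono_tags, lifting) mem_Collect_eq set_rev)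
qed


section \<open>Kac--Moody root data\<close>

fun alternating :: "'a \<Rightarrow> 'a \<Rightarrow> nat \<Rightarrow> 'a list" where
  "alternating a b 0 = []"
| "alternating a b (Suc l) = a # alternating b a l"

lemma length_alternating [simp]: "length (alternating a b l) = l"
  by (induction a b l rule: alternating.induct) simp_all

lemma set_alternating: "set (alternating a b l) \<subseteq> {a, b}"
  by (induction a b l rule: alternating.induct) auto

lemma alternating_add: "\<exists>xs. alternating a b (l + k) = alternating a b l @ xs \<and> set xs \<subseteq> {a, b}"
  by (induction a b l rule: alternating.induct) (use set_alternating in fastforce)+

lemma alternating_snoc: "alternating a b (Suc l) = alternating a b l @ [if even l then a else b]"
  by (induction a b l rule: alternating.induct) auto

lemma alternatingI:
  assumes "set ds \<subseteq> {a, b}" "ds \<noteq> [] \<Longrightarrow> hd ds = a" "\<And>xs c ys. ds \<noteq> xs @ [c, c] @ ys"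
  shows "ds = alternating a b (length ds)"
  using assms
proof (induction ds arbitrary: a b)
  case (Cons d ds)
  have d: "d = a" using Cons.prems(2) by simp
  have "hd ds = b" if ne: "ds \<noteq> []"
  proof -
    obtain e es where ds: "ds = e # es" using ne by (cases ds) auto
    have "e \<noteq> d" using Cons.prems(3)[of "[]" d es] ds by auto
    then show ?thesis using Cons.prems(1) d ds by auto
  qed
  moreover have "ds \<noteq> xs @ [c, c] @ ys" for xs c ys
    using Cons.prems(3)[of "d # xs" c ys] by simp
  ultimately have "ds = alternating b a (length ds)"
    using Cons.prems(1) by (intro Cons.IH) auto
  then show ?case using d by simp
qed simp

locale kac_moody =
  fixes K :: km_datum
  assumes datum: "km_root_datum K"
begin

abbreviation "n \<equiv> km_size K"
abbreviation "N \<equiv> km_rank K"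
abbreviation "A \<equiv> km_cartan K"
abbreviation "sroot \<equiv> km_root K"
abbreviation "scoroot \<equiv> km_coroot K"
abbreviation "sr \<equiv> km_simple_refl K"
abbreviation "Wk \<equiv> km_weyl K"

lemma cartan: "i < n \<Longrightarrow> A i i = 2" "i < n \<Longrightarrow> j < n \<Longrightarrow> i \<noteq> j \<Longrightarrow> A i j \<le> 0"
    "i < n \<Longrightarrow> j < n \<Longrightarrow> A i j = 0 \<Longrightarrow> A j i = 0"
  and roots_lattice: "i < n \<Longrightarrow> sroot i \<in> lattice N"
  and pairing_A: "i < n \<Longrightarrow> j < n \<Longrightarrow> pairing N (scoroot i) (sroot j) = A i j"
  and independent: "int_independent {..<n} sroot"
  using datum by (auto simp: km_root_datum_def symmetrizable_gcm_def)

definition rootvec :: "(nat \<Rightarrow> int) \<Rightarrow> weight" where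
  "rootvec k = (\<lambda>j. \<Sum>i<n. k i * sroot i j)"

definition corootvec :: "(nat \<Rightarrow> int) \<Rightarrow> weight" where
  "corootvec k = (\<lambda>j. \<Sum>i<n. k i * scoroot i j)"

lemma rootvec_eq_iff: "rootvec k = rootvec k' \<longleftrightarrow> (\<forall>i<n. k i = k' i)"
proof
  assume "rootvec k = rootvec k'"
  then have "\<forall>j. (\<Sum>i<n. (k i - k' i) * sroot i j) = 0"
    by (simp add: rootvec_def fun_eq_iff left_diff_distrib sum_subtractf)
  then have "\<forall>i\<in>{..<n}. k i - k' i = 0"
    using independent[unfolded int_independent_def, THEN spec, of "\<lambda>i. k i - k' i"] by blast
  then show "\<forall>i<n. k i = k' i" by auto
qed (auto simp: rootvec_def)

lemma rootvec_unit: "i < n \<Longrightarrow> rootvec (\<lambda>l. if l = i then c else 0) = (\<lambda>j. c * sroot i j)"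
  by (simp add: rootvec_def if_distrib[of "\<lambda>x. x * _"] sum.delta cong: if_cong)

lemma root_rootvec: "i < n \<Longrightarrow> sroot i = rootvec (\<lambda>l. if l = i then 1 else 0)"
  by (simp add: rootvec_unit)

lemma wneg_rootvec: "wneg (rootvec k) = rootvec (\<lambda>i. - k i)"
  by (simp add: rootvec_def wneg_def sum_negf)

lemma rootvec_lattice: "rootvec k \<in> lattice N"
  using roots_lattice by (simp add: rootvec_def lattice_def)

lemma root_inj: "inj_on sroot {..<n}"
proof (rule inj_onI)
  fix i l assume "i \<in> {..<n}" "l \<in> {..<n}" "sroot i = sroot l"
  then have "\<forall>x<n. (if x = i then 1 else 0) = (if x = l then 1 else (0::int))"
    by (simp add: root_rootvec rootvec_eq_iff)
  then show "i = l" using \<open>i \<in> {..<n}\<close> by (metis lessThan_iff zero_neq_one)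
qed

lemma rootvec_linear: "int_linear w \<Longrightarrow> w (rootvec k) = (\<lambda>j. \<Sum>i<n. k i * w (sroot i) j)"
  unfolding rootvec_def by (rule int_linear_sum)

lemma pairing_coroot_rootvec: "l < n \<Longrightarrow> pairing N (scoroot l) (rootvec k) = (\<Sum>i<n. A l i * k i)"
  by (simp add: rootvec_def pairing_sum_right pairing_A mult.commute)

lemma sr_eq: "sr l v = (\<lambda>j. v j - pairing N (scoroot l) v * sroot l j)"
  by (simp add: km_simple_refl_def reflection_def)

lemma sr_linear: "int_linear (sr l)"
  by (simp add: km_simple_refl_def reflection_linear)

lemma sr_sr: "l < n \<Longrightarrow> sr l \<circ> sr l = id"
  by (simp add: km_simple_refl_def reflection_involution pairing_A cartan)

lemma sr_sr_apply: "l < n \<Longrightarrow> sr l (sr l v) = v"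
  using sr_sr by (metis comp_apply id_apply)

lemma sr_root: "l < n \<Longrightarrow> sr l (sroot l) = wneg (sroot l)"
  by (simp add: sr_eq pairing_A cartan wneg_def)

lemma sr_rootvec:
  assumes "l < n"
  shows "sr l (rootvec k) = rootvec (k(l := k l - (\<Sum>i<n. A l i * k i)))"
proof -
  let ?c = "\<Sum>i<n. A l i * k i"
  have "sr l (rootvec k) = (\<lambda>j. rootvec k j - rootvec (\<lambda>i. if i = l then ?c else 0) j)"
    by (simp only: sr_eq pairing_coroot_rootvec[OF assms] rootvec_unit[OF assms])
  also have "\<dots> = rootvec (\<lambda>i. k i - (if i = l then ?c else 0))"
    by (simp add: rootvec_def sum_subtractf left_diff_distrib)
  also have "\<dots> = rootvec (k(l := k l - ?c))"
    by (simp add: rootvec_eq_iff)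
  finally show ?thesis .
qed

lemma weyl_eq: "Wk = refl_group sr {..<n}"
  by (simp add: km_weyl_def)

lemma sr_weyl: "l < n \<Longrightarrow> sr l \<in> Wk"
  by (simp add: weyl_eq refl_group_gen)

lemma weyl_bij: "w \<in> Wk \<Longrightarrow> bij w" and weyl_inv: "w \<in> Wk \<Longrightarrow> inv w \<in> Wk"
  using refl_group_inverse[of "{..<n}" sr] sr_sr by (simp_all add: weyl_eq)

lemma weyl_comp: "u \<in> Wk \<Longrightarrow> w \<in> Wk \<Longrightarrow> u \<circ> w \<in> Wk"
  by (simp add: weyl_eq refl_group_comp)

lemma weyl_id: "id \<in> Wk"
  by (simp add: weyl_eq refl_group_id)

lemma weyl_linear: "w \<in> Wk \<Longrightarrow> int_linear w"
  unfolding weyl_eq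
proof (induction rule: refl_group_induct)
  case id
  show ?case by (rule int_linear_id)
next
  case (refl i w)
  then show ?case by (intro int_linear_comp sr_linear)
qed

lemma weyl_lattice: "w \<in> Wk \<Longrightarrow> v \<in> lattice N \<Longrightarrow> w v \<in> lattice N"
  unfolding weyl_eq
proof (induction rule: refl_group_induct)
  case (refl i w)
  then show ?case using roots_lattice by (simp add: km_simple_refl_def reflection_lattice)
qed simp

lemma weyl_rootvec: "w \<in> Wk \<Longrightarrow> \<exists>k'. w (rootvec k) = rootvec k'"
  unfolding weyl_eq
proof (induction rule: refl_group_induct)
  case (refl i w)
  then show ?case using sr_rootvec by auto
qed auto

lemma weyl_neg: "w \<in> Wk \<Longrightarrow> w (wneg v) = wneg (w v)"
  by (simp add: int_linear_neg weyl_linear)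


subsection \<open>Real roots are positive or negative\<close>

definition nonneg_roots :: "weight set" where
  "nonneg_roots = {rootvec k | k. \<forall>i<n. 0 \<le> k i}"

lemma nonneg_rootsI: "(\<And>i. i < n \<Longrightarrow> 0 \<le> k i) \<Longrightarrow> rootvec k \<in> nonneg_roots"
  by (auto simp: nonneg_roots_def)

lemma nonneg_roots_comb:
  assumes "u \<in> nonneg_roots" "v \<in> nonneg_roots" "0 \<le> x" "0 \<le> y"
  shows "(\<lambda>j. x * u j + y * v j) \<in> nonneg_roots"
proof -
  obtain k k' where k: "u = rootvec k" "v = rootvec k'" "\<forall>i<n. 0 \<le> k i" "\<forall>i<n. 0 \<le> k' i"
    using assms(1,2) by (auto simp: nonneg_roots_def)
  have "(\<lambda>j. x * u j + y * v j) = rootvec (\<lambda>i. x * k i + y * k' i)"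
    by (simp add: k rootvec_def sum_distrib_left sum.distrib algebra_simps)
  then show ?thesis using k assms(3,4) by (auto intro!: nonneg_rootsI)
qed

lemma nonneg_span_eq: "nonneg_span (sroot ` {..<n}) = nonneg_roots"
proof
  show "nonneg_span (sroot ` {..<n}) \<subseteq> nonneg_roots"
  proof
    fix v assume "v \<in> nonneg_span (sroot ` {..<n})"
    then obtain c :: "weight \<Rightarrow> nat" where "v = (\<lambda>j. \<Sum>b\<in>sroot ` {..<n}. int (c b) * b j)"
      by (auto simp: nonneg_span_def)
    then have "v = rootvec (\<lambda>i. int (c (sroot i)))"
      by (simp add: rootvec_def sum.reindex[OF root_inj])
    then show "v \<in> nonneg_roots" by (auto intro: nonneg_rootsI)
  qed
  show "nonneg_roots \<subseteq> nonneg_span (sroot ` {..<n})"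
  proof
    fix v assume "v \<in> nonneg_roots"
    then obtain k where k: "v = rootvec k" "\<forall>i<n. 0 \<le> k i" by (auto simp: nonneg_roots_def)
    have "v = (\<lambda>j. \<Sum>b\<in>sroot ` {..<n}. int (nat (k (inv_into {..<n} sroot b))) * b j)"
      using k by (simp add: rootvec_def sum.reindex[OF root_inj] inv_into_f_f[OF root_inj])
    then show "v \<in> nonneg_span (sroot ` {..<n})" unfolding nonneg_span_def mem_Collect_eq
      by (rule exI[of _ "\<lambda>b. nat (k (inv_into {..<n} sroot b))"])
  qed
qed

text \<open>
  The coefficients, with respect to two simple roots \<open>\<alpha>\<^sub>i\<close> and \<open>\<alpha>\<^sub>j\<close>, of the root that arises from \<open>\<alpha>\<^sub>i\<close>
  when \<open>l\<close> reflections \<open>s\<^sub>j, s\<^sub>i, s\<^sub>j, \<dots>\<close> are applied in turn; \<open>a\<close> and \<open>b\<close> are \<open>-a\<^sub>i\<^sub>j\<close> and \<open>-a\<^sub>j\<^sub>i\<close>.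
\<close>

fun rank2_coeffs :: "int \<Rightarrow> int \<Rightarrow> nat \<Rightarrow> int \<times> int" where
  "rank2_coeffs a b 0 = (1, 0)"
| "rank2_coeffs a b (Suc l) = (case rank2_coeffs a b l of (x, y) \<Rightarrow>
     if even l then (x, b * x - y) else (a * y - x, y))"

lemma alternating_root:
  assumes ij: "i < n" "j < n" "i \<noteq> j" and xy: "rank2_coeffs (- A i j) (- A j i) l = (x, y)"
  shows "word_prod sr (rev (alternating j i l)) (sroot i) = (\<lambda>v. x * sroot i v + y * sroot j v)"
  using xy
proof (induction l arbitrary: x y)
  case (Suc l)
  obtain x' y' where xy': "rank2_coeffs (- A i j) (- A j i) l = (x', y')" by force
  note IH = Suc.IH[OF this]
  have "word_prod sr (rev (alternating j i (Suc l))) (sroot i) =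
      sr (if even l then j else i) (\<lambda>v. x' * sroot i v + y' * sroot j v)"
    by (simp only: alternating_snoc rev_append rev.simps append.simps word_prod_Cons comp_apply IH)
  also have "\<dots> = (\<lambda>v. x * sroot i v + y * sroot j v)"
  proof (cases "even l")
    case True
    then have x: "x' = x" and y: "y = - A j i * x - y'" using Suc.prems by (auto simp: xy')
    show ?thesis
      unfolding x y using True ij by (simp add: sr_eq pairing_comb pairing_A cartan algebra_simps)
  next
    case False
    then have y: "y' = y" and x: "x = - A i j * y - x'" using Suc.prems by (auto simp: xy')
    show ?thesis
      unfolding x y using False ij by (simp add: sr_eq pairing_comb pairing_A cartan algebra_simps)
  qed
  finally show ?case .
qed simp

text \<open>
  Nonnegativity alone does not propagate. The bound on the quotient of the two coefficients
  does, and it reproduces itself when \<open>a b \<ge> 4\<close>.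
\<close>

lemma rank2_coeffs_infinite:
  assumes "0 \<le> a" "0 \<le> b" "4 \<le> a * b" "rank2_coeffs a b l = (x, y)"
  shows "0 \<le> x \<and> 0 \<le> y \<and> (if even l then a * y \<le> 2 * x else b * x \<le> 2 * y)"
  using assms(4)
proof (induction l arbitrary: x y)
  case (Suc l)
  obtain x' y' where xy': "rank2_coeffs a b l = (x', y')" by force
  note IH = Suc.IH[OF this]
  show ?case
  proof (cases "even l")
    case True
    then have xy: "x = x'" "y = b * x' - y'" using Suc.prems xy' by auto
    have "b * (a * y') \<le> b * (2 * x')" using IH True assms by (intro mult_left_mono) auto
    moreover have "4 * y' \<le> a * b * y'" using IH assms by (intro mult_right_mono) auto
    ultimately have "2 * y' \<le> b * x'" by (simp add: mult_ac)
    then show ?thesis using True xy IH by (auto simp: algebra_simps)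
  next
    case False
    then have xy: "x = a * y' - x'" "y = y'" using Suc.prems xy' by auto
    have "a * (b * x') \<le> a * (2 * y')" using IH False assms by (intro mult_left_mono) auto
    moreover have "4 * x' \<le> a * b * x'" using IH assms by (intro mult_right_mono) auto
    ultimately have "2 * x' \<le> a * y'" by (simp add: mult_ac)
    then show ?thesis using False xy IH by (auto simp: algebra_simps)
  qed
qed auto

text \<open>
  The Cartan integers of the types \<open>A\<^sub>1 \<times> A\<^sub>1\<close>, \<open>A\<^sub>2\<close>, \<open>B\<^sub>2\<close> and \<open>G\<^sub>2\<close>, with the order \<open>m\<close> of the product of the
  two simple reflections.
\<close>

definition rank2_type :: "int \<Rightarrow> int \<Rightarrow> nat \<Rightarrow> bool" where
  "rank2_type a b m \<longleftrightarrow> (a, b, m) \<in> {(0, 0, 2), (1, 1, 3), (1, 2, 4), (2, 1, 4), (1, 3, 6), (3, 1, 6)}"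

lemma rank2_coeffs_finite:
  assumes "rank2_type a b m" "l < m" "rank2_coeffs a b l = (x, y)"
  shows "0 \<le> x \<and> 0 \<le> y"
proof -
  have "l \<in> {0, Suc 0, Suc (Suc 0), Suc (Suc (Suc 0)), Suc (Suc (Suc (Suc 0))),
      Suc (Suc (Suc (Suc (Suc 0))))}"
    using assms(1,2) by (auto simp: rank2_type_def)
  then show ?thesis
    using assms by (auto simp: rank2_type_def)
qed

text \<open>
  Both words move \<open>v\<close> within the plane through \<open>v\<close> that is spanned by the two roots, where each
  reflection is an affine map with coefficients \<open>p\<close>, \<open>q\<close> and Cartan integers.
\<close>

lemma braid_relation:
  assumes ij: "i < n" "j < n" "i \<noteq> j" and type: "rank2_type (- A i j) (- A j i) m"
  shows "word_prod sr (rev (alternating i j m)) = word_prod sr (rev (alternating j i m))"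
proof (rule ext)
  fix v
  define t where "t x y = (\<lambda>k. v k - x * sroot i k - y * sroot j k)" for x y
  define p q where "p = pairing N (scoroot i) v" and "q = pairing N (scoroot j) v"
  have pair: "pairing N c (t x y) = pairing N c v - x * pairing N c (sroot i) - y * pairing N c (sroot j)"
    for c x y
    using pairing_diff[of N c "\<lambda>k. v k - x * sroot i k" y "sroot j"]
    by (simp add: t_def pairing_diff)
  have i: "sr i (t x y) = t (p - x + (- A i j) * y) y" for x y
    unfolding sr_eq pair using ij by (simp add: t_def pairing_A cartan p_def algebra_simps)
  have j: "sr j (t x y) = t x (q - y + (- A j i) * x)" for x y
    unfolding sr_eq pair using ij by (simp add: t_def pairing_A cartan q_def algebra_simps)
  have v: "v = t 0 0" by (simp add: t_def)
  show "word_prod sr (rev (alternating i j m)) v = word_prod sr (rev (alternating j i m)) v"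
    using type unfolding rank2_type_def
    by (auto simp: numeral_eq_Suc word_prod_append v i j algebra_simps)
qed

lemma rank2_type_if_small:
  assumes "0 \<le> a" "0 \<le> b" "a = 0 \<longleftrightarrow> b = 0" "a * b < 4"
  shows "\<exists>m. rank2_type a b m"
proof (cases "a = 0")
  case True
  then show ?thesis using assms by (intro exI[of _ 2]) (simp add: rank2_type_def)
next
  case False
  then have pos: "1 \<le> a" "1 \<le> b" using assms by linarith+
  have "a * 1 \<le> a * b" "1 * b \<le> a * b" using pos by (intro mult_mono; simp)+
  then have "a = 1 \<or> a = 2 \<or> a = 3" "b = 1 \<or> b = 2 \<or> b = 3" using assms(4) pos by linarith+
  then have "rank2_type a b 3 \<or> rank2_type a b 4 \<or> rank2_type a b 6"
    using assms(4) by (elim disjE) (simp_all add: rank2_type_def)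
  then show ?thesis by blast
qed

lemma rank2_type_exists:
  assumes "i < n" "j < n" "i \<noteq> j" "- A i j * - A j i < 4"
  shows "\<exists>m. rank2_type (- A i j) (- A j i) m"
proof (rule rank2_type_if_small)
  show "0 \<le> - A i j" "0 \<le> - A j i" using assms cartan(2) by simp_all
  show "- A i j = 0 \<longleftrightarrow> - A j i = 0" using assms cartan(3) by (metis neg_equal_0_iff_equal)
qed (rule assms(4))

definition min_word :: "nat list \<Rightarrow> bool" where
  "min_word is \<longleftrightarrow> set is \<subseteq> {..<n} \<and>
    (\<forall>js. set js \<subseteq> {..<n} \<longrightarrow> word_prod sr js = word_prod sr is \<longrightarrow> length is \<le> length js)"

lemma min_word_exists:
  assumes "w \<in> Wk"
  shows "\<exists>is. min_word is \<and> word_prod sr is = w"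
proof -
  have "\<exists>is. set is \<subseteq> {..<n} \<and> word_prod sr is = w"
    using assms by (auto simp: weyl_eq refl_group_def)
  then obtain "is" where "set is \<subseteq> {..<n} \<and> word_prod sr is = w"
    "\<forall>js. set js \<subseteq> {..<n} \<and> word_prod sr js = w \<longrightarrow> length is \<le> length js"
    using ex_has_least_nat[of "\<lambda>is. set is \<subseteq> {..<n} \<and> word_prod sr is = w" _ length] by metis
  then show ?thesis by (intro exI[of _ "is"]) (auto simp: min_word_def)
qed

lemma word_cancel:
  assumes "k < n"
  shows "word_prod sr (xs @ [k, k] @ ys) = word_prod sr (xs @ ys)"
proof -
  have "word_prod sr (xs @ [k, k] @ ys) = word_prod sr xs \<circ> ((sr k \<circ> sr k) \<circ> word_prod sr ys)"
    by (simp only: word_prod_append word_prod_Cons word_prod_Nil append.simps comp_assoc)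
  then show ?thesis by (simp only: sr_sr[OF assms] id_comp word_prod_append)
qed

text \<open>
  A minimal word with last letter \<open>j\<close> is split as \<open>bs @ cs\<close> where \<open>cs\<close> is a word in \<open>s\<^sub>i\<close> and \<open>s\<^sub>j\<close>,
  as long as possible. By induction \<open>bs\<close> maps both simple roots to nonnegative
  combinations, and \<open>cs\<close> is an alternating word, too short to make a root of rank two negative.
\<close>

lemma ascent_nonneg:
  assumes "min_word is" "i < n"
    and "\<And>js. set js \<subseteq> {..<n} \<Longrightarrow> word_prod sr js = word_prod sr is \<circ> sr i \<Longrightarrow> length is \<le> length js"
  shows "word_prod sr is (sroot i) \<in> nonneg_roots"
  using assms
proof (induction "length is" arbitrary: "is" i rule: less_induct)
  case less
  note min = less.prems(1) and i = less.prems(2) and asc = less.prems(3)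
  have minD: "set is \<subseteq> {..<n}"
    "\<And>js. set js \<subseteq> {..<n} \<Longrightarrow> word_prod sr js = word_prod sr is \<Longrightarrow> length is \<le> length js"
    using min by (auto simp: min_word_def)
  show ?case
  proof (cases "is" rule: rev_cases)
    case Nil
    have "sroot i \<in> nonneg_roots" unfolding root_rootvec[OF i] by (rule nonneg_rootsI) auto
    then show ?thesis by (simp add: Nil)
  next
    case (snoc bs0 j)
    have j: "j < n" and bs0: "set bs0 \<subseteq> {..<n}" using minD(1) snoc by auto
    have wj: "word_prod sr is = word_prod sr bs0 \<circ> sr j"
      by (simp only: snoc word_prod_append word_prod_Cons word_prod_Nil comp_id)
    have ij: "i \<noteq> j"
    proof
      assume "i = j"
      then have "word_prod sr bs0 = word_prod sr is \<circ> sr i"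
        unfolding wj comp_assoc using sr_sr[OF j] by (simp only: comp_id)
      then show False using asc[OF bs0] snoc by simp
    qed
    \<comment> \<open>Decompositions of a minimal word, of which one with the shortest \<open>bs\<close> is chosen.\<close>
    let ?Q = "\<lambda>(bs, cs). set bs \<subseteq> {..<n} \<and> set cs \<subseteq> {i, j} \<and> word_prod sr (bs @ cs) = word_prod sr is \<and>
      length bs + length cs = length is"
    have "?Q (bs0, [j])" using bs0 snoc by simp
    then obtain p where p: "?Q p" "\<And>q. ?Q q \<Longrightarrow> length (fst p) \<le> length (fst q)"
      using ex_has_least_nat[of ?Q "(bs0, [j])" "\<lambda>p. length (fst p)"] by blast
    obtain bs cs where bc: "p = (bs, cs)" by force
    have Q: "?Q (bs, cs)" using p(1) unfolding bc .
    have least: "length bs \<le> length bs'" if "?Q (bs', cs')" for bs' cs'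
      using p(2)[OF that] by (simp add: bc)
    have bs: "set bs \<subseteq> {..<n}" and cs: "set cs \<subseteq> {i, j}" "set cs \<subseteq> {..<n}"
      and w: "word_prod sr is = word_prod sr bs \<circ> word_prod sr cs"
      and len: "length bs + length cs = length is"
      using Q i j by (auto simp: word_prod_append)
    have "length bs \<le> length bs0" using least[of bs0 "[j]"] bs0 snoc by simp
    then have shorter: "length bs < length is" using snoc by simp
    have min_bs: "min_word bs"
      unfolding min_word_def
    proof (intro conjI bs allI impI)
      fix js assume "set js \<subseteq> {..<n}" "word_prod sr js = word_prod sr bs"
      then have "length is \<le> length (js @ cs)"
        using cs by (intro minD) (auto simp: word_prod_append w)
      then show "length bs \<le> length js" using len by simp
    qed
    have asc_bs: "length bs \<le> length js"
      if k: "k \<in> {i, j}" and js: "set js \<subseteq> {..<n}" "word_prod sr js = word_prod sr bs \<circ> sr k" for k js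
    proof (rule ccontr)
      assume "\<not> length bs \<le> length js"
      have kn: "k < n" using k i j by auto
      have eq: "word_prod sr (js @ k # cs) = word_prod sr is"
      proof -
        have "word_prod sr (js @ k # cs) = word_prod sr bs \<circ> ((sr k \<circ> sr k) \<circ> word_prod sr cs)"
          by (simp only: word_prod_append word_prod_Cons js comp_assoc)
        then show ?thesis by (simp only: sr_sr[OF kn] id_comp w)
      qed
      then have "length is \<le> length (js @ k # cs)"
        using js cs kn by (intro minD) auto
      then have "length js + length (k # cs) = length is"
        using \<open>\<not> length bs \<le> length js\<close> len by simp
      then have "?Q (js, k # cs)" using js k cs eq by simp
      then have "length bs \<le> length js" by (rule least)
      then show False using \<open>\<not> length bs \<le> length js\<close> by simp
    qed
    have pos: "word_prod sr bs (sroot i) \<in> nonneg_roots" "word_prod sr bs (sroot j) \<in> nonneg_roots"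
      using less.hyps[OF shorter min_bs i] less.hyps[OF shorter min_bs j] asc_bs by blast+
    have no_i: "False" if "word_prod sr cs = word_prod sr xs \<circ> sr i" "set xs \<subseteq> {..<n}"
      "length xs < length cs" for xs
    proof -
      have "word_prod sr (bs @ xs) = word_prod sr bs \<circ> (word_prod sr xs \<circ> (sr i \<circ> sr i))"
        by (simp only: word_prod_append sr_sr[OF i] comp_id)
      also have "\<dots> = word_prod sr is \<circ> sr i" by (simp only: w that(1) comp_assoc)
      finally have "length is \<le> length (bs @ xs)" using that bs by (intro asc) auto
      then show False using that len by simp
    qed
    have alt: "rev cs = alternating j i (length cs)"
    proof -
      have "rev cs = alternating j i (length (rev cs))"
      proof (rule alternatingI)
        show "set (rev cs) \<subseteq> {j, i}" using cs by auto
        show "hd (rev cs) = j" if "rev cs \<noteq> []"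
        proof (rule ccontr)
          assume "hd (rev cs) \<noteq> j"
          moreover have "cs \<noteq> []" using that by simp
          moreover from this have "last cs \<in> {i, j}" using cs(1) last_in_set by blast
          ultimately have "last cs = i" "cs \<noteq> []" by (auto simp: hd_rev)
          then obtain xs where xs: "cs = xs @ [i]" by (metis append_butlast_last_id)
          show False
            by (rule no_i[of xs])
              (use cs xs in \<open>auto simp only: word_prod_append word_prod_Cons word_prod_Nil comp_id
                 set_append length_append list.size\<close>)
        qed
        show "rev cs \<noteq> xs @ [c, c] @ ys" for xs c ys
        proof
          assume "rev cs = xs @ [c, c] @ ys"
          then have "cs = rev ys @ [c, c] @ rev xs"
            by (metis append_assoc rev.simps rev_append rev_rev_ident append_Cons append_Nil)
          then have c: "c < n" and bc: "bs @ cs = (bs @ rev ys) @ [c, c] @ rev xs"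
            and sub: "set ((bs @ rev ys) @ rev xs) \<subseteq> {..<n}"
            and l: "length cs = Suc (Suc (length xs + length ys))"
            using cs bs by auto
          have "word_prod sr ((bs @ rev ys) @ rev xs) = word_prod sr is"
            using word_cancel[OF c, of "bs @ rev ys" "rev xs"] by (simp only: bc[symmetric] word_prod_append w)
          then have "length is \<le> length ((bs @ rev ys) @ rev xs)" using sub by (intro minD)
          then show False using len l by simp
        qed
      qed
      then show ?thesis by simp
    qed
    then have cs_eq: "cs = rev (alternating j i (length cs))" by (metis rev_rev_ident)
    obtain x y where xy: "rank2_coeffs (- A i j) (- A j i) (length cs) = (x, y)" by force
    have "0 \<le> x \<and> 0 \<le> y"
    proof (cases "- A i j * - A j i < 4")
      case False
      then show ?thesis
        using rank2_coeffs_infinite[OF _ _ _ xy] cartan(2)[OF i j ij] cartan(2)[OF j i] ij by simp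
    next
      case True
      then obtain m where m: "rank2_type (- A i j) (- A j i) m" using rank2_type_exists i j ij by blast
      have "length cs < m"
      proof (rule ccontr)
        assume "\<not> length cs < m"
        then obtain k where k: "length cs = m + k" using le_Suc_ex not_less by blast
        obtain xs where xs: "alternating j i (m + k) = alternating j i m @ xs" "set xs \<subseteq> {j, i}"
          using alternating_add by metis
        obtain m' where m': "m = Suc m'" using m by (auto simp: rank2_type_def numeral_eq_Suc)
        let ?ys = "rev xs @ rev (alternating j i m')"
        have "cs = rev xs @ rev (alternating j i m)" using cs_eq by (simp add: k xs)
        then have "word_prod sr cs = word_prod sr (rev xs) \<circ> word_prod sr (rev (alternating i j m))"
          using braid_relation[OF i j ij m] by (simp only: word_prod_append)
        also have "rev (alternating i j m) = rev (alternating j i m') @ [i]" by (simp add: m')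
        finally have "word_prod sr cs = word_prod sr ?ys \<circ> sr i"
          by (simp only: word_prod_append word_prod_Cons word_prod_Nil comp_id comp_assoc)
        moreover have "set ?ys \<subseteq> {..<n}" using xs(2) set_alternating[of j i m'] i j by auto
        moreover have "length ?ys < length cs"
          using arg_cong[OF xs(1), of length] k m' by simp
        ultimately show False by (rule no_i)
      qed
      then show ?thesis using rank2_coeffs_finite[OF m _ xy] by simp
    qed
    moreover have "word_prod sr is (sroot i) =
        (\<lambda>v. x * word_prod sr bs (sroot i) v + y * word_prod sr bs (sroot j) v)"
    proof -
      have "word_prod sr cs (sroot i) = (\<lambda>v. x * sroot i v + y * sroot j v)"
        using alternating_root[OF i j ij xy] cs_eq by simp
      moreover have "int_linear (word_prod sr bs)"
        using bs by (intro weyl_linear) (auto simp: weyl_eq refl_group_def)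
      ultimately show ?thesis by (simp only: w comp_apply int_linearD)
    qed
    ultimately show ?thesis using nonneg_roots_comb[OF pos] by simp
  qed
qed

text \<open>
  One of \<open>w\<close> and \<open>w s\<^sub>i\<close> is not shortened by \<open>s\<^sub>i\<close>, and they map \<open>\<alpha>\<^sub>i\<close> to opposite roots.
\<close>

lemma sign_coherent:
  assumes "w \<in> Wk" "i < n"
  shows "w (sroot i) \<in> nonneg_roots \<or> wneg (w (sroot i)) \<in> nonneg_roots"
proof -
  obtain "is" where "is": "min_word is" "word_prod sr is = w" using min_word_exists[OF assms(1)] by blast
  obtain js where js: "min_word js" "word_prod sr js = w \<circ> sr i"
    using min_word_exists[OF weyl_comp[OF assms(1) sr_weyl[OF assms(2)]]] by blast
  show ?thesis
  proof (cases "length is \<le> length js")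
    case True
    have "w (sroot i) \<in> nonneg_roots"
      unfolding "is"(2)[symmetric] using "is"(1) assms(2)
    proof (rule ascent_nonneg)
      fix ks assume ks: "set ks \<subseteq> {..<n}" "word_prod sr ks = word_prod sr is \<circ> sr i"
      then have "length js \<le> length ks" using js "is"(2) by (simp add: min_word_def)
      then show "length is \<le> length ks" using True by simp
    qed
    then show ?thesis by simp
  next
    case False
    have "word_prod sr js (sroot i) \<in> nonneg_roots"
      using js(1) assms(2)
    proof (rule ascent_nonneg)
      fix ks assume ks: "set ks \<subseteq> {..<n}" "word_prod sr ks = word_prod sr js \<circ> sr i"
      then have "word_prod sr ks = word_prod sr is"
        using sr_sr[OF assms(2)] by (simp only: js(2) "is"(2) comp_assoc comp_id)
      then have "length is \<le> length ks" using "is"(1) ks(1) by (simp add: min_word_def)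
      then show "length js \<le> length ks" using False by simp
    qed
    then show ?thesis
      using assms by (simp add: js sr_root weyl_neg)
  qed
qed


abbreviation "\<Phi>k \<equiv> km_real_roots K"

lemma real_rootE:
  assumes "\<alpha> \<in> \<Phi>k"
  obtains w i where "w \<in> Wk" "i < n" "\<alpha> = w (sroot i)"
  using assms by (auto simp: km_real_roots_def)

lemma real_rootI: "w \<in> Wk \<Longrightarrow> i < n \<Longrightarrow> w (sroot i) \<in> \<Phi>k"
  by (auto simp: km_real_roots_def)

lemma real_root_weyl: "u \<in> Wk \<Longrightarrow> \<alpha> \<in> \<Phi>k \<Longrightarrow> u \<alpha> \<in> \<Phi>k"
proof (elim real_rootE)
  fix w i assume "u \<in> Wk" "w \<in> Wk" "i < n" "\<alpha> = w (sroot i)"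
  then show "u \<alpha> \<in> \<Phi>k" using real_rootI[OF weyl_comp, of u w i] by simp
qed

lemma real_root_neg: "\<alpha> \<in> \<Phi>k \<Longrightarrow> wneg \<alpha> \<in> \<Phi>k"
proof (elim real_rootE)
  fix w i assume "w \<in> Wk" "i < n" "\<alpha> = w (sroot i)"
  then show "wneg \<alpha> \<in> \<Phi>k"
    using real_rootI[OF weyl_comp[OF _ sr_weyl], of w i i] by (simp add: sr_root weyl_neg)
qed

lemma real_root_rootvec:
  assumes "\<alpha> \<in> \<Phi>k"
  obtains k where "\<alpha> = rootvec k"
proof -
  obtain w i where "w \<in> Wk" "i < n" "\<alpha> = w (sroot i)" using assms by (rule real_rootE)
  then show ?thesis using weyl_rootvec[of w] that root_rootvec[of i] by metis
qed

lemma sroot_nonzero: "i < n \<Longrightarrow> sroot i \<noteq> (\<lambda>_. 0)"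
proof
  assume "i < n" "sroot i = (\<lambda>_. 0)"
  then show False using pairing_A[of i i] cartan(1)[of i] by (simp add: pairing_def)
qed

lemma weyl_inv_apply: "w \<in> Wk \<Longrightarrow> inv w (w v) = v" "w \<in> Wk \<Longrightarrow> w (inv w v) = v"
  by (simp_all add: weyl_bij bij_is_inj bij_is_surj surj_f_inv_f)

lemma real_root_nonzero: "\<alpha> \<in> \<Phi>k \<Longrightarrow> \<alpha> \<noteq> (\<lambda>_. 0)"
proof (elim real_rootE)
  fix w i assume *: "w \<in> Wk" "i < n" "\<alpha> = w (sroot i)"
  show "\<alpha> \<noteq> (\<lambda>_. 0)"
  proof
    assume "\<alpha> = (\<lambda>_. 0)"
    then have "sroot i = (\<lambda>_. 0)"
      using * weyl_inv_apply(1)[of w "sroot i"] int_linear_0[OF weyl_linear[OF weyl_inv[OF *(1)]]] by simp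
    then show False using sroot_nonzero * by blast
  qed
qed

lemma real_root_sign: "\<alpha> \<in> \<Phi>k \<Longrightarrow> \<alpha> \<in> nonneg_roots \<or> wneg \<alpha> \<in> nonneg_roots"
  by (elim real_rootE) (simp add: sign_coherent)

lemma nonneg_roots_antisym:
  assumes "v \<in> nonneg_roots" "wneg v \<in> nonneg_roots"
  shows "v = (\<lambda>_. 0)"
proof -
  obtain k k' where k: "v = rootvec k" "\<forall>i<n. 0 \<le> k i" "wneg v = rootvec k'" "\<forall>i<n. 0 \<le> k' i"
    using assms by (auto simp: nonneg_roots_def)
  then have "\<forall>i<n. - k i = k' i" by (simp add: wneg_rootvec rootvec_eq_iff)
  then have "\<forall>i<n. k i = 0" using k by (metis add.inverse_inverse le_minus_one_simps(3) neg_0_le_iff_le order_antisym)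
  then show ?thesis by (simp add: k rootvec_def)
qed

text \<open>Roots are primitive in the root lattice, because simple roots are.\<close>

lemma real_roots_multiple:
  assumes "\<alpha> \<in> \<Phi>k" "\<beta> \<in> \<Phi>k" "\<And>j. a * \<alpha> j = b * \<beta> j" "b \<noteq> 0"
  shows "\<exists>c. \<beta> = (\<lambda>j. c * \<alpha> j)"
proof -
  obtain w i where w: "w \<in> Wk" "i < n" "\<alpha> = w (sroot i)" using assms(1) by (rule real_rootE)
  have iw: "inv w \<in> Wk" "int_linear (inv w)" using w weyl_inv weyl_linear by auto
  obtain k where k: "inv w \<beta> = rootvec k"
    using real_root_weyl[OF iw(1) assms(2)] by (rule real_root_rootvec)
  have "(\<lambda>j. a * sroot i j) = (\<lambda>j. b * rootvec k j)"
    using assms(3) int_linear_scale[OF iw(2), of a \<alpha>] int_linear_scale[OF iw(2), of b \<beta>]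
    by (simp add: w weyl_inv_apply flip: k)
  then have "rootvec (\<lambda>l. if l = i then a else 0) = rootvec (\<lambda>l. b * k l)"
    unfolding rootvec_unit[OF w(2)] by (simp add: rootvec_def sum_distrib_left mult.assoc)
  then have "\<forall>l<n. (if l = i then a else 0) = b * k l" by (simp only: rootvec_eq_iff)
  then have "\<forall>l<n. k l = (if l = i then k i else 0)" using assms(4) by (metis mult_eq_0_iff)
  then have "rootvec k = rootvec (\<lambda>l. if l = i then k i else 0)" by (simp only: rootvec_eq_iff)
  then have "inv w \<beta> = (\<lambda>j. k i * sroot i j)" by (simp only: k rootvec_unit[OF w(2)])
  then have "w (inv w \<beta>) = (\<lambda>j. k i * \<alpha> j)"
    using int_linear_scale[OF weyl_linear[OF w(1)]] by (simp add: w(3))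
  then show ?thesis using weyl_inv_apply(2)[OF w(1)] by metis
qed

lemma real_roots_proportional:
  assumes "\<alpha> \<in> \<Phi>k" "\<beta> \<in> \<Phi>k" "a \<noteq> 0" "\<And>j. a * \<alpha> j = b * \<beta> j"
  shows "\<beta> = \<alpha> \<or> \<beta> = wneg \<alpha>"
proof -
  obtain j where j: "\<alpha> j \<noteq> 0" using real_root_nonzero[OF assms(1)] by auto
  then have "b \<noteq> 0" using assms(3) assms(4)[of j] by auto
  then obtain c where c: "\<beta> = (\<lambda>j. c * \<alpha> j)" using real_roots_multiple[OF assms(1,2,4)] by blast
  obtain d where d: "\<alpha> = (\<lambda>j. d * \<beta> j)"
    using real_roots_multiple[OF assms(2,1) assms(4)[symmetric] assms(3)] by blast
  have "\<alpha> j = d * (c * \<alpha> j)" using c d by metis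
  then have "c * d = 1" using j by (simp add: mult_ac)
  then have "c = 1 \<or> c = - 1" by (auto simp: zmult_eq_1_iff)
  then show ?thesis using c by (auto simp: wneg_def)
qed


subsection \<open>The reflection in a real root\<close>

lemma corootvec_sr:
  assumes "l < n"
  shows "pairing N (corootvec k) (sr l v) =
    pairing N (corootvec (k(l := k l - (\<Sum>i<n. k i * A i l)))) v"
proof -
  let ?c = "\<Sum>i<n. k i * A i l"
  have left: "pairing N (corootvec k) v = (\<Sum>i<n. k i * pairing N (scoroot i) v)" for k v
    by (simp add: corootvec_def pairing_sum_left)
  have "pairing N (corootvec k) (sroot l) = ?c"
    using assms by (simp add: left pairing_A)
  then have "pairing N (corootvec k) (sr l v) = pairing N (corootvec k) v - pairing N (scoroot l) v * ?c"
    unfolding sr_eq pairing_diff by simp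
  also have "\<dots> = (\<Sum>i<n. (k i - (if i = l then ?c else 0)) * pairing N (scoroot i) v)"
    using assms by (simp add: left left_diff_distrib sum_subtractf if_distrib[of "\<lambda>x. x * _"] sum.delta
        cong: if_cong)
  also have "\<dots> = pairing N (corootvec (k(l := k l - ?c))) v"
    by (auto simp: left intro!: sum.cong)
  finally show ?thesis .
qed

text \<open>
  Symmetrizability yields a \<open>\<W>\<close>-equivariant rescaling of the coroot lattice into the root lattice over
  the rationals. The coroot that belongs to \<open>w \<alpha>\<^sub>i\<close> is therefore a multiple of the rescaled
  root, and it is normalized by its value 2 on the root; hence it does not depend on \<open>w\<close> and \<open>i\<close>.
\<close>

lemma conjugate_reflection:
  assumes d: "\<And>i j. i < n \<Longrightarrow> j < n \<Longrightarrow> d i * of_int (A i j) = d j * (of_int (A j i) :: rat)"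
    "\<And>i. i < n \<Longrightarrow> d i > 0"
    and w: "w \<in> Wk" and i: "i < n"
  shows "\<exists>k k'. w (sroot i) = rootvec k \<and> pairing N (corootvec k') (rootvec k) = 2 \<and>
    w \<circ> sr i \<circ> inv w = reflection N (corootvec k') (rootvec k) \<and>
    (\<forall>l<n. d i * of_int (k' l) = d l * of_int (k l))"
  using w unfolding weyl_eq
proof (induction rule: refl_group_induct)
  case id
  let ?e = "\<lambda>l. if l = i then 1 else (0::int)"
  have c: "corootvec ?e = scoroot i"
    using i by (simp add: corootvec_def if_distrib[of "\<lambda>x. x * _"] sum.delta cong: if_cong)
  show ?case
    by (intro exI[of _ ?e] conjI)
      (simp_all add: c pairing_A cartan i km_simple_refl_def flip: root_rootvec[OF i])
next
  case (refl l w)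
  then obtain k k' where IH: "w (sroot i) = rootvec k" "pairing N (corootvec k') (rootvec k) = 2"
    "w \<circ> sr i \<circ> inv w = reflection N (corootvec k') (rootvec k)"
    "\<forall>l<n. d i * of_int (k' l) = d l * of_int (k l)" by blast
  have l: "l < n" and w: "w \<in> Wk" using refl by (auto simp: weyl_eq)
  let ?c = "\<Sum>i<n. A l i * k i" and ?c' = "\<Sum>i<n. k' i * A i l"
  let ?k = "k(l := k l - ?c)" and ?k' = "k'(l := k' l - ?c')"
  have inv: "inv (sr l \<circ> w) = inv w \<circ> sr l"
    using o_inv_distrib[OF weyl_bij[OF sr_weyl[OF l]] weyl_bij[OF w]] inv_unique_comp[OF sr_sr[OF l] sr_sr[OF l]]
    by simp
  have "(sr l \<circ> w) \<circ> sr i \<circ> inv (sr l \<circ> w) = sr l \<circ> (w \<circ> sr i \<circ> inv w) \<circ> sr l"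
    unfolding inv by (simp only: comp_assoc)
  also have "\<dots> = reflection N (corootvec ?k') (rootvec ?k)"
  proof
    fix v
    have "sr l (\<lambda>j. sr l v j - pairing N (corootvec k') (sr l v) * rootvec k j) =
        (\<lambda>j. sr l (sr l v) j - pairing N (corootvec k') (sr l v) * sr l (rootvec k) j)"
      by (rule int_linear_diff[OF sr_linear])
    then show "(sr l \<circ> (w \<circ> sr i \<circ> inv w) \<circ> sr l) v = reflection N (corootvec ?k') (rootvec ?k) v"
      unfolding IH(3) sr_rootvec[OF l] sr_sr_apply[OF l] corootvec_sr[OF l]
      by (simp add: reflection_def corootvec_sr[OF l])
  qed
  finally have conj: "(sr l \<circ> w) \<circ> sr i \<circ> inv (sr l \<circ> w) = reflection N (corootvec ?k') (rootvec ?k)" .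
  have "pairing N (corootvec ?k') (rootvec ?k) = pairing N (corootvec k') (sr l (rootvec ?k))"
    by (simp only: corootvec_sr[OF l])
  also have "\<dots> = 2"
    using sr_sr_apply[OF l, of "rootvec k"] IH(2) by (simp only: sr_rootvec[OF l])
  finally have two: "pairing N (corootvec ?k') (rootvec ?k) = 2" .
  have "d i * of_int ?c' = d l * of_int ?c"
  proof -
    have "d i * of_int ?c' = (\<Sum>j<n. (d i * of_int (k' j)) * of_int (A j l))"
      by (simp add: sum_distrib_left mult_ac)
    also have "\<dots> = (\<Sum>j<n. d l * of_int (A l j) * of_int (k j))"
    proof (rule sum.cong)
      fix j assume "j \<in> {..<n}"
      then have j: "j < n" by simp
      have "d i * of_int (k' j) * of_int (A j l) = (d j * of_int (A j l)) * of_int (k j)"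
        using IH(4) j by (simp add: mult_ac)
      then show "d i * of_int (k' j) * of_int (A j l) = d l * of_int (A l j) * of_int (k j)"
        by (simp only: d(1)[OF j l])
    qed simp
    also have "\<dots> = d l * of_int ?c" by (simp add: sum_distrib_left mult_ac)
    finally show ?thesis .
  qed
  then have "\<forall>j<n. d i * of_int (?k' j) = d j * of_int (?k j)"
    using IH(4) by (auto simp: algebra_simps)
  moreover have "(sr l \<circ> w) (sroot i) = rootvec ?k" by (simp add: IH(1) sr_rootvec[OF l])
  ultimately show ?case using conj two by blast
qed

lemma conjugate_reflection_unique:
  assumes "w \<in> Wk" "i < n" "w' \<in> Wk" "i' < n" "w (sroot i) = w' (sroot i')"
  shows "w \<circ> sr i \<circ> inv w = w' \<circ> sr i' \<circ> inv w'"
proof -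
  obtain d :: "nat \<Rightarrow> rat" where d:
    "\<And>i j. i < n \<Longrightarrow> j < n \<Longrightarrow> d i * of_int (A i j) = d j * of_int (A j i)" "\<And>i. i < n \<Longrightarrow> d i > 0"
    using datum unfolding km_root_datum_def symmetrizable_gcm_def by metis
  obtain k k' where k: "w (sroot i) = rootvec k" "pairing N (corootvec k') (rootvec k) = 2"
    "w \<circ> sr i \<circ> inv w = reflection N (corootvec k') (rootvec k)"
    "\<forall>l<n. d i * of_int (k' l) = d l * of_int (k l)"
    using conjugate_reflection[of d w i] d assms by blast
  obtain h h' where h: "w' (sroot i') = rootvec h" "pairing N (corootvec h') (rootvec h) = 2"
    "w' \<circ> sr i' \<circ> inv w' = reflection N (corootvec h') (rootvec h)"
    "\<forall>l<n. d i' * of_int (h' l) = d l * of_int (h l)"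
    using conjugate_reflection[of d w' i'] d assms by blast
  have kh: "rootvec k = rootvec h" using k(1) h(1) assms(5) by simp
  then have "\<forall>l<n. k l = h l" by (simp only: rootvec_eq_iff)
  then have eq: "d i * of_int (k' l) = d i' * of_int (h' l)" if "l < n" for l
    using k(4) h(4) that by simp
  have scaled: "e * of_int (pairing N (corootvec c) (rootvec k)) =
      (\<Sum>l<n. (e * of_int (c l)) * of_int (pairing N (scoroot l) (rootvec k)))" for e :: rat and c
    by (simp add: corootvec_def pairing_sum_left sum_distrib_left mult_ac)
  have "d i * of_int (pairing N (corootvec k') (rootvec k)) =
      d i' * of_int (pairing N (corootvec h') (rootvec k))"
    unfolding scaled using eq by (intro sum.cong) simp_all
  then have "d i = d i'" using k(2) h(2) kh by simp
  then have "\<forall>l<n. k' l = h' l" using eq d(2)[OF assms(4)] by auto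
  then have "corootvec k' = corootvec h'" by (simp add: corootvec_def)
  then show ?thesis using k(3) h(3) kh by simp
qed

lemma km_refl_eq:
  assumes "w \<in> Wk" "i < n"
  shows "km_refl K (w (sroot i)) = w \<circ> sr i \<circ> inv w"
  unfolding km_refl_def
proof (rule someI2[of _ "w \<circ> sr i \<circ> inv w"])
  show "\<exists>u\<in>Wk. \<exists>j<n. w (sroot i) = u (sroot j) \<and> w \<circ> sr i \<circ> inv w = u \<circ> sr j \<circ> inv u"
    using assms by blast
  fix s assume "\<exists>u\<in>Wk. \<exists>j<n. w (sroot i) = u (sroot j) \<and> s = u \<circ> sr j \<circ> inv u"
  then show "s = w \<circ> sr i \<circ> inv w" using conjugate_reflection_unique assms by metis
qed

lemma km_refl_conj:
  assumes "u \<in> Wk" "\<alpha> \<in> \<Phi>k" "\<beta> \<in> \<Phi>k" "u \<alpha> = \<beta> \<or> u \<alpha> = wneg \<beta>"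
  shows "km_refl K \<beta> \<circ> u = u \<circ> km_refl K \<alpha>"
proof -
  obtain w i where w: "w \<in> Wk" "i < n" "\<alpha> = w (sroot i)" using assms(2) by (rule real_rootE)
  have "km_refl K \<beta> = u \<circ> km_refl K \<alpha> \<circ> inv u"
    using assms(4)
  proof
    assume "u \<alpha> = \<beta>"
    then have \<beta>: "\<beta> = (u \<circ> w) (sroot i)" by (simp add: w)
    show ?thesis
      unfolding \<beta> km_refl_eq[OF weyl_comp[OF assms(1) w(1)] w(2)] w(3) km_refl_eq[OF w(1,2)]
      using o_inv_distrib[OF weyl_bij[OF assms(1)] weyl_bij[OF w(1)]] by (simp only: comp_assoc)
  next
    let ?v = "u \<circ> w \<circ> sr i"
    assume "u \<alpha> = wneg \<beta>"
    then have \<beta>: "\<beta> = ?v (sroot i)"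
      using w assms(1) by (metis comp_apply sr_root weyl_neg wneg_wneg)
    have uw: "u \<circ> w \<in> Wk" using assms(1) w(1) by (rule weyl_comp)
    have v: "?v \<in> Wk" using uw sr_weyl[OF w(2)] by (rule weyl_comp)
    have "inv ?v = sr i \<circ> (inv w \<circ> inv u)"
      using o_inv_distrib[OF weyl_bij[OF uw] weyl_bij[OF sr_weyl[OF w(2)]]]
        o_inv_distrib[OF weyl_bij[OF assms(1)] weyl_bij[OF w(1)]]
        inv_unique_comp[OF sr_sr[OF w(2)] sr_sr[OF w(2)]] by simp
    then have "?v \<circ> sr i \<circ> inv ?v = (u \<circ> w) \<circ> ((sr i \<circ> sr i) \<circ> (sr i \<circ> (inv w \<circ> inv u)))"
      by (simp only: comp_assoc)
    also have "\<dots> = u \<circ> (w \<circ> sr i \<circ> inv w) \<circ> inv u"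
      unfolding sr_sr[OF w(2)] by (simp only: id_comp comp_assoc)
    finally show ?thesis unfolding \<beta> km_refl_eq[OF v w(2)] w(3) km_refl_eq[OF w(1,2)] .
  qed
  then have "km_refl K \<beta> \<circ> u = u \<circ> km_refl K \<alpha> \<circ> (inv u \<circ> u)" by (simp only: comp_assoc)
  also have "inv u \<circ> u = id" using weyl_bij[OF assms(1)] by (simp add: bij_is_inj)
  finally show ?thesis by (simp only: comp_id)
qed

lemma km_refl_simple: "i < n \<Longrightarrow> km_refl K (sroot i) = sr i"
  using km_refl_eq[OF weyl_id, of i] by (simp add: inv_id)

lemma setting_simps:
  "rank (km_setting K) = N" "imag_roots (km_setting K) = {}" "weyl_group (km_setting K) = Wk"
  "Omega (km_setting K) = {id}" "simple (km_setting K) = sroot ` {..<n}"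
  "pos_re (km_setting K) = \<Phi>k \<inter> nonneg_roots" "refl (km_setting K) = km_refl K"
  by (simp_all add: km_setting_def nonneg_span_eq)

lemma simple_positive: "i < n \<Longrightarrow> sroot i \<in> \<Phi>k \<inter> nonneg_roots"
  using real_rootI[OF weyl_id, of i] nonneg_rootsI[of "\<lambda>l. if l = i then 1 else 0"]
  by (simp add: root_rootvec)

lemma km_reflection_setting: "reflection_setting (km_setting K)"
proof (unfold_locales, unfold setting_simps)
  let ?P = "\<Phi>k \<inter> nonneg_roots"
  show "id \<in> Wk" by (rule weyl_id)
  show "u \<circ> w \<in> Wk" if "u \<in> Wk" "w \<in> Wk" for u w using that by (rule weyl_comp)
  show "inv w \<in> Wk" if "w \<in> Wk" for w using that by (rule weyl_inv)
  show "bij w" if "w \<in> Wk" for w using that by (rule weyl_bij)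
  show "int_linear w" if "w \<in> Wk" for w using that by (rule weyl_linear)
  show "w v \<in> lattice N" if "w \<in> Wk" "v \<in> lattice N" for w v using that by (rule weyl_lattice)
  show "\<alpha> \<in> lattice N" if "\<alpha> \<in> ?P" for \<alpha>
    using that rootvec_lattice by (auto simp: nonneg_roots_def)
  show neg: "wneg \<alpha> \<notin> ?P" if "\<alpha> \<in> ?P" for \<alpha>
    using that nonneg_roots_antisym real_root_nonzero by blast
  show proportional: "\<alpha> = \<beta>" if "\<alpha> \<in> ?P" "\<beta> \<in> ?P" "a \<noteq> 0" "\<And>j. a * \<alpha> j = b * \<beta> j" for \<alpha> \<beta> a b
    using real_roots_proportional[of \<alpha> \<beta> a b] neg[of \<alpha>] that by auto
  show pm: "w \<alpha> \<in> ?P \<or> wneg (w \<alpha>) \<in> ?P" if "w \<in> Wk" "\<alpha> \<in> ?P" for w \<alpha>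
    using that real_root_weyl real_root_neg real_root_sign by blast
  show "km_refl K \<alpha> \<in> Wk" if "\<alpha> \<in> ?P" for \<alpha>
  proof -
    obtain w i where "w \<in> Wk" "i < n" "\<alpha> = w (sroot i)" using \<open>\<alpha> \<in> ?P\<close> by (auto elim: real_rootE)
    then show ?thesis by (simp add: km_refl_eq weyl_comp sr_weyl weyl_inv)
  qed
  show "\<exists>c. km_refl K \<alpha> v = (\<lambda>j. v j - c * \<alpha> j)" if "\<alpha> \<in> ?P" for \<alpha> v
  proof -
    obtain w i where w: "w \<in> Wk" "i < n" "\<alpha> = w (sroot i)" using \<open>\<alpha> \<in> ?P\<close> by (auto elim: real_rootE)
    have "w (sr i (inv w v)) = (\<lambda>j. w (inv w v) j - pairing N (scoroot i) (inv w v) * w (sroot i) j)"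
      unfolding sr_eq by (rule int_linear_diff[OF weyl_linear[OF w(1)]])
    then show ?thesis using w by (auto simp: km_refl_eq weyl_inv_apply)
  qed
  show "km_refl K \<alpha> \<alpha> = wneg \<alpha>" if "\<alpha> \<in> ?P" for \<alpha>
  proof -
    obtain w i where "w \<in> Wk" "i < n" "\<alpha> = w (sroot i)" using \<open>\<alpha> \<in> ?P\<close> by (auto elim: real_rootE)
    then show ?thesis by (simp add: km_refl_eq weyl_inv_apply sr_root weyl_neg)
  qed
  show "km_refl K \<beta> \<circ> w = w \<circ> km_refl K \<alpha>"
    if "w \<in> Wk" "\<alpha> \<in> ?P" "\<beta> \<in> ?P" "w \<alpha> = \<beta> \<or> w \<alpha> = wneg \<beta>" for w \<alpha> \<beta>
    using that by (intro km_refl_conj) auto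
  show "\<beta> \<in> ?P" if "\<beta> \<in> sroot ` {..<n}" for \<beta> using that simple_positive by blast
  show "km_refl K \<beta> \<alpha> \<in> ?P" if "\<beta> \<in> sroot ` {..<n}" "\<alpha> \<in> ?P" "\<alpha> \<noteq> \<beta>" for \<beta> \<alpha>
  proof -
    obtain i where i: "i < n" "\<beta> = sroot i" using \<open>\<beta> \<in> sroot ` {..<n}\<close> by auto
    obtain k where k: "\<alpha> = rootvec k" "\<forall>l<n. 0 \<le> k l" using \<open>\<alpha> \<in> ?P\<close> by (auto simp: nonneg_roots_def)
    \<comment> \<open>The reflection changes only the \<open>i\<close>-th coefficient, so one positive coefficient remains.\<close>
    have "\<exists>l<n. l \<noteq> i \<and> 0 < k l"
    proof (rule ccontr)
      assume "\<not> (\<exists>l<n. l \<noteq> i \<and> 0 < k l)"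
      then have "\<forall>l<n. k l = (if l = i then k i else 0)" using k(2) by (metis le_less)
      then have "rootvec k = rootvec (\<lambda>l. if l = i then k i else 0)" by (simp only: rootvec_eq_iff)
      then have "\<alpha> = (\<lambda>j. k i * \<beta> j)" by (simp only: k i rootvec_unit[OF i(1)])
      then have "\<alpha> = \<beta>"
        using proportional[of \<alpha> \<beta> 1 "k i"] that simple_positive i by auto
      then show False using that by simp
    qed
    then obtain l where l: "l < n" "l \<noteq> i" "0 < k l" by blast
    have eq: "km_refl K \<beta> \<alpha> = rootvec (k(i := k i - (\<Sum>l<n. A i l * k l)))" (is "_ = rootvec ?k")
      using i by (simp add: km_refl_simple k sr_rootvec)
    have "wneg (rootvec ?k) \<notin> nonneg_roots"
    proof
      assume "wneg (rootvec ?k) \<in> nonneg_roots"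
      then obtain h where "rootvec (\<lambda>i. - ?k i) = rootvec h" "\<forall>l<n. 0 \<le> h l"
        by (auto simp: nonneg_roots_def wneg_rootvec)
      then have "0 \<le> - ?k l" using l(1) by (simp only: rootvec_eq_iff)
      then show False using l by simp
    qed
    then show ?thesis
      using pm[of "sr i" \<alpha>] that i sr_weyl[OF i(1)] unfolding eq[symmetric]
      by (auto simp: km_refl_simple)
  qed
  show "finite {\<alpha> \<in> ?P. w \<alpha> \<notin> ?P}" if "w \<in> Wk" for w
    using that unfolding weyl_eq
  proof (induction rule: refl_group_induct)
    case (refl i w)
    then have i: "i < n" and w: "w \<in> Wk" by (auto simp: weyl_eq)
    have "{\<alpha> \<in> ?P. (sr i \<circ> w) \<alpha> \<notin> ?P} \<subseteq> {\<alpha> \<in> ?P. w \<alpha> \<notin> ?P} \<union> {inv w (sroot i)}"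
    proof
      fix \<alpha> assume \<alpha>: "\<alpha> \<in> {\<alpha> \<in> ?P. (sr i \<circ> w) \<alpha> \<notin> ?P}"
      show "\<alpha> \<in> {\<alpha> \<in> ?P. w \<alpha> \<notin> ?P} \<union> {inv w (sroot i)}"
      proof (cases "w \<alpha> = sroot i")
        case True
        then show ?thesis using weyl_inv_apply(1)[OF w, of \<alpha>] by simp
      next
        case False
        have "w \<alpha> \<notin> ?P"
        proof
          assume "w \<alpha> \<in> ?P"
          then have "km_refl K (sroot i) (w \<alpha>) \<in> ?P"
            using False i \<open>\<And>\<beta> \<alpha>. \<beta> \<in> sroot ` {..<n} \<Longrightarrow> \<alpha> \<in> ?P \<Longrightarrow> \<alpha> \<noteq> \<beta> \<Longrightarrow> km_refl K \<beta> \<alpha> \<in> ?P\<close>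
            by blast
          then show False using \<alpha> by (simp add: km_refl_simple i)
        qed
        then show ?thesis using \<alpha> by blast
      qed
    qed
    then show ?case using refl.IH by (meson finite.emptyI finite.insertI finite_UnI finite_subset)
  next
    case id
    have "{\<alpha> \<in> ?P. id \<alpha> \<notin> ?P} = {}" by auto
    then show ?case by (simp only: finite.emptyI)
  qed
  show "w \<alpha> \<in> ?P" if w: "w \<in> Wk" and simple: "\<And>\<beta>. \<beta> \<in> sroot ` {..<n} \<Longrightarrow> w \<beta> \<in> ?P" and \<alpha>: "\<alpha> \<in> ?P"
    for w \<alpha>
  proof -
    obtain k where k: "\<alpha> = rootvec k" "\<forall>l<n. 0 \<le> k l" using \<alpha> by (auto simp: nonneg_roots_def)
    have "\<forall>i. \<exists>h. i < n \<longrightarrow> w (sroot i) = rootvec h \<and> (\<forall>l<n. 0 \<le> h l)"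
      using simple by (auto simp: nonneg_roots_def)
    then obtain h where h: "\<And>i. i < n \<Longrightarrow> w (sroot i) = rootvec (h i)" "\<And>i l. i < n \<Longrightarrow> l < n \<Longrightarrow> 0 \<le> h i l"
      by metis
    have "w \<alpha> = (\<lambda>j. \<Sum>i<n. k i * w (sroot i) j)"
      unfolding k by (rule rootvec_linear[OF weyl_linear[OF w]])
    also have "\<dots> = (\<lambda>j. \<Sum>i<n. \<Sum>l<n. k i * h i l * sroot l j)"
      by (simp add: h(1) rootvec_def sum_distrib_left mult.assoc)
    also have "\<dots> = rootvec (\<lambda>l. \<Sum>i<n. k i * h i l)"
      unfolding rootvec_def sum_distrib_right by (subst sum.swap) simp
    finally have "w \<alpha> \<in> nonneg_roots"
      using k(2) h(2) by (auto intro!: nonneg_rootsI sum_nonneg)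
    then show ?thesis using real_root_weyl[OF w] \<alpha> by blast
  qed
qed simp_all

lemma km_weyl_setting: "weyl_setting (km_setting K)"
proof -
  interpret reflection_setting "km_setting K" by (rule km_reflection_setting)
  have word: "word_prod (km_refl K) (map sroot xs) = word_prod sr xs" if "set xs \<subseteq> {..<n}" for xs
    using that by (induction xs) (simp_all add: km_refl_simple)
  have gen: "Wk \<subseteq> refl_group (km_refl K) (sroot ` {..<n})"
  proof
    fix w assume "w \<in> Wk"
    then obtain xs where "set xs \<subseteq> {..<n}" "w = word_prod sr xs" by (auto simp: weyl_eq refl_group_def)
    then show "w \<in> refl_group (km_refl K) (sroot ` {..<n})"
      unfolding refl_group_def using word[of xs]
      by (force intro!: exI[of _ "map sroot xs"])
  qed
  show ?thesis
  proof
    have "w = id" if "w \<in> Wk" "\<forall>\<alpha>\<in>pos_re (km_setting K). w \<alpha> \<in> pos_re (km_setting K)" for w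
      using cox_positive_trivial[of w] positive_preserves[of w] that gen
      by (auto simp: setting_simps)
    then show "Omega (km_setting K) = {\<omega> \<in> weyl_group (km_setting K).
        \<forall>\<alpha>\<in>pos_re (km_setting K). \<omega> \<alpha> \<in> pos_re (km_setting K)}"
      using weyl_id by (auto simp: setting_simps)
  qed
qed

end


section \<open>Extended affine Weyl groups\<close>

locale affine =
  fixes R :: reductive_datum
  assumes datum: "reductive_root_datum R"
begin

abbreviation "N \<equiv> rd_rank R"
abbreviation "\<Phi>0 \<equiv> rd_roots R"
abbreviation "cv \<equiv> rd_coroot R"
abbreviation "base \<equiv> rd_base R"
abbreviation "EW \<equiv> ext_affine_weyl R"
abbreviation "sf \<equiv> finite_refl R"
abbreviation "tr \<equiv> translation R"

lemma datum_conjuncts: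
  shows finite_roots: "finite \<Phi>0"
    and "\<Phi>0 \<subseteq> lattice N"
    and "cv ` \<Phi>0 \<subseteq> lattice N"
    and "\<forall>\<alpha>\<in>\<Phi>0. pairing N (cv \<alpha>) \<alpha> = 2"
    and "\<forall>\<alpha>\<in>\<Phi>0. reflection N (cv \<alpha>) \<alpha> ` \<Phi>0 \<subseteq> \<Phi>0"
    and "\<forall>\<alpha>\<in>\<Phi>0. reflection N \<alpha> (cv \<alpha>) ` cv ` \<Phi>0 \<subseteq> cv ` \<Phi>0"
    and "\<forall>\<alpha>\<in>\<Phi>0. \<forall>\<beta>\<in>\<Phi>0. \<forall>a b :: int. a \<noteq> 0 \<longrightarrow> b \<noteq> 0 \<longrightarrow>
        (\<forall>j. a * \<alpha> j = b * \<beta> j) \<longrightarrow> \<beta> = \<alpha> \<or> \<beta> = (\<lambda>j. - \<alpha> j)"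
    and base_roots: "base \<subseteq> \<Phi>0"
    and base_independent: "int_independent base (\<lambda>\<alpha>. \<alpha>)"
    and "\<forall>\<alpha>\<in>\<Phi>0. \<alpha> \<in> nonneg_span base \<or> (\<lambda>j. - \<alpha> j) \<in> nonneg_span base"
  using datum unfolding reductive_root_datum_def by - (elim conjE, assumption)+

lemma root_lattice: "\<alpha> \<in> \<Phi>0 \<Longrightarrow> \<alpha> \<in> lattice N"
  using datum_conjuncts(2) by blast

lemma coroot_lattice: "\<alpha> \<in> \<Phi>0 \<Longrightarrow> cv \<alpha> \<in> lattice N"
  using datum_conjuncts(3) by blast

lemma coroot_root: "\<alpha> \<in> \<Phi>0 \<Longrightarrow> pairing N (cv \<alpha>) \<alpha> = 2"
  using datum_conjuncts(4) by blast

lemma sf_root: "\<alpha> \<in> \<Phi>0 \<Longrightarrow> \<beta> \<in> \<Phi>0 \<Longrightarrow> sf \<alpha> \<beta> \<in> \<Phi>0"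
  using datum_conjuncts(5) unfolding finite_refl_def by blast

lemma coroot_refl: "\<alpha> \<in> \<Phi>0 \<Longrightarrow> c \<in> cv ` \<Phi>0 \<Longrightarrow> reflection N \<alpha> (cv \<alpha>) c \<in> cv ` \<Phi>0"
  using datum_conjuncts(6) by blast

lemma reduced: "\<alpha> \<in> \<Phi>0 \<Longrightarrow> \<beta> \<in> \<Phi>0 \<Longrightarrow> a \<noteq> 0 \<Longrightarrow> b \<noteq> 0 \<Longrightarrow> (\<And>j. a * \<alpha> j = b * \<beta> j) \<Longrightarrow>
    \<beta> = \<alpha> \<or> \<beta> = wneg \<alpha>"
  using datum_conjuncts(7) unfolding wneg_def by blast

lemma root_sign: "\<alpha> \<in> \<Phi>0 \<Longrightarrow> \<alpha> \<in> nonneg_span base \<or> wneg \<alpha> \<in> nonneg_span base"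
  using datum_conjuncts(10) unfolding wneg_def by blast

lemma finite_base: "finite base"
  using base_roots finite_roots by (rule finite_subset)

lemma lattice_N: "v \<in> lattice N \<Longrightarrow> v N = 0"
  by (simp add: lattice_def)

lemma root_N: "\<alpha> \<in> \<Phi>0 \<Longrightarrow> \<alpha> N = 0"
  by (simp add: root_lattice lattice_N)

lemma root_upd_0: "\<alpha> \<in> \<Phi>0 \<Longrightarrow> \<alpha>(N := 0) = \<alpha>"
  using root_N by (metis fun_upd_triv)

lemma pairing_upd [simp]: "pairing N c (v(N := k)) = pairing N c v"
  unfolding pairing_def by (intro sum.cong) auto

lemma pairing_commute: "pairing N c v = pairing N v c"
  by (simp add: pairing_def mult.commute)

lemma sf_eq: "sf \<alpha> v = (\<lambda>j. v j - pairing N (cv \<alpha>) v * \<alpha> j)"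
  by (simp add: finite_refl_def reflection_def)

lemma sf_sf: "\<alpha> \<in> \<Phi>0 \<Longrightarrow> sf \<alpha> \<circ> sf \<alpha> = id"
  unfolding finite_refl_def by (rule reflection_involution[OF coroot_root])

lemma sf_self: "\<alpha> \<in> \<Phi>0 \<Longrightarrow> sf \<alpha> \<alpha> = wneg \<alpha>"
  by (simp add: sf_eq coroot_root wneg_def)

lemma root_neg: "\<alpha> \<in> \<Phi>0 \<Longrightarrow> wneg \<alpha> \<in> \<Phi>0"
  using sf_root[of \<alpha> \<alpha>] by (simp add: sf_self)

lemma root_nonzero: "\<alpha> \<in> \<Phi>0 \<Longrightarrow> \<alpha> \<noteq> (\<lambda>_. 0)"
  using coroot_root[of \<alpha>] by (auto simp: pairing_def)


subsection \<open>The base\<close>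

definition spanvec :: "(weight \<Rightarrow> int) \<Rightarrow> weight" where
  "spanvec k = (\<lambda>j. \<Sum>b\<in>base. k b * b j)"

lemma spanvec_eq_iff: "spanvec k = spanvec k' \<longleftrightarrow> (\<forall>b\<in>base. k b = k' b)"
proof
  assume "spanvec k = spanvec k'"
  then have "\<forall>j. (\<Sum>b\<in>base. (k b - k' b) * b j) = 0"
    by (simp add: spanvec_def fun_eq_iff left_diff_distrib sum_subtractf)
  then have "\<forall>b\<in>base. k b - k' b = 0"
    using base_independent[unfolded int_independent_def, THEN spec, of "\<lambda>b. k b - k' b"] by blast
  then show "\<forall>b\<in>base. k b = k' b" by auto
qed (auto simp: spanvec_def)

lemma wneg_spanvec: "wneg (spanvec k) = spanvec (\<lambda>b. - k b)"
  by (simp add: wneg_def spanvec_def sum_negf)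

lemma nonneg_span_iff: "v \<in> nonneg_span base \<longleftrightarrow> (\<exists>k. v = spanvec k \<and> (\<forall>b\<in>base. 0 \<le> k b))"
proof
  assume "v \<in> nonneg_span base"
  then obtain c :: "weight \<Rightarrow> nat" where "v = spanvec (\<lambda>b. int (c b))"
    by (auto simp: nonneg_span_def spanvec_def)
  then show "\<exists>k. v = spanvec k \<and> (\<forall>b\<in>base. 0 \<le> k b)" by auto
next
  assume "\<exists>k. v = spanvec k \<and> (\<forall>b\<in>base. 0 \<le> k b)"
  then obtain k where k: "v = spanvec k" "\<forall>b\<in>base. 0 \<le> k b" by blast
  then have "v = (\<lambda>j. \<Sum>b\<in>base. int (nat (k b)) * b j)" by (simp add: spanvec_def)
  then show "v \<in> nonneg_span base"
    unfolding nonneg_span_def mem_Collect_eq by (rule exI[of _ "\<lambda>b. nat (k b)"])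
qed

lemma nonneg_comb:
  assumes "u \<in> nonneg_span base" "v \<in> nonneg_span base" "0 \<le> x" "0 \<le> y"
  shows "(\<lambda>j. x * u j + y * v j) \<in> nonneg_span base"
proof -
  obtain k k' where k: "u = spanvec k" "v = spanvec k'" "\<forall>b\<in>base. 0 \<le> k b" "\<forall>b\<in>base. 0 \<le> k' b"
    using assms(1,2) by (auto simp: nonneg_span_iff)
  have "(\<lambda>j. x * u j + y * v j) = spanvec (\<lambda>b. x * k b + y * k' b)"
    by (simp add: k spanvec_def sum_distrib_left sum.distrib algebra_simps)
  then show ?thesis using k assms(3,4) unfolding nonneg_span_iff by auto
qed

lemma nonneg_add: "u \<in> nonneg_span base \<Longrightarrow> v \<in> nonneg_span base \<Longrightarrow> (\<lambda>j. u j + v j) \<in> nonneg_span base"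
  using nonneg_comb[of u v 1 1] by simp

lemma zero_nonneg: "(\<lambda>_. 0) \<in> nonneg_span base"
  unfolding nonneg_span_iff by (intro exI[of _ "\<lambda>_. 0"]) (simp add: spanvec_def)

lemma nonneg_antisym:
  assumes "v \<in> nonneg_span base" "wneg v \<in> nonneg_span base"
  shows "v = (\<lambda>_. 0)"
proof -
  obtain k k' where k: "v = spanvec k" "\<forall>b\<in>base. 0 \<le> k b" "wneg v = spanvec k'" "\<forall>b\<in>base. 0 \<le> k' b"
    using assms by (auto simp: nonneg_span_iff)
  have "wneg v = spanvec (\<lambda>b. - k b)" by (simp only: k(1) wneg_spanvec)
  then have "\<forall>b\<in>base. k' b = - k b" using k(3) by (simp add: spanvec_eq_iff)
  then have "\<forall>b\<in>base. k b = 0" using k(2,4) by fastforce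
  then show ?thesis by (simp add: k(1) spanvec_def)
qed

lemma root_not_both: "\<alpha> \<in> \<Phi>0 \<Longrightarrow> \<alpha> \<in> nonneg_span base \<Longrightarrow> wneg \<alpha> \<notin> nonneg_span base"
  using nonneg_antisym root_nonzero by blast

lemma spanvec_single: "\<beta> \<in> base \<Longrightarrow> spanvec (\<lambda>b. if b = \<beta> then c else 0) = (\<lambda>j. c * \<beta> j)"
  using finite_base by (simp add: spanvec_def if_distrib[of "\<lambda>x. x * _"] sum.delta cong: if_cong)

lemma base_nonneg: "\<beta> \<in> base \<Longrightarrow> \<beta> \<in> nonneg_span base"
  using spanvec_single[of \<beta> 1] unfolding nonneg_span_iff
  by (intro exI[of _ "\<lambda>b. if b = \<beta> then 1 else 0"]) auto

lemma simple_refl_nonneg: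
  assumes "\<beta> \<in> base" "\<alpha> \<in> \<Phi>0" "\<alpha> \<in> nonneg_span base" "\<alpha> \<noteq> \<beta>"
  shows "sf \<beta> \<alpha> \<in> nonneg_span base"
proof -
  have \<beta>: "\<beta> \<in> \<Phi>0" using assms(1) base_roots by blast
  obtain k where k: "\<alpha> = spanvec k" "\<forall>b\<in>base. 0 \<le> k b" using assms(3) by (auto simp: nonneg_span_iff)
  have "\<exists>b\<in>base. b \<noteq> \<beta> \<and> 0 < k b"
  proof (rule ccontr)
    assume "\<not> (\<exists>b\<in>base. b \<noteq> \<beta> \<and> 0 < k b)"
    then have "\<forall>b\<in>base. k b = (if b = \<beta> then k \<beta> else 0)" using k(2) by (metis le_less)
    then have "spanvec k = spanvec (\<lambda>b. if b = \<beta> then k \<beta> else 0)" by (simp only: spanvec_eq_iff)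
    then have eq: "\<alpha> = (\<lambda>j. k \<beta> * \<beta> j)" by (simp only: k(1) spanvec_single[OF assms(1)])
    then have "k \<beta> \<noteq> 0" using root_nonzero[OF assms(2)] by auto
    then have "\<beta> = \<alpha> \<or> \<beta> = wneg \<alpha>"
      using reduced[OF assms(2) \<beta>, of 1 "k \<beta>"] eq by (metis mult_1 zero_neq_one)
    then show False
      using assms(4) root_not_both[OF assms(2,3)] base_nonneg[OF assms(1)] by auto
  qed
  then obtain b where b: "b \<in> base" "b \<noteq> \<beta>" "0 < k b" by blast
  let ?c = "pairing N (cv \<beta>) \<alpha>"
  have "sf \<beta> \<alpha> = (\<lambda>j. spanvec k j - spanvec (\<lambda>b. if b = \<beta> then ?c else 0) j)"
    by (simp only: sf_eq spanvec_single[OF assms(1)]) (simp add: k(1))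
  also have "\<dots> = spanvec (\<lambda>b. k b - (if b = \<beta> then ?c else 0))"
    by (simp add: spanvec_def left_diff_distrib sum_subtractf)
  finally have eq: "sf \<beta> \<alpha> = spanvec (\<lambda>b. k b - (if b = \<beta> then ?c else 0))" (is "_ = spanvec ?k") .
  have "wneg (sf \<beta> \<alpha>) \<notin> nonneg_span base"
  proof
    assume "wneg (sf \<beta> \<alpha>) \<in> nonneg_span base"
    then obtain h where h: "wneg (sf \<beta> \<alpha>) = spanvec h" "\<forall>b\<in>base. 0 \<le> h b"
      by (auto simp: nonneg_span_iff)
    have "wneg (sf \<beta> \<alpha>) = spanvec (\<lambda>b. - ?k b)" by (simp only: eq wneg_spanvec)
    then have "spanvec h = spanvec (\<lambda>b. - ?k b)" using h(1) by simp
    then have "\<forall>b\<in>base. h b = - ?k b" by (simp only: spanvec_eq_iff)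
    then have "0 \<le> - ?k b" using h(2) b(1) by metis
    then show False using b by simp
  qed
  then show ?thesis using root_sign[OF sf_root[OF \<beta> assms(2)]] by blast
qed


subsection \<open>The invariant form\<close>

text \<open>
  The coroots are permuted by the dual reflections, so the sum of the squares of all coroots is an
  invariant quadratic form. It is positive on roots and recovers each coroot from its root,
  also after an affine root has been moved by an element of the extended affine Weyl group.
\<close>

definition form :: "weight \<Rightarrow> weight \<Rightarrow> int" where
  "form x y = (\<Sum>c\<in>cv ` \<Phi>0. pairing N c x * pairing N c y)"

lemma form_commute: "form x y = form y x"
  by (simp add: form_def mult.commute)

lemma form_diff: "form (\<lambda>j. u j - a * v j) y = form u y - a * form v y"
  by (simp add: form_def pairing_diff algebra_simps sum_subtractf sum_distrib_left)

lemma form_neg: "form (wneg u) y = - form u y"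
  by (simp add: form_def pairing_wneg sum_negf)

lemma form_upd [simp]: "form (x(N := k)) y = form x y" "form x (y(N := k)) = form x y"
  by (simp_all add: form_def)

lemma form_nonneg: "0 \<le> form x x"
  unfolding form_def by (rule sum_nonneg) simp

lemma form_pos: "\<alpha> \<in> \<Phi>0 \<Longrightarrow> 0 < form \<alpha> \<alpha>"
proof -
  assume \<alpha>: "\<alpha> \<in> \<Phi>0"
  have "pairing N (cv \<alpha>) \<alpha> * pairing N (cv \<alpha>) \<alpha> \<le> form \<alpha> \<alpha>"
    unfolding form_def using \<alpha> finite_roots by (intro member_le_sum) auto
  then show ?thesis using coroot_root[OF \<alpha>] by simp
qed

lemma pairing_sf:
  assumes "\<alpha> \<in> \<Phi>0"
  shows "pairing N c (sf \<alpha> v) = pairing N (reflection N \<alpha> (cv \<alpha>) c) v"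
proof -
  have "pairing N (reflection N \<alpha> (cv \<alpha>) c) v = pairing N v (\<lambda>j. c j - pairing N \<alpha> c * cv \<alpha> j)"
    by (simp add: pairing_commute[of _ v] reflection_def)
  then show ?thesis
    by (simp add: sf_eq pairing_diff pairing_commute[of v] pairing_commute[of \<alpha>])
qed

lemma form_sf:
  assumes "\<alpha> \<in> \<Phi>0"
  shows "form (sf \<alpha> x) (sf \<alpha> y) = form x y"
proof -
  let ?r = "reflection N \<alpha> (cv \<alpha>)"
  have rr: "?r (?r c) = c" for c
    using reflection_involution[of N \<alpha> "cv \<alpha>"] coroot_root[OF assms]
    by (simp add: pairing_commute fun_eq_iff)
  have inj: "inj_on ?r (cv ` \<Phi>0)" by (rule inj_on_inverseI[of _ ?r]) (rule rr)
  have "?r ` (cv ` \<Phi>0) \<subseteq> cv ` \<Phi>0" using coroot_refl[OF assms] by blast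
  then have img: "?r ` (cv ` \<Phi>0) = cv ` \<Phi>0"
    using inj finite_roots by (simp add: endo_inj_surj)
  have "form x y = (\<Sum>c\<in>?r ` (cv ` \<Phi>0). pairing N c x * pairing N c y)"
    by (simp only: form_def img)
  also have "\<dots> = (\<Sum>c\<in>cv ` \<Phi>0. pairing N (?r c) x * pairing N (?r c) y)"
    by (rule sum.reindex_cong[OF inj]) auto
  also have "\<dots> = form (sf \<alpha> x) (sf \<alpha> y)"
    by (simp only: form_def pairing_sf[OF assms])
  finally show ?thesis by simp
qed

lemma coroot_form:
  assumes "\<alpha> \<in> \<Phi>0"
  shows "pairing N (cv \<alpha>) x * form \<alpha> \<alpha> = 2 * form \<alpha> x"
proof -
  have "form (sf \<alpha> x) (wneg \<alpha>) = form x \<alpha>"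
    using form_sf[OF assms, of x \<alpha>] by (simp add: sf_self assms)
  then have "- form (sf \<alpha> x) \<alpha> = form x \<alpha>"
    by (metis form_commute form_neg)
  then show ?thesis
    unfolding sf_eq form_diff by (simp add: form_commute)
qed

lemma coroot_neg:
  assumes "\<alpha> \<in> \<Phi>0"
  shows "pairing N (cv (wneg \<alpha>)) x = - pairing N (cv \<alpha>) x"
proof -
  have "form (wneg \<alpha>) (wneg \<alpha>) = form \<alpha> \<alpha>" by (metis form_commute form_neg minus_minus)
  then have "pairing N (cv (wneg \<alpha>)) x * form \<alpha> \<alpha> = (- pairing N (cv \<alpha>) x) * form \<alpha> \<alpha>"
    using coroot_form[OF root_neg[OF assms], of x] coroot_form[OF assms, of x] by (simp add: form_neg)
  then show ?thesis using form_pos[OF assms] by (metis mult_right_cancel less_irrefl)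
qed


subsection \<open>Highest roots\<close>

lemma highestD: "\<theta> \<in> highest_roots R \<Longrightarrow> \<theta> \<in> \<Phi>0"
    "\<theta> \<in> highest_roots R \<Longrightarrow> \<gamma> \<in> \<Phi>0 \<Longrightarrow> (\<lambda>j. \<gamma> j - \<theta> j) \<in> nonneg_span base \<Longrightarrow> \<gamma> = \<theta>"
  by (auto simp: highest_roots_def)

lemma highest_nonneg:
  assumes "\<theta> \<in> highest_roots R"
  shows "\<theta> \<in> nonneg_span base"
proof (rule ccontr)
  assume "\<theta> \<notin> nonneg_span base"
  then have neg: "wneg \<theta> \<in> nonneg_span base" using root_sign highestD(1)[OF assms] by blast
  have "(\<lambda>j. wneg \<theta> j - \<theta> j) = (\<lambda>j. wneg \<theta> j + wneg \<theta> j)" by (simp add: wneg_def)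
  then have "wneg \<theta> = \<theta>"
    using nonneg_add[OF neg neg] by (intro highestD(2)[OF assms] root_neg highestD(1)[OF assms]) simp
  then show False using neg \<open>\<theta> \<notin> nonneg_span base\<close> by simp
qed

text \<open>
  Among the roots above \<open>\<gamma>\<close>, one that has the largest number of roots below it is maximal.
\<close>

lemma highest_above:
  assumes "\<gamma> \<in> \<Phi>0"
  obtains \<theta> where "\<theta> \<in> highest_roots R" "(\<lambda>j. \<theta> j - \<gamma> j) \<in> nonneg_span base"
proof -
  let ?le = "\<lambda>x y. (\<lambda>j. y j - x j) \<in> nonneg_span base"
  let ?f = "\<lambda>y. card {x \<in> \<Phi>0. ?le x y}"
  note zero = zero_nonneg
  have trans: "?le x z" if "?le x y" "?le y z" for x y z
    using nonneg_add[OF that] by simp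
  let ?A = "{y \<in> \<Phi>0. ?le \<gamma> y}"
  have A: "finite ?A" "?A \<noteq> {}" using finite_roots assms zero by auto
  then have "Max (?f ` ?A) \<in> ?f ` ?A" by (intro Max_in) auto
  then obtain \<theta> where \<theta>: "\<theta> \<in> \<Phi>0" "?le \<gamma> \<theta>" "?f \<theta> = Max (?f ` ?A)" by auto
  have "y = \<theta>" if y: "y \<in> \<Phi>0" "?le \<theta> y" for y
  proof (rule ccontr)
    assume "y \<noteq> \<theta>"
    have "y \<notin> {x \<in> \<Phi>0. ?le x \<theta>}"
    proof
      assume "y \<in> {x \<in> \<Phi>0. ?le x \<theta>}"
      moreover have "wneg (\<lambda>j. y j - \<theta> j) = (\<lambda>j. \<theta> j - y j)" by (simp add: wneg_def)
      ultimately have "(\<lambda>j. y j - \<theta> j) = (\<lambda>_. 0)" using y(2) by (intro nonneg_antisym) auto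
      then show False using \<open>y \<noteq> \<theta>\<close> by (simp add: fun_eq_iff)
    qed
    moreover have "y \<in> {x \<in> \<Phi>0. ?le x y}" using y zero by simp
    moreover have "{x \<in> \<Phi>0. ?le x \<theta>} \<subseteq> {x \<in> \<Phi>0. ?le x y}" using trans y(2) by blast
    ultimately have "?f \<theta> < ?f y" using finite_roots by (intro psubset_card_mono) auto
    moreover have "?f y \<le> Max (?f ` ?A)"
      using A(1) y trans[OF \<theta>(2) y(2)] by (intro Max_ge) auto
    ultimately show False using \<theta>(3) by simp
  qed
  then have "\<theta> \<in> highest_roots R" using \<theta>(1) by (simp add: highest_roots_def)
  then show ?thesis using \<theta>(2) that by blast
qed

text \<open>
  Otherwise reflecting \<open>\<gamma>\<close> in \<open>\<theta>\<close> adds a positive multiple of \<open>\<theta>\<close> to \<open>\<gamma>\<close> and yields a root above \<open>\<theta>\<close>.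
\<close>

lemma highest_coroot_nonneg:
  assumes \<theta>: "\<theta> \<in> highest_roots R" and \<gamma>: "\<gamma> \<in> \<Phi>0" "\<gamma> \<in> nonneg_span base"
  shows "0 \<le> pairing N (cv \<theta>) \<gamma>"
proof (rule ccontr)
  define k where "k = - pairing N (cv \<theta>) \<gamma>"
  assume "\<not> 0 \<le> pairing N (cv \<theta>) \<gamma>"
  then have k: "1 \<le> k" by (simp add: k_def)
  have eq: "sf \<theta> \<gamma> = (\<lambda>j. \<gamma> j + k * \<theta> j)" by (simp add: sf_eq k_def)
  have "(\<lambda>j. sf \<theta> \<gamma> j - \<theta> j) = (\<lambda>j. 1 * \<gamma> j + (k - 1) * \<theta> j)"
    by (simp add: eq algebra_simps)
  then have "(\<lambda>j. sf \<theta> \<gamma> j - \<theta> j) \<in> nonneg_span base"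
    using nonneg_comb[OF \<gamma>(2) highest_nonneg[OF \<theta>], of 1 "k - 1"] k by simp
  then have "sf \<theta> \<gamma> = \<theta>"
    using \<theta> \<gamma>(1) by (intro highestD(2)[OF \<theta>] sf_root highestD(1)[OF \<theta>])
  then have "\<gamma> j + k * \<theta> j = \<theta> j" for j using eq by metis
  then have "wneg \<gamma> = (\<lambda>j. (k - 1) * \<theta> j + 0 * \<theta> j)"
    by (simp add: wneg_def fun_eq_iff algebra_simps)
  then have "wneg \<gamma> \<in> nonneg_span base"
    using nonneg_comb[OF highest_nonneg[OF \<theta>] highest_nonneg[OF \<theta>], of "k - 1" 0] k by simp
  then show False using root_not_both \<gamma> by blast
qed

text \<open>
  If the pairing of a positive root \<open>\<gamma> \<noteq> \<theta>\<close> with \<open>\<theta>\<^sup>\<or>\<close> were at least 2, then either \<open>\<theta> - \<gamma>\<close> is a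
  positive root and a root above \<open>\<theta>\<close> arises by reflection, or \<open>\<theta>\<close> and \<open>\<gamma>\<close> span an
  isotropic vector and infinitely many roots arise.
\<close>

lemma highest_coroot_le_1:
  assumes \<theta>: "\<theta> \<in> highest_roots R" and \<gamma>: "\<gamma> \<in> \<Phi>0" "\<gamma> \<in> nonneg_span base" "\<gamma> \<noteq> \<theta>"
    and pos: "1 \<le> pairing N (cv \<theta>) \<gamma>"
  shows "pairing N (cv \<theta>) \<gamma> = 1" "(\<lambda>j. \<theta> j - \<gamma> j) \<in> nonneg_span base"
proof -
  note \<theta>r = highestD(1)[OF \<theta>]
  define k p where "k = pairing N (cv \<theta>) \<gamma>" and "p = pairing N (cv \<gamma>) \<theta>"
  have nonneg: "(\<lambda>j. \<theta> j - \<gamma> j) \<in> nonneg_span base" if "(\<lambda>j. \<theta> j - \<gamma> j) \<in> \<Phi>0"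
  proof (rule ccontr)
    assume "(\<lambda>j. \<theta> j - \<gamma> j) \<notin> nonneg_span base"
    then have "wneg (\<lambda>j. \<theta> j - \<gamma> j) \<in> nonneg_span base" using root_sign[OF that] by blast
    then have "(\<lambda>j. \<gamma> j - \<theta> j) \<in> nonneg_span base" by (simp add: wneg_def)
    then show False using highestD(2)[OF \<theta> \<gamma>(1)] \<gamma>(3) by blast
  qed
  have k1: "(\<lambda>j. \<theta> j - \<gamma> j) \<in> \<Phi>0" if "k = 1"
  proof -
    have "wneg (sf \<theta> \<gamma>) = (\<lambda>j. \<theta> j - \<gamma> j)" using that by (simp add: sf_eq k_def wneg_def)
    then show ?thesis using root_neg[OF sf_root[OF \<theta>r \<gamma>(1)]] by simp
  qed
  have kform: "k * form \<theta> \<theta> = 2 * form \<theta> \<gamma>" unfolding k_def by (rule coroot_form[OF \<theta>r])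
  have pform: "p * form \<gamma> \<gamma> = 2 * form \<theta> \<gamma>"
    unfolding p_def by (subst form_commute[of \<theta> \<gamma>]) (rule coroot_form[OF \<gamma>(1)])
  have p0: "0 < p"
  proof -
    have "0 < k * form \<theta> \<theta>" using pos form_pos[OF \<theta>r] by (simp add: k_def)
    then have "0 < p * form \<gamma> \<gamma>" using kform pform by simp
    then show ?thesis using form_pos[OF \<gamma>(1)] by (simp add: zero_less_mult_iff)
  qed
  have "k = 1"
  proof (rule ccontr)
    assume "k \<noteq> 1"
    then have k2: "2 \<le> k" using pos by (simp add: k_def)
    show False
    proof (cases "p = 1")
      case True
      have "sf \<gamma> \<theta> = (\<lambda>j. \<theta> j - \<gamma> j)" using True by (simp add: sf_eq p_def)
      then have diff: "(\<lambda>j. \<theta> j - \<gamma> j) \<in> nonneg_span base"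
        using nonneg sf_root[OF \<gamma>(1) \<theta>r] by simp
      have eq: "wneg (sf \<theta> \<gamma>) = (\<lambda>j. k * \<theta> j - \<gamma> j)" by (simp add: sf_eq k_def wneg_def)
      have "(\<lambda>j. wneg (sf \<theta> \<gamma>) j - \<theta> j) = (\<lambda>j. (k - 2) * \<theta> j + 1 * (\<theta> j - \<gamma> j))"
        by (simp add: eq algebra_simps)
      then have "(\<lambda>j. wneg (sf \<theta> \<gamma>) j - \<theta> j) \<in> nonneg_span base"
        using nonneg_comb[OF highest_nonneg[OF \<theta>] diff, of "k - 2" 1] k2 by simp
      then have "wneg (sf \<theta> \<gamma>) = \<theta>"
        by (intro highestD(2)[OF \<theta>] root_neg sf_root \<theta>r \<gamma>(1))
      then have "k * \<theta> j - \<gamma> j = \<theta> j" for j using eq by metis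
      then have "(k - 1) * \<theta> j = 1 * \<gamma> j" for j
        by (simp add: left_diff_distrib) (metis add_diff_cancel_left' diff_add_cancel)
      then have "\<gamma> = \<theta> \<or> \<gamma> = wneg \<theta>"
        using reduced[OF \<theta>r \<gamma>(1), of "k - 1" 1] k2 by simp
      then show False
        using \<gamma> root_not_both[OF \<theta>r highest_nonneg[OF \<theta>]] by auto
    next
      case False
      then have p2: "2 \<le> p" using p0 by simp
      define x where "x = (\<lambda>j. \<theta> j - \<gamma> j)"
      have fx: "form x y = form \<theta> y - form \<gamma> y" for y
        using form_diff[of \<theta> 1 \<gamma> y] by (simp add: x_def)
      have "form x x = form \<theta> x - form \<gamma> x" by (rule fx)
      also have "\<dots> = (form \<theta> \<theta> - form \<theta> \<gamma>) - (form \<theta> \<gamma> - form \<gamma> \<gamma>)"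
        by (simp only: fx form_commute[of \<theta> x] form_commute[of \<gamma> x] form_commute[of \<gamma> \<theta>])
      finally have "2 * form x x = (2 - k) * form \<theta> \<theta> + (2 - p) * form \<gamma> \<gamma>"
        using kform pform by (simp add: algebra_simps)
      moreover have "(2 - k) * form \<theta> \<theta> \<le> 0" "(2 - p) * form \<gamma> \<gamma> \<le> 0"
        using k2 p2 form_pos[OF \<theta>r] form_pos[OF \<gamma>(1)] by (simp_all add: mult_le_0_iff)
      ultimately have z: "form x x = 0" "(2 - k) * form \<theta> \<theta> = 0" "(2 - p) * form \<gamma> \<gamma> = 0"
        using form_nonneg[of x] by linarith+
      have "k = 2" "p = 2" using z form_pos[OF \<theta>r] form_pos[OF \<gamma>(1)] by auto
      have "\<forall>c\<in>cv ` \<Phi>0. pairing N c x * pairing N c x = 0"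
        using z(1) finite_roots unfolding form_def by (subst (asm) sum_nonneg_eq_0_iff) auto
      \<comment> \<open>All coroots vanish on \<open>x\<close>, so the two reflections translate \<open>\<theta>\<close> by \<open>2 x\<close> again and again.\<close>
      then have px: "pairing N (cv \<alpha>) x = 0" if "\<alpha> \<in> \<Phi>0" for \<alpha> using that by simp
      have roots: "(\<lambda>j. \<theta> j + (2 * int i) * x j) \<in> \<Phi>0" for i
      proof (induction i)
        case (Suc i)
        let ?\<eta> = "\<lambda>j. \<theta> j + (2 * int i) * x j"
        have pair: "pairing N c ?\<eta> = pairing N c \<theta> + 2 * int i * pairing N c x" for c
          using pairing_comb[of N c 1 \<theta> "2 * int i" x] by simp
        have 1: "sf \<gamma> ?\<eta> = (\<lambda>j. ?\<eta> j - 2 * \<gamma> j)"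
          using \<open>p = 2\<close> unfolding sf_eq pair px[OF \<gamma>(1)] by (simp add: p_def)
        have "pairing N (cv \<theta>) (\<lambda>j. ?\<eta> j - 2 * \<gamma> j) = - 2"
          using \<open>k = 2\<close> unfolding pairing_diff pair px[OF \<theta>r] by (simp add: k_def coroot_root[OF \<theta>r])
        then have "sf \<theta> (sf \<gamma> ?\<eta>) = (\<lambda>j. (?\<eta> j - 2 * \<gamma> j) + 2 * \<theta> j)"
          unfolding 1 sf_eq[of \<theta>] by simp
        also have "\<dots> = (\<lambda>j. \<theta> j + (2 * int (Suc i)) * x j)"
          by (simp add: x_def algebra_simps)
        finally show ?case using sf_root[OF \<theta>r sf_root[OF \<gamma>(1) Suc]] by simp
      qed (simp add: \<theta>r)
      obtain j where "\<theta> j \<noteq> \<gamma> j" using \<gamma>(3) by (metis ext)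
      then have j: "x j \<noteq> 0" by (simp add: x_def)
      have "inj (\<lambda>i. \<lambda>j. \<theta> j + (2 * int i) * x j)"
      proof (rule injI)
        fix i i' assume "(\<lambda>j. \<theta> j + (2 * int i) * x j) = (\<lambda>j. \<theta> j + (2 * int i') * x j)"
        then have "\<theta> j + (2 * int i) * x j = \<theta> j + (2 * int i') * x j" by metis
        then show "i = i'" using j by simp
      qed
      moreover have "range (\<lambda>i. \<lambda>j. \<theta> j + (2 * int i) * x j) \<subseteq> \<Phi>0" using roots by auto
      ultimately show False using finite_roots finite_subset finite_imageD infinite_UNIV_nat by metis
    qed
  qed
  then show "pairing N (cv \<theta>) \<gamma> = 1" "(\<lambda>j. \<theta> j - \<gamma> j) \<in> nonneg_span base"
    using nonneg k1 by (simp_all add: k_def)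
qed


subsection \<open>The extended affine Weyl group\<close>

lemma tr_linear: "int_linear (tr \<mu>)"
  by (auto simp: int_linear_def translation_def pairing_comb fun_eq_iff algebra_simps)

lemma tr_zero: "tr (\<lambda>_. 0) = id"
  by (auto simp: translation_def pairing_def)

lemma tr_add: "tr \<mu> \<circ> tr \<nu> = tr (\<lambda>j. \<mu> j + \<nu> j)"
proof
  fix v
  have "pairing N (\<lambda>j. \<mu> j + \<nu> j) v = pairing N \<mu> v + pairing N \<nu> v"
    by (simp add: pairing_def distrib_right sum.distrib)
  then show "(tr \<mu> \<circ> tr \<nu>) v = tr (\<lambda>j. \<mu> j + \<nu> j) v"
    by (simp add: translation_def add_ac)
qed

lemma sf_linear: "int_linear (sf \<alpha>)"
  by (simp add: finite_refl_def reflection_linear)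

lemma sf_upd: "\<alpha> \<in> \<Phi>0 \<Longrightarrow> sf \<alpha> (v(N := k)) = (sf \<alpha> v)(N := k)"
  using root_N by (auto simp: sf_eq fun_eq_iff)

lemma sf_tr:
  assumes "\<alpha> \<in> \<Phi>0"
  shows "sf \<alpha> \<circ> tr \<mu> = tr (reflection N \<alpha> (cv \<alpha>) \<mu>) \<circ> sf \<alpha>"
proof
  fix v
  have sf_N: "sf \<alpha> v N = v N" using root_N[OF assms] by (simp add: sf_eq)
  have "sf \<alpha> (sf \<alpha> v) = v" using sf_sf[OF assms] by (metis comp_apply id_apply)
  then have "pairing N (reflection N \<alpha> (cv \<alpha>) \<mu>) (sf \<alpha> v) = pairing N \<mu> v"
    using pairing_sf[OF assms, of \<mu> "sf \<alpha> v"] by simp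
  then show "(sf \<alpha> \<circ> tr \<mu>) v = (tr (reflection N \<alpha> (cv \<alpha>) \<mu>) \<circ> sf \<alpha>) v"
    by (simp add: translation_def sf_upd[OF assms] sf_N)
qed

lemma finite_weyl_tr:
  assumes "w \<in> finite_weyl R" "\<mu> \<in> lattice N"
  shows "\<exists>\<nu>\<in>lattice N. w \<circ> tr \<mu> = tr \<nu> \<circ> w"
  using assms(1) unfolding finite_weyl_def
proof (induction rule: refl_group_induct)
  case id
  then show ?case using assms(2) by auto
next
  case (refl \<alpha> w)
  then obtain \<nu> where \<nu>: "\<nu> \<in> lattice N" "w \<circ> tr \<mu> = tr \<nu> \<circ> w" by blast
  let ?\<nu> = "reflection N \<alpha> (cv \<alpha>) \<nu>"
  have "(sf \<alpha> \<circ> w) \<circ> tr \<mu> = (sf \<alpha> \<circ> tr \<nu>) \<circ> w" by (simp only: comp_assoc \<nu>(2))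
  also have "\<dots> = tr ?\<nu> \<circ> (sf \<alpha> \<circ> w)" by (simp only: sf_tr[OF refl(1)] comp_assoc)
  finally show ?case
    using reflection_lattice[OF coroot_lattice[OF refl(1)] \<nu>(1)] by blast
qed

lemma EW_induct [consumes 1, case_names translation]:
  assumes "w \<in> EW" "\<And>\<mu> u. \<mu> \<in> lattice N \<Longrightarrow> u \<in> finite_weyl R \<Longrightarrow> P (tr \<mu> \<circ> u)"
  shows "P w"
  using assms by (auto simp: ext_affine_weyl_def)

lemma EWI: "\<mu> \<in> lattice N \<Longrightarrow> u \<in> finite_weyl R \<Longrightarrow> tr \<mu> \<circ> u \<in> EW"
  by (auto simp: ext_affine_weyl_def)

lemma zero_lattice: "(\<lambda>_. 0) \<in> lattice N"
  by (simp add: lattice_def)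

lemma EW_finite: "u \<in> finite_weyl R \<Longrightarrow> u \<in> EW"
  using EWI[OF zero_lattice, of u] by (simp add: tr_zero)

lemma EW_id: "id \<in> EW"
  by (rule EW_finite) (simp add: finite_weyl_def refl_group_id)

lemma EW_comp:
  assumes "w \<in> EW" "w' \<in> EW"
  shows "w \<circ> w' \<in> EW"
proof -
  obtain \<mu> u \<mu>' u' where w: "w = tr \<mu> \<circ> u" "\<mu> \<in> lattice N" "u \<in> finite_weyl R"
    "w' = tr \<mu>' \<circ> u'" "\<mu>' \<in> lattice N" "u' \<in> finite_weyl R"
    using assms by (auto simp: ext_affine_weyl_def)
  obtain \<nu> where \<nu>: "\<nu> \<in> lattice N" "u \<circ> tr \<mu>' = tr \<nu> \<circ> u" using finite_weyl_tr w by blast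
  have "w \<circ> w' = tr \<mu> \<circ> (u \<circ> tr \<mu>') \<circ> u'" by (simp only: w comp_assoc)
  also have "\<dots> = (tr \<mu> \<circ> tr \<nu>) \<circ> (u \<circ> u')" by (simp only: \<nu>(2) comp_assoc)
  finally have "w \<circ> w' = tr (\<lambda>j. \<mu> j + \<nu> j) \<circ> (u \<circ> u')" by (simp only: tr_add)
  moreover have "(\<lambda>j. \<mu> j + \<nu> j) \<in> lattice N" using w \<nu> by (simp add: lattice_def)
  moreover have "u \<circ> u' \<in> finite_weyl R" using w by (simp add: finite_weyl_def refl_group_comp)
  ultimately show ?thesis using EWI by simp
qed

lemma EW_inverse:
  assumes "w \<in> EW"
  shows "bij w" "inv w \<in> EW"
proof -
  obtain \<mu> u where w: "w = tr \<mu> \<circ> u" "\<mu> \<in> lattice N" "u \<in> finite_weyl R"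
    using assms by (auto simp: ext_affine_weyl_def)
  have u: "bij u" "inv u \<in> finite_weyl R"
    using refl_group_inverse[of \<Phi>0 sf u] sf_sf w(3) by (simp_all add: finite_weyl_def)
  let ?m = "tr (\<lambda>j. - \<mu> j)"
  have m: "?m \<circ> tr \<mu> = id" "tr \<mu> \<circ> ?m = id" by (simp_all add: tr_add tr_zero)
  have "bij (tr \<mu>)" using m by (rule o_bij)
  then show "bij w" using u(1) by (simp add: w(1) bij_comp)
  have "inv w = inv u \<circ> inv (tr \<mu>)"
    using o_inv_distrib[OF \<open>bij (tr \<mu>)\<close> u(1)] by (simp only: w(1))
  also have "inv (tr \<mu>) = ?m" using m by (intro inv_unique_comp)
  finally have "inv w = inv u \<circ> ?m" .
  moreover have "?m \<in> EW"
    using EWI[of "\<lambda>j. - \<mu> j" id] w(2) by (simp add: lattice_def finite_weyl_def refl_group_id)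
  ultimately show "inv w \<in> EW" using EW_comp[OF EW_finite[OF u(2)]] by simp
qed

lemma EW_linear: "w \<in> EW \<Longrightarrow> int_linear w"
proof (induction rule: EW_induct)
  case (translation \<mu> u)
  have "int_linear u"
    using translation(2) unfolding finite_weyl_def
  proof (induction rule: refl_group_induct)
    case id
    show ?case by (rule int_linear_id)
  next
    case (refl i w)
    then show ?case by (intro int_linear_comp sf_linear)
  qed
  then show ?case by (intro int_linear_comp tr_linear)
qed

lemma EW_form: "w \<in> EW \<Longrightarrow> form (w x) (w y) = form x y"
proof (induction rule: EW_induct)
  case (translation \<mu> u)
  have "form (u x) (u y) = form x y"
    using translation(2) unfolding finite_weyl_def
    by (induction rule: refl_group_induct) (simp_all add: form_sf)
  then show ?case by (simp only: comp_apply translation_def form_upd)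
qed

lemma EW_lattice:
  assumes "w \<in> EW" "N < M" "v \<in> lattice M"
  shows "w v \<in> lattice M"
  using assms(1)
proof (induction rule: EW_induct)
  case (translation \<mu> u)
  have "u v \<in> lattice M"
    using translation(2) unfolding finite_weyl_def
  proof (induction rule: refl_group_induct)
    case (refl \<alpha> w)
    have "\<alpha> \<in> lattice M" using root_lattice[OF refl(1)] assms(2) by (simp add: lattice_def)
    then show ?case using refl by (simp add: finite_refl_def reflection_lattice)
  qed (simp add: assms(3))
  then show ?case using assms(2) by (simp add: translation_def lattice_def)
qed

lemma EW_root:
  assumes "w \<in> EW" "\<alpha> \<in> \<Phi>0"
  shows "\<exists>\<beta>\<in>\<Phi>0. \<exists>c. \<forall>k. w (\<alpha>(N := k)) = \<beta>(N := k + c)"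
  using assms(1)
proof (induction rule: EW_induct)
  case (translation \<mu> u)
  have "\<exists>\<beta>\<in>\<Phi>0. \<forall>k. u (\<alpha>(N := k)) = \<beta>(N := k)"
    using translation(2) unfolding finite_weyl_def
  proof (induction rule: refl_group_induct)
    case id
    show ?case using assms(2) by auto
  next
    case (refl \<gamma> w)
    then obtain \<beta> where "\<beta> \<in> \<Phi>0" "\<forall>k. w (\<alpha>(N := k)) = \<beta>(N := k)" by blast
    then have "\<forall>k. (sf \<gamma> \<circ> w) (\<alpha>(N := k)) = (sf \<gamma> \<beta>)(N := k)" "sf \<gamma> \<beta> \<in> \<Phi>0"
      using sf_root[OF refl(1)] by (simp_all only: comp_apply sf_upd[OF refl(1)] simp_thms)
    then show ?case by blast
  qed
  then obtain \<beta> where \<beta>: "\<beta> \<in> \<Phi>0" "\<forall>k. u (\<alpha>(N := k)) = \<beta>(N := k)" by blast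
  have "tr \<mu> (\<beta>(N := k)) = \<beta>(N := k + pairing N \<mu> \<beta>)" for k
    by (simp add: translation_def)
  then have "\<forall>k. (tr \<mu> \<circ> u) (\<alpha>(N := k)) = \<beta>(N := k + pairing N \<mu> \<beta>)"
    by (simp only: comp_apply \<beta>(2) simp_thms)
  then show ?case using \<beta>(1) by blast
qed

lemma affine_refl_eq:
  "\<alpha> \<in> \<Phi>0 \<Longrightarrow> affine_refl R (\<alpha>(N := k)) v = (\<lambda>j. v j - pairing N (cv \<alpha>) v * (\<alpha>(N := k)) j)"
  by (simp add: affine_refl_def reflection_def root_upd_0)

lemma affine_refl_EW:
  assumes "\<alpha> \<in> \<Phi>0"
  shows "affine_refl R (\<alpha>(N := k)) \<in> EW"
proof -
  have "affine_refl R (\<alpha>(N := k)) = tr (\<lambda>j. k * cv \<alpha> j) \<circ> sf \<alpha>"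
  proof
    fix v
    have "pairing N (\<lambda>j. k * cv \<alpha> j) (sf \<alpha> v) = k * pairing N (cv \<alpha>) (sf \<alpha> v)"
      by (simp add: pairing_def sum_distrib_left mult.assoc)
    also have "\<dots> = - k * pairing N (cv \<alpha>) v"
      by (simp add: sf_eq pairing_diff coroot_root[OF assms])
    finally have "pairing N (\<lambda>j. k * cv \<alpha> j) (sf \<alpha> v) = - k * pairing N (cv \<alpha>) v" .
    moreover have "sf \<alpha> v N = v N" using root_N[OF assms] by (simp add: sf_eq)
    ultimately show "affine_refl R (\<alpha>(N := k)) v = (tr (\<lambda>j. k * cv \<alpha> j) \<circ> sf \<alpha>) v"
      using assms by (auto simp: affine_refl_eq translation_def fun_eq_iff sf_eq)
  qed
  moreover have "(\<lambda>j. k * cv \<alpha> j) \<in> lattice N" using coroot_lattice[OF assms] by (simp add: lattice_def)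
  moreover have "sf \<alpha> \<in> finite_weyl R" using assms by (simp add: finite_weyl_def refl_group_gen)
  ultimately show ?thesis using EWI by simp
qed

lemma affine_refl_conj:
  assumes w: "w \<in> EW" and \<alpha>: "\<alpha> \<in> \<Phi>0" and \<beta>: "\<beta> \<in> \<Phi>0"
    and eq: "w (\<alpha>(N := k)) = \<beta>(N := l) \<or> w (\<alpha>(N := k)) = wneg (\<beta>(N := l))"
  shows "affine_refl R (\<beta>(N := l)) \<circ> w = w \<circ> affine_refl R (\<alpha>(N := k))"
proof
  fix x
  let ?a = "\<alpha>(N := k)" and ?b = "\<beta>(N := l)"
  \<comment> \<open>The sign \<open>e\<close> enters twice and cancels.\<close>
  obtain e :: int where e: "e = 1 \<or> e = - 1" "w ?a = (\<lambda>j. e * ?b j)"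
  proof (cases "w ?a = ?b")
    case True
    then have "w ?a = (\<lambda>j. 1 * ?b j)" by (simp only: mult_1)
    then show ?thesis using that[of 1] by blast
  next
    case False
    then have "w ?a = (\<lambda>j. - 1 * ?b j)" using eq by (simp only: wneg_def mult_minus1) blast
    then show ?thesis using that[of "- 1"] by blast
  qed
  have scale: "form (\<lambda>j. e * u j) v = e * form u v" for u v
    using form_diff[of "\<lambda>_. 0" "- e" u v] by (simp add: form_def pairing_def)
  have ee: "e * e = 1" using e(1) by auto
  have "form \<alpha> x = form (w ?a) (w x)" by (simp add: EW_form[OF w])
  also have "\<dots> = e * form \<beta> (w x)" by (simp only: e(2) scale form_upd)
  finally have ax: "form \<alpha> x = e * form \<beta> (w x)" .
  have "form \<alpha> \<alpha> = form (w ?a) (w ?a)" by (simp add: EW_form[OF w])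
  also have "\<dots> = (e * e) * form ?b ?b"
    by (simp only: e(2) scale form_commute[of ?b "\<lambda>j. e * ?b j"] mult.assoc)
  also have "\<dots> = form \<beta> \<beta>" by (simp only: ee form_upd mult_1)
  finally have aa: "form \<alpha> \<alpha> = form \<beta> \<beta>" .
  have "pairing N (cv \<alpha>) x * form \<beta> \<beta> = e * pairing N (cv \<beta>) (w x) * form \<beta> \<beta>"
    using coroot_form[OF \<alpha>, of x] coroot_form[OF \<beta>, of "w x"] ax aa by simp
  then have p: "pairing N (cv \<alpha>) x = e * pairing N (cv \<beta>) (w x)" using form_pos[OF \<beta>] by simp
  have "w (affine_refl R ?a x) = (\<lambda>j. w x j - pairing N (cv \<alpha>) x * w ?a j)"
    unfolding affine_refl_eq[OF \<alpha>] by (rule int_linear_diff[OF EW_linear[OF w]])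
  also have "\<dots> = (\<lambda>j. w x j - (e * e) * pairing N (cv \<beta>) (w x) * ?b j)"
    unfolding e(2) p by (simp only: mult_ac)
  also have "\<dots> = affine_refl R ?b (w x)" unfolding affine_refl_eq[OF \<beta>] ee by simp
  finally show "(affine_refl R ?b \<circ> w) x = (w \<circ> affine_refl R ?a) x" by simp
qed

abbreviation "P \<equiv> affine_pos_re R"

lemma posE:
  assumes "v \<in> P"
  obtains \<alpha> k where "v = \<alpha>(N := k)" "\<alpha> \<in> \<Phi>0" "k > 0 \<or> k = 0 \<and> \<alpha> \<in> nonneg_span base"
  using assms by (auto simp: affine_pos_re_def)

lemma affine_root_eq_iff: "\<alpha> \<in> \<Phi>0 \<Longrightarrow> \<beta> \<in> \<Phi>0 \<Longrightarrow> \<alpha>(N := k) = \<beta>(N := l) \<longleftrightarrow> \<alpha> = \<beta> \<and> k = l"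
  by (metis fun_upd_same fun_upd_upd root_upd_0)

lemma wneg_upd: "wneg (\<alpha>(N := k)) = (wneg \<alpha>)(N := - k)"
  by (auto simp: wneg_def)

lemma pos_iff: "\<alpha> \<in> \<Phi>0 \<Longrightarrow> \<alpha>(N := k) \<in> P \<longleftrightarrow> k > 0 \<or> k = 0 \<and> \<alpha> \<in> nonneg_span base"
  unfolding affine_pos_re_def by (auto simp: affine_root_eq_iff)

lemma affine_root_sign: "\<alpha> \<in> \<Phi>0 \<Longrightarrow> \<alpha>(N := k) \<in> P \<or> wneg (\<alpha>(N := k)) \<in> P"
  using root_sign[of \<alpha>] unfolding wneg_upd by (auto simp: pos_iff root_neg)

lemma base_pos: "\<beta> \<in> base \<Longrightarrow> \<beta> = \<beta>(N := 0) \<and> \<beta>(N := 0) \<in> P"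
  using base_roots base_nonneg pos_iff root_upd_0 by (metis subsetD)

lemma highest_simple:
  "\<theta> \<in> highest_roots R \<Longrightarrow> (\<lambda>j. - \<theta> j)(N := 1) = (wneg \<theta>)(N := 1) \<and> (wneg \<theta>)(N := 1) \<in> P"
  using root_neg[OF highestD(1)] by (auto simp: pos_iff wneg_def[symmetric])

lemma affine_simpleE:
  assumes "v \<in> affine_simple R"
  obtains (base) \<beta> where "\<beta> \<in> base" "v = \<beta>(N := 0)"
  | (highest) \<theta> where "\<theta> \<in> highest_roots R" "v = (wneg \<theta>)(N := 1)"
  using assms base_pos highest_simple unfolding affine_simple_def by blast

text \<open>
  The reflection in \<open>\<delta> - \<theta>\<close> adds the pairing with \<open>\<theta>\<^sup>\<or>\<close> to the coefficient of \<open>\<delta>\<close>. By the properties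
  of highest roots it lowers that coefficient by at most one, except on the roots \<open>k \<delta> - \<theta>\<close>,
  and where \<open>\<delta> - \<gamma>\<close> loses its \<open>\<delta>\<close> the result \<open>\<theta> - \<gamma>\<close> is positive.
\<close>

lemma affine_simple_refl_pos:
  assumes "b \<in> affine_simple R" "v \<in> P" "v \<noteq> b"
  shows "affine_refl R b v \<in> P"
proof -
  obtain \<gamma> k where v: "v = \<gamma>(N := k)" "\<gamma> \<in> \<Phi>0" "k > 0 \<or> k = 0 \<and> \<gamma> \<in> nonneg_span base"
    using assms(2) by (rule posE)
  show ?thesis
    using assms(1)
  proof (cases rule: affine_simpleE)
    case (base \<beta>)
    have \<beta>: "\<beta> \<in> \<Phi>0" using base base_roots by blast
    have "affine_refl R b v = (sf \<beta> \<gamma>)(N := k)"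
      unfolding base(2) v(1) affine_refl_eq[OF \<beta>] using root_N[OF \<beta>] by (auto simp: sf_eq fun_eq_iff)
    moreover have "k > 0 \<or> k = 0 \<and> sf \<beta> \<gamma> \<in> nonneg_span base"
      using v simple_refl_nonneg[OF base(1) v(2)] assms(3) base by auto
    ultimately show ?thesis using sf_root[OF \<beta> v(2)] by (simp add: pos_iff)
  next
    case (highest \<theta>)
    have \<theta>: "\<theta> \<in> \<Phi>0" using highestD(1) highest by blast
    define c where "c = pairing N (cv \<theta>) \<gamma>"
    have eq: "affine_refl R b v = (sf \<theta> \<gamma>)(N := k + c)"
      using \<theta> root_neg[OF \<theta>] coroot_neg[OF \<theta>]
      by (auto simp: highest v affine_refl_eq sf_eq c_def wneg_def fun_eq_iff)
    have "k + c > 0 \<or> k + c = 0 \<and> sf \<theta> \<gamma> \<in> nonneg_span base"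
    proof (cases "\<gamma> \<in> nonneg_span base")
      case True
      have "0 \<le> c" unfolding c_def by (rule highest_coroot_nonneg[OF highest(1) v(2) True])
      moreover have "sf \<theta> \<gamma> = \<gamma>" if "c = 0" using that by (simp add: sf_eq c_def)
      ultimately show ?thesis using v(3) by fastforce
    next
      case False
      let ?\<gamma> = "wneg \<gamma>"
      have \<gamma>: "?\<gamma> \<in> \<Phi>0" "?\<gamma> \<in> nonneg_span base" using False v(2) root_sign root_neg by blast+
      have k: "0 < k" using v(3) False by simp
      have c: "pairing N (cv \<theta>) ?\<gamma> = - c" by (simp add: pairing_wneg c_def)
      have "0 \<le> - c" using highest_coroot_nonneg[OF highest(1) \<gamma>] by (simp only: c)
      consider "?\<gamma> = \<theta>" | "?\<gamma> \<noteq> \<theta>" "c = 0" | "?\<gamma> \<noteq> \<theta>" "1 \<le> - c" using \<open>0 \<le> - c\<close> by linarith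
      then show ?thesis
      proof cases
        case 1
        then have \<gamma>': "\<gamma> = wneg \<theta>" by (metis wneg_wneg)
        have "c = - 2" using c 1 coroot_root[OF \<theta>] by simp
        moreover have "k \<noteq> 1" using assms(3) by (auto simp: v highest \<gamma>')
        moreover have "sf \<theta> \<gamma> = \<theta>" using \<open>c = - 2\<close> by (simp add: sf_eq flip: c_def) (simp add: \<gamma>' wneg_def)
        ultimately show ?thesis using k highest_nonneg[OF highest(1)] by auto
      next
        case 2
        then show ?thesis using k by simp
      next
        case 3
        then have c1: "c = - 1" and nn: "(\<lambda>j. \<theta> j - ?\<gamma> j) \<in> nonneg_span base"
          using highest_coroot_le_1[OF highest(1) \<gamma>] c by simp_all
        have "sf \<theta> \<gamma> = (\<lambda>j. \<theta> j - ?\<gamma> j)" using c1 by (simp add: sf_eq wneg_def add.commute flip: c_def)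
        then show ?thesis using nn c1 k by auto
      qed
    qed
    then show ?thesis unfolding eq using sf_root[OF \<theta> v(2)] by (simp add: pos_iff)
  qed
qed

text \<open>
  The simple affine roots generate the positive ones: \<open>\<delta> = \<theta> + (\<delta> - \<theta>)\<close>, and
  \<open>\<delta> - \<gamma> = (\<theta> - \<gamma>) + (\<delta> - \<theta>)\<close> for a highest root \<open>\<theta>\<close> above \<open>\<gamma>\<close>.
\<close>

lemma affine_simple_generate:
  assumes w: "w \<in> EW" and simple: "\<And>b. b \<in> affine_simple R \<Longrightarrow> w b \<in> P" and v: "v \<in> P"
  shows "w v \<in> P"
proof -
  \<comment> \<open>An additive cone whose only affine roots are the positive ones.\<close>
  define C where "C = {v. 0 < v N} \<union> nonneg_span base"
  have nonneg_N: "u N = 0" if "u \<in> nonneg_span base" for u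
    using that base_roots root_N by (auto simp: nonneg_span_def subset_iff intro!: sum.neutral)
  have C_add: "(\<lambda>j. x j + y j) \<in> C" if "x \<in> C" "y \<in> C" for x y
    using that nonneg_add[of x y] nonneg_N[of x] nonneg_N[of y] by (auto simp: C_def)
  define G where "G = {v. w v \<in> C}"
  have wlin: "int_linear w" using w by (rule EW_linear)
  have zero: "(\<lambda>_. 0) \<in> G"
    using zero_nonneg by (simp add: G_def C_def int_linear_0[OF wlin])
  have G_add: "(\<lambda>j. x j + y j) \<in> G" if "x \<in> G" "y \<in> G" for x y
    using that C_add[of "w x" "w y"] int_linearD[OF wlin, of 1 x 1 y] by (simp add: G_def)
  have G_scale: "(\<lambda>j. int k * x j) \<in> G" if "x \<in> G" for x k
  proof (induction k)
    case (Suc k)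
    then show ?case using G_add[OF that Suc] by (simp add: distrib_right)
  qed (simp add: zero)
  have P_C: "P \<subseteq> C" by (auto simp: C_def root_upd_0 elim!: posE)
  have simple_G: "b \<in> G" if "b \<in> affine_simple R" for b using simple[OF that] P_C by (auto simp: G_def)
  have nonneg_G: "u \<in> G" if u: "u \<in> nonneg_span base" for u
  proof -
    obtain k where k: "u = (\<lambda>j. \<Sum>b\<in>base. int (k b) * b j)"
      using u by (auto simp: nonneg_span_def)
    have "(\<lambda>j. \<Sum>b\<in>B. int (k b) * b j) \<in> G" if "finite B" "B \<subseteq> base" for B
      using that
    proof (induction B)
      case (insert b B)
      then have "(\<lambda>j. int (k b) * b j) \<in> G" by (intro G_scale simple_G) (simp add: affine_simple_def)
      then show ?case using insert G_add by simp
    qed (simp add: zero)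
    then show ?thesis using finite_base k by simp
  qed
  let ?\<delta> = "(\<lambda>_. 0)(N := 1)"
  obtain \<alpha> k where \<alpha>: "v = \<alpha>(N := k)" "\<alpha> \<in> \<Phi>0" "k > 0 \<or> k = 0 \<and> \<alpha> \<in> nonneg_span base"
    using v by (rule posE)
  have above: "\<exists>\<theta>\<in>highest_roots R. (\<lambda>j. \<theta> j - \<gamma> j) \<in> G" if "\<gamma> \<in> \<Phi>0" for \<gamma>
    using highest_above[OF that] nonneg_G by blast
  have \<theta>G: "(wneg \<theta>)(N := 1) \<in> G" if "\<theta> \<in> highest_roots R" for \<theta>
    using that highest_simple[OF that] by (intro simple_G) (auto simp: affine_simple_def)
  have \<delta>: "?\<delta> \<in> G"
  proof -
    obtain \<theta> where \<theta>: "\<theta> \<in> highest_roots R" using above[OF \<alpha>(2)] by blast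
    have "?\<delta> = (\<lambda>j. \<theta> j + ((wneg \<theta>)(N := 1)) j)"
      using root_N[OF highestD(1)[OF \<theta>]] by (auto simp: wneg_def)
    then show ?thesis using G_add[OF nonneg_G[OF highest_nonneg[OF \<theta>]] \<theta>G[OF \<theta>]] by simp
  qed
  have "v \<in> G"
  proof (cases "\<alpha> \<in> nonneg_span base")
    case True
    have "v = (\<lambda>j. \<alpha> j + int (nat k) * ?\<delta> j)"
      using \<alpha> root_N[OF \<alpha>(2)] by auto
    moreover have "(\<lambda>j. \<alpha> j + int (nat k) * ?\<delta> j) \<in> G"
      by (rule G_add[OF nonneg_G[OF True] G_scale[OF \<delta>]])
    ultimately show ?thesis by (simp only:)
  next
    case False
    then have k: "0 < k" using \<alpha>(3) by simp
    obtain \<theta> where \<theta>: "\<theta> \<in> highest_roots R" "(\<lambda>j. \<theta> j - wneg \<alpha> j) \<in> G"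
      using above[OF root_neg[OF \<alpha>(2)]] by blast
    have "v = (\<lambda>j. ((\<theta> j - wneg \<alpha> j) + ((wneg \<theta>)(N := 1)) j) + int (nat (k - 1)) * ?\<delta> j)"
      using k \<alpha> root_N[OF \<alpha>(2)] root_N[OF highestD(1)[OF \<theta>(1)]] by (auto simp: wneg_def)
    moreover have "(\<lambda>j. ((\<theta> j - wneg \<alpha> j) + ((wneg \<theta>)(N := 1)) j) + int (nat (k - 1)) * ?\<delta> j) \<in> G"
      by (rule G_add[OF G_add[OF \<theta>(2) \<theta>G[OF \<theta>(1)]] G_scale[OF \<delta>]])
    ultimately show ?thesis by (simp only:)
  qed
  then have wv: "w v \<in> C" by (simp add: G_def)
  obtain \<beta> c where \<beta>: "\<beta> \<in> \<Phi>0" "w v = \<beta>(N := k + c)" using EW_root[OF w \<alpha>(2)] \<alpha>(1) by blast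
  show ?thesis
  proof (cases "0 < k + c")
    case True
    then show ?thesis using \<beta> by (simp add: pos_iff)
  next
    case False
    then have nn: "\<beta>(N := k + c) \<in> nonneg_span base" using wv \<beta>(2) by (simp add: C_def)
    then have "k + c = 0" using nonneg_N[OF nn] by simp
    moreover from this have "\<beta> \<in> nonneg_span base" using nn \<beta>(1) by (simp add: root_upd_0)
    ultimately show ?thesis unfolding \<beta>(2) pos_iff[OF \<beta>(1)] by simp
  qed
qed

lemma finite_affine_negated:
  assumes "w \<in> EW"
  shows "finite {v \<in> P. w v \<notin> P}"
proof -
  have "\<forall>\<alpha>. \<exists>\<beta> c. \<alpha> \<in> \<Phi>0 \<longrightarrow> \<beta> \<in> \<Phi>0 \<and> (\<forall>k. w (\<alpha>(N := k)) = \<beta>(N := k + c))"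
    using EW_root[OF assms] by blast
  then obtain b c where bc: "\<And>\<alpha>. \<alpha> \<in> \<Phi>0 \<Longrightarrow> b \<alpha> \<in> \<Phi>0 \<and> (\<forall>k. w (\<alpha>(N := k)) = (b \<alpha>)(N := k + c \<alpha>))"
    by metis
  have "{v \<in> P. w v \<notin> P} \<subseteq> (\<lambda>(\<alpha>, k). \<alpha>(N := k)) ` (SIGMA \<alpha>:\<Phi>0. {0..- c \<alpha>})"
  proof
    fix v assume "v \<in> {v \<in> P. w v \<notin> P}"
    then obtain \<alpha> k where \<alpha>: "v = \<alpha>(N := k)" "\<alpha> \<in> \<Phi>0" "0 \<le> k" "w v \<notin> P"
      by (auto elim!: posE)
    then have "(b \<alpha>)(N := k + c \<alpha>) \<notin> P" using bc by simp
    then have "k + c \<alpha> \<le> 0" using bc[OF \<alpha>(2)] by (auto simp: pos_iff)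
    then show "v \<in> (\<lambda>(\<alpha>, k). \<alpha>(N := k)) ` (SIGMA \<alpha>:\<Phi>0. {0..- c \<alpha>})"
      using \<alpha> by (intro image_eqI[of _ _ "(\<alpha>, k)"]) auto
  qed
  then show ?thesis
    by (rule finite_subset) (intro finite_imageI finite_SigmaI finite_roots finite_atLeastAtMost_int)
qed

lemma affine_pos_proportional:
  assumes "u \<in> P" "v \<in> P" "a \<noteq> 0" "\<And>j. a * u j = b * v j"
  shows "u = v"
proof -
  obtain \<alpha> k where u: "u = \<alpha>(N := k)" "\<alpha> \<in> \<Phi>0" "k > 0 \<or> k = 0 \<and> \<alpha> \<in> nonneg_span base"
    using assms(1) by (rule posE)
  obtain \<beta> l where v: "v = \<beta>(N := l)" "\<beta> \<in> \<Phi>0" "l > 0 \<or> l = 0 \<and> \<beta> \<in> nonneg_span base"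
    using assms(2) by (rule posE)
  have eq: "a * \<alpha> j = b * \<beta> j" for j
    using assms(4)[of j] root_N[OF u(2)] root_N[OF v(2)] by (cases "j = N") (auto simp: u v)
  have kl: "a * k = b * l" using assms(4)[of N] by (simp add: u v)
  obtain j where j: "\<alpha> j \<noteq> 0" using root_nonzero[OF u(2)] by auto
  then have "b \<noteq> 0" using eq[of j] assms(3) by auto
  then consider "\<beta> = \<alpha>" | "\<beta> = wneg \<alpha>" using reduced[OF u(2) v(2) assms(3) _ eq] by blast
  then show ?thesis
  proof cases
    case 1
    then have "a = b" using eq[of j] j by simp
    then show ?thesis using kl assms(3) 1 u v by simp
  next
    case 2
    then have "(a + b) * \<alpha> j = 0" using eq[of j] by (simp add: wneg_def distrib_right)
    then have "a = - b" using j by simp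
    then have "b * (k + l) = 0" using kl by (simp add: distrib_left)
    then have "k = - l" using \<open>b \<noteq> 0\<close> by simp
    then have "k = 0" "l = 0" using u(3) v(3) by auto
    then show ?thesis using u v 2 root_not_both[OF u(2)] by simp
  qed
qed

lemma affine_setting_simps:
  "rank (ext_affine_setting R) = N + 1 + (if rd_dil R then 1 else 0)"
  "imag_roots (ext_affine_setting R) = affine_imag R" "weyl_group (ext_affine_setting R) = EW"
  "Omega (ext_affine_setting R) = ext_affine_Omega R" "simple (ext_affine_setting R) = affine_simple R"
  "pos_re (ext_affine_setting R) = P" "refl (ext_affine_setting R) = affine_refl R"
  by (simp_all add: ext_affine_setting_def)

lemma affine_weyl_setting: "weyl_setting (ext_affine_setting R)"
proof (unfold_locales, unfold affine_setting_simps)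
  let ?M = "N + 1 + (if rd_dil R then 1 else 0)"
  show "id \<in> EW" by (rule EW_id)
  show "u \<circ> w \<in> EW" if "u \<in> EW" "w \<in> EW" for u w using that by (rule EW_comp)
  show "inv w \<in> EW" if "w \<in> EW" for w using that by (rule EW_inverse)
  show "bij w" if "w \<in> EW" for w using that by (rule EW_inverse)
  show "int_linear w" if "w \<in> EW" for w using that by (rule EW_linear)
  show "w v \<in> lattice ?M" if "w \<in> EW" "v \<in> lattice ?M" for w v
    by (rule EW_lattice[OF that(1) _ that(2)]) simp
  show "v \<in> lattice ?M" if "v \<in> P" for v
    using that root_lattice by (auto simp: lattice_def elim!: posE)
  show "wneg v \<notin> P" if "v \<in> P" for v
    using that
  proof (rule posE)
    fix \<alpha> k assume \<alpha>: "v = \<alpha>(N := k)" "\<alpha> \<in> \<Phi>0" "k > 0 \<or> k = 0 \<and> \<alpha> \<in> nonneg_span base"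
    show "wneg v \<notin> P"
      unfolding \<alpha>(1) wneg_upd pos_iff[OF root_neg[OF \<alpha>(2)]]
      using \<alpha>(3) root_not_both[OF \<alpha>(2)] by auto
  qed
  show "u = v" if "u \<in> P" "v \<in> P" "a \<noteq> 0" "\<And>j. a * u j = b * v j" for u v a b
    using that by (rule affine_pos_proportional)
  show "w v \<in> P \<or> wneg (w v) \<in> P" if w: "w \<in> EW" and v: "v \<in> P" for w v
  proof -
    obtain \<alpha> k where \<alpha>: "v = \<alpha>(N := k)" "\<alpha> \<in> \<Phi>0" using v by (rule posE)
    obtain \<beta> c where "\<beta> \<in> \<Phi>0" "w v = \<beta>(N := k + c)" using EW_root[OF w \<alpha>(2)] \<alpha>(1) by blast
    then show ?thesis using affine_root_sign by simp
  qed
  show "affine_refl R v \<in> EW" if "v \<in> P" for v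
    using that by (elim posE) (simp add: affine_refl_EW)
  show "\<exists>c. affine_refl R v x = (\<lambda>j. x j - c * v j)" if "v \<in> P" for v x
    using that by (elim posE) (auto simp: affine_refl_eq)
  show "affine_refl R v v = wneg v" if "v \<in> P" for v
    using that by (elim posE) (auto simp: affine_refl_eq coroot_root wneg_def)
  show "affine_refl R v \<circ> w = w \<circ> affine_refl R u"
    if "w \<in> EW" "u \<in> P" "v \<in> P" "w u = v \<or> w u = wneg v" for w u v
    using that by (elim posE) (simp only: affine_refl_conj)
  show "b \<in> P" if "b \<in> affine_simple R" for b
    using that
  proof (cases rule: affine_simpleE)
    case (base \<beta>)
    then show ?thesis using base_pos[of \<beta>] by metis
  next
    case (highest \<theta>)
    then show ?thesis using highest_simple by metis
  qed
  show "affine_refl R b v \<in> P" if "b \<in> affine_simple R" "v \<in> P" "v \<noteq> b" for b v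
    using that by (rule affine_simple_refl_pos)
  show "finite {v \<in> P. w v \<notin> P}" if "w \<in> EW" for w using that by (rule finite_affine_negated)
  show "w v \<in> P" if "w \<in> EW" "\<And>b. b \<in> affine_simple R \<Longrightarrow> w b \<in> P" "v \<in> P" for w v
    using that by (rule affine_simple_generate)
  show "\<eta> \<in> lattice ?M" if "\<eta> \<in> affine_imag R" for \<eta>
    using that by (auto simp: affine_imag_def lattice_def unit_vec_def)
  show "a = 0" if \<eta>: "\<eta> \<in> affine_imag R" and v: "v \<in> P" and eq: "\<And>j. a * v j = b * \<eta> j" for \<eta> v a b
  proof -
    obtain \<alpha> k where \<alpha>: "v = \<alpha>(N := k)" "\<alpha> \<in> \<Phi>0" using v by (rule posE)
    obtain j where j: "\<alpha> j \<noteq> 0" using root_nonzero[OF \<alpha>(2)] by auto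
    then have "j \<noteq> N" using root_N[OF \<alpha>(2)] by auto
    then show "a = 0" using eq[of j] \<eta> j by (auto simp: \<alpha> affine_imag_def unit_vec_def)
  qed
  show "\<eta> \<noteq> (\<lambda>_. 0)" if "\<eta> \<in> affine_imag R" for \<eta>
    using that by (auto simp: affine_imag_def unit_vec_def fun_eq_iff)
  show "ext_affine_Omega R = {\<omega> \<in> EW. \<forall>v\<in>P. \<omega> v \<in> P}"
    by (auto simp: ext_affine_Omega_def)
qed

end


section \<open>Residue conditions for the conjugate intersection\<close>

theorem theorem2p5:
  fixes D :: setting and m :: "weight \<Rightarrow> nat"
  assumes "kac_moody_case D \<or> ext_affine_case D"
    and "admissible_collection D m"
  shows "nil_Hecke_Sigma D m =
    {f \<in> QW D.
       (\<forall>w\<in>weyl_group D. only_simple_real_poles D (f w)) \<and>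
       (\<forall>w\<in>weyl_group D. \<forall>\<alpha>\<in>pos_re D.
          Res D \<alpha> (f w) + Res D \<alpha> (f (refl D \<alpha> \<circ> w)) = restrict_hyp D \<alpha> 0) \<and>
       (\<forall>w\<in>weyl_group D. \<forall>\<alpha>\<in>pos_re D.
          Res D \<alpha> (Pi_ratio D m (act_coll w m) * f w) +
          Res D \<alpha> (Pi_ratio D m (act_coll (refl D \<alpha> \<circ> w) m) * f (refl D \<alpha> \<circ> w))
            = restrict_hyp D \<alpha> 0) \<and>
       (\<forall>w\<in>weyl_group D. only_simple_real_poles D (f w / Pi_tilde_den D m w))}"
  using assms(1)
proof
  assume "kac_moody_case D"
  then obtain K where K: "km_root_datum K" and D: "D = km_setting K"
    by (auto simp: kac_moody_case_def)
  interpret kac_moody K by standard (rule K)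
  show ?thesis
    using assms(2) unfolding D by (rule weyl_setting.nil_Hecke_Sigma_residues[OF km_weyl_setting])
next
  assume "ext_affine_case D"
  then obtain R where R: "reductive_root_datum R" and D: "D = ext_affine_setting R"
    by (auto simp: ext_affine_case_def)
  interpret affine R by standard (rule R)
  show ?thesis
    using assms(2) unfolding D by (rule weyl_setting.nil_Hecke_Sigma_residues[OF affine_weyl_setting])
qed

end
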